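(* Let $n\ge1$ and $s\in(0,1)$. There exists a constant $\Theta=\Theta(n,s)>1$ such that the following holds. Let $\Omega\subset\mathbb{R}^n$ be a bounded open set with Lipschitz boundary, let $A\subset\Omega$ be an open set, $\psi\in L^\infty(A)$, and let $\varphi:\mathbb{R}^n\to\mathbb{R}$ be such that $\varphi\in L^\infty(\Omega_{\Theta\,\mathrm{diam}(\Omega)}\setminus\Omega)$. Then the obstacle problem in $\Omega$ with exterior data $\varphi$ and obstacle $\psi$ in $A$ has a unique solution $u\in\mathcal{W}^s_{\varphi,\psi}(\Omega,A)$, and its subgraph $\mathcal{S}g(u)$ solves the geometric obstacle problem.
   Context: For $\delta\in\mathbb{R}$, $\Omega_\delta:=\{x\in\mathbb{R}^n:\bar d_\Omega(x)<\delta\}$, where $\bar d_\Omega(x)=d(x,\Omega)-d(x,\mathbb{R}^n\setminus\Omega)$ is the signed distance from $\partial\Omega$, negative inside $\Omega$. Obstacle problem. Set $g_s(t)=(1+t^2)^{-\frac{n+1+s}{2}}$, $G_s(t)=\int_0^t g_s(\tau)\,d\tau$, $\mathcal{G}_s(t)=\int_0^tG_s(\tau)\,d\tau$, and $Q(\Omega)=\mathbb{R}^{2n}\setminus(\mathbb{R}^n\setminus\Omega)^2$. Functions are measurable and identified when equal a.e. $\mathcal{W}^s(\Omega)$ is the set of $u:\mathbb{R}^n\to\mathbb{R}$ with $u|_\Omega\in W^{s,1}(\Omega)$, i.e. $\|u\|_{L^1(\Omega)}+\int_\Omega\int_\Omega\frac{|u(x)-u(y)|}{|x-y|^{n+s}}\,dx\,dy<\infty$.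 For $A\subset\Omega$ open and $\psi\in L^\infty(A)$, $$\mathcal{W}^s_{\varphi,\psi}(\Omega,A):=\{u\in\mathcal{W}^s(\Omega):u=\varphi\text{ on }\mathbb{R}^n\setminus\Omega,\ u\ge\psi\text{ a.e. in }A\}.$$ A function $u$ solves the obstacle problem (in $\Omega$, with exterior data $\varphi$ and obstacle $\psi$ in $A$) if $u\in\mathcal{W}^s_{\varphi,\psi}(\Omega,A)$ and for every $v\in\mathcal{W}^s_{\varphi,\psi}(\Omega,A)$ $$\iint_{Q(\Omega)}\left\{\mathcal{G}_s\Big(\tfrac{u(x)-u(y)}{|x-y|}\Big)-\mathcal{G}_s\Big(\tfrac{v(x)-v(y)}{|x-y|}\Big)\right\}\frac{dx\,dy}{|x-y|^{n-1+s}}\le0.$$ Geometric obstacle problem. For a function $u:\mathcal{A}\to\mathbb{R}$, $\mathcal{A}\subset\mathbb{R}^n$, let $\mathcal{S}g(u,\mathcal{A})=\{(x,x_{n+1})\in\mathcal{A}\times\mathbb{R}:x_{n+1}<u(x)\}$ and $\mathcal{S}g(u)=\mathcal{S}g(u,\mathbb{R}^n)$ when $\mathcal A=\mathbb{R}^n$. Let $\Omega^\infty=\Omega\times\mathbb{R}$, $\Omega^M=\Omega\times(-M,M)$. For a bounded open set $\mathcal{O}\subset\mathbb{R}^{n+1}$ with Lipschitz boundary and measurable $E\subset\mathbb{R}^{n+1}$, $$\mathrm{Per}_s(E,\mathcal{O})=\iint_{\mathbb{R}^{2(n+1)}\setminus(\mathbb{R}^{n+1}\setminus\mathcal{O})^2}\frac{|\chi_E(X)-\chi_E(Y)|}{|X-Y|^{n+1+s}}\,dX\,dY.$$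 A set $E\subset\mathbb{R}^{n+1}$ with $E\setminus\Omega^\infty=\mathcal{S}g(\varphi)\setminus\Omega^\infty$ and $\mathcal{S}g(\psi,A)\subset E$ solves the geometric obstacle problem if for every $M\ge\|\psi\|_{L^\infty(A)}$ one has $\mathrm{Per}_s(E,\Omega^M)<\infty$ and $\mathrm{Per}_s(E,\Omega^M)\le\mathrm{Per}_s(F,\Omega^M)$ for every $F\subset\mathbb{R}^{n+1}$ with $F\setminus\Omega^M=E\setminus\Omega^M$ and $\mathcal{S}g(\psi,A)\subset F$. Sets are measurable and all set relations are understood up to sets of Lebesgue measure zero. *)

theory Defs
  imports "HOL-Analysis.Analysis" "HOL-Probability.Essential_Supremum"
begin

text \<open>
  Euclidean n-space is a type of class \<open>euclidean_space\<close>, with n written as \<open>DIM('a)\<close>;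
  (n+1)-space is \<open>'a \<times> real\<close>, whose library norm is the Euclidean one. ``Measurable'' means
  Lebesgue measurable, and every a.e. qualifier refers to \<open>lebesgue\<close>.
\<close>

text \<open>\<open>infdist\<close> to the empty set is 0 rather than infinity, so the formula is the usual one for
  nonempty \<open>\<Omega> \<noteq> UNIV\<close>.\<close>

definition signed_dist :: "'a::euclidean_space set \<Rightarrow> 'a \<Rightarrow> real" where
  "signed_dist \<Omega> x = infdist x \<Omega> - infdist x (- \<Omega>)"

definition enlarged :: "'a::euclidean_space set \<Rightarrow> real \<Rightarrow> 'a set" where
  "enlarged \<Omega> \<delta> = {x. signed_dist \<Omega> x < \<delta>}"

text \<open>
  Near each boundary point the set is the strict epigraph of a Lipschitz function of n-1 variables
  in suitable orthonormal coordinates. The direction of the last coordinate is the unit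
  vector \<open>\<nu>\<close>, and the function lives on the hyperplane orthogonal to it.
\<close>

definition lipschitz_boundary :: "'a::euclidean_space set \<Rightarrow> bool" where
  "lipschitz_boundary \<Omega> \<longleftrightarrow>
     (\<forall>p\<in>frontier \<Omega>. \<exists>r>0. \<exists>\<nu> \<gamma> K. norm \<nu> = 1 \<and> K-lipschitz_on {z. z \<bullet> \<nu> = 0} \<gamma> \<and>
        \<Omega> \<inter> ball p r = {x \<in> ball p r. \<gamma> (x - (x \<bullet> \<nu>) *\<^sub>R \<nu>) < x \<bullet> \<nu>})"

text \<open>The supremum is taken in \<open>ennreal\<close>, so the norm is 0 when \<open>A\<close> is a null set.\<close>

definition Linf_norm :: "'a::euclidean_space set \<Rightarrow> ('a \<Rightarrow> real) \<Rightarrow> ennreal" where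
  "Linf_norm A f = esssup (lebesgue_on A) (\<lambda>x. ennreal \<bar>f x\<bar>)"

definition Linf :: "'a::euclidean_space set \<Rightarrow> ('a \<Rightarrow> real) set" where
  "Linf A = {f. f \<in> borel_measurable (lebesgue_on A) \<and> Linf_norm A f < \<infinity>}"

definition Ws1_norm :: "real \<Rightarrow> 'a::euclidean_space set \<Rightarrow> ('a \<Rightarrow> real) \<Rightarrow> ennreal" where
  "Ws1_norm s \<Omega> u =
     (\<integral>\<^sup>+x\<in>\<Omega>. ennreal \<bar>u x\<bar> \<partial>lebesgue) +
     (\<integral>\<^sup>+x\<in>\<Omega>. (\<integral>\<^sup>+y\<in>\<Omega>. ennreal (\<bar>u x - u y\<bar> / norm (x - y) powr (real DIM('a) + s))
        \<partial>lebesgue) \<partial>lebesgue)"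

definition Ws :: "real \<Rightarrow> 'a::euclidean_space set \<Rightarrow> ('a \<Rightarrow> real) set" where
  "Ws s \<Omega> = {u \<in> borel_measurable lebesgue. Ws1_norm s \<Omega> u < \<infinity>}"

definition Ws_obs ::
  "real \<Rightarrow> 'a::euclidean_space set \<Rightarrow> 'a set \<Rightarrow> ('a \<Rightarrow> real) \<Rightarrow> ('a \<Rightarrow> real) \<Rightarrow> ('a \<Rightarrow> real) set" where
  "Ws_obs s \<Omega> A \<phi> \<psi> =
     {u \<in> Ws s \<Omega>. (AE x in lebesgue. x \<notin> \<Omega> \<longrightarrow> u x = \<phi> x) \<and>
                  (AE x in lebesgue. x \<in> A \<longrightarrow> \<psi> x \<le> u x)}"

definition g_fun :: "nat \<Rightarrow> real \<Rightarrow> real \<Rightarrow> real" where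
  "g_fun n s t = (1 + t\<^sup>2) powr (- (real n + 1 + s) / 2)"

definition G_fun :: "nat \<Rightarrow> real \<Rightarrow> real \<Rightarrow> real" where
  "G_fun n s t = (LBINT \<tau>=0..t. g_fun n s \<tau>)"

definition calG_fun :: "nat \<Rightarrow> real \<Rightarrow> real \<Rightarrow> real" where
  "calG_fun n s t = (LBINT \<tau>=0..t. G_fun n s \<tau>)"

definition Q_set :: "'a set \<Rightarrow> ('a \<times> 'a) set" where
  "Q_set \<Omega> = UNIV - (UNIV - \<Omega>) \<times> (UNIV - \<Omega>)"

definition energy_diff ::
  "real \<Rightarrow> ('a::euclidean_space \<Rightarrow> real) \<Rightarrow> ('a \<Rightarrow> real) \<Rightarrow> 'a \<times> 'a \<Rightarrow> real" where
  "energy_diff s u v = (\<lambda>(x, y).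
     (calG_fun DIM('a) s ((u x - u y) / norm (x - y)) -
      calG_fun DIM('a) s ((v x - v y) / norm (x - y)))
     / norm (x - y) powr (real DIM('a) - 1 + s))"

text \<open>
  The library's integral of a non-integrable function is 0, so that the integral
  converges has to be said explicitly for the inequality to be meaningful.
\<close>

definition solves_obstacle ::
  "real \<Rightarrow> 'a::euclidean_space set \<Rightarrow> 'a set \<Rightarrow> ('a \<Rightarrow> real) \<Rightarrow> ('a \<Rightarrow> real) \<Rightarrow> ('a \<Rightarrow> real) \<Rightarrow> bool" where
  "solves_obstacle s \<Omega> A \<phi> \<psi> u \<longleftrightarrow>
     u \<in> Ws_obs s \<Omega> A \<phi> \<psi> \<and>
     (\<forall>v \<in> Ws_obs s \<Omega> A \<phi> \<psi>.
        set_integrable lebesgue (Q_set \<Omega>) (energy_diff s u v) \<and>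
        set_lebesgue_integral lebesgue (Q_set \<Omega>) (energy_diff s u v) \<le> 0)"

definition Sg :: "('a \<Rightarrow> real) \<Rightarrow> 'a set \<Rightarrow> ('a \<times> real) set" where
  "Sg u A = {(x, t). x \<in> A \<and> t < u x}"

definition cyl :: "'a set \<Rightarrow> real \<Rightarrow> ('a \<times> real) set" where
  "cyl \<Omega> M = \<Omega> \<times> {-M<..<M}"

text \<open>The dimension of the ambient space is \<open>DIM('b)\<close>; below it is used with \<open>'b = 'a \<times> real\<close>.\<close>

definition Per :: "real \<Rightarrow> 'b::euclidean_space set \<Rightarrow> 'b set \<Rightarrow> ennreal" where
  "Per s E U =
     (\<integral>\<^sup>+(X, Y) \<in> Q_set U.
        ennreal (\<bar>indicator E X - indicator E Y\<bar> / norm (X - Y) powr (real DIM('b) + s)) \<partial>lebesgue)"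

definition ae_eq :: "'b::euclidean_space set \<Rightarrow> 'b set \<Rightarrow> bool" where
  "ae_eq S T \<longleftrightarrow> (AE X in lebesgue. X \<in> S \<longleftrightarrow> X \<in> T)"

definition ae_subset :: "'b::euclidean_space set \<Rightarrow> 'b set \<Rightarrow> bool" where
  "ae_subset S T \<longleftrightarrow> (AE X in lebesgue. X \<in> S \<longrightarrow> X \<in> T)"

definition solves_geometric_obstacle ::
  "real \<Rightarrow> 'a::euclidean_space set \<Rightarrow> 'a set \<Rightarrow> ('a \<Rightarrow> real) \<Rightarrow> ('a \<Rightarrow> real) \<Rightarrow> ('a \<times> real) set \<Rightarrow> bool" where
  "solves_geometric_obstacle s \<Omega> A \<phi> \<psi> E \<longleftrightarrow>
     E \<in> sets lebesgue \<and>
     ae_eq (E - \<Omega> \<times> UNIV) (Sg \<phi> UNIV - \<Omega> \<times> UNIV) \<and>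
     ae_subset (Sg \<psi> A) E \<and>
     (\<forall>M\<ge>0. Linf_norm A \<psi> \<le> ennreal M \<longrightarrow>
        Per s E (cyl \<Omega> M) < \<infinity> \<and>
        (\<forall>F \<in> sets lebesgue.
           ae_eq (F - cyl \<Omega> M) (E - cyl \<Omega> M) \<and> ae_subset (Sg \<psi> A) F \<longrightarrow>
           Per s E (cyl \<Omega> M) \<le> Per s F (cyl \<Omega> M)))"

end

theory Submission
  imports Defs
begin

text \<open>
  Both claims rest on one convex functional. Relative to a fixed competitor, the energy of \<open>u\<close> is the
  integral over pairs of differences of \<open>calG\<close>, applied to the slopes, against a positive weight, and \<open>calG\<close> is strictly convex,
  Lipschitz and of linear growth.

  Energy differences converge. As \<open>calG\<close> is Lipschitz, it suffices that the difference of two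
  competitors, extended by zero, has finite Gagliardo seminorm on the whole space. Since \<open>s < 1\<close>, this is a
  fractional Hardy inequality for \<open>W\<^sup>s\<^sup>,\<^sup>1\<close> of a Lipschitz domain (\<open>fractional_hardy\<close>): the mass in a thin
  boundary layer is compared with the mass of \<open>m\<close> disjoint inward translates, which gains a factor
  \<open>1 / m\<close> against a loss of order \<open>m\<^sup>s\<close> in the weight.

  Minimisers exist and are unique. Cutting a competitor at a height exceeding the bound of the datum near
  \<open>\<Omega>\<close> by \<open>diameter \<Omega>\<close> lowers its energy (\<open>truncation_decreases_energy\<close>): the attraction by the
  annulus where the slopes exceed \<open>1/2\<close> outweighs the uncontrolled datum at distance \<open>\<Theta> diameter \<Omega>\<close>,
  if \<open>\<Theta>\<close> is large depending on the dimension and \<open>s\<close> only, because \<open>G\<close> is bounded and the kernel has tail of order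
  \<open>\<Theta>\<^sup>-\<^sup>s\<close>. Among bounded competitors, the interaction with the same annulus makes the energy uniformly
  convex (\<open>uniform_convexity\<close>), so a minimising sequence is Cauchy in \<open>L\<^sup>2(\<Omega>)\<close> and
  Fatou's lemma gives the minimiser. Strict convexity gives uniqueness.

  The subgraph minimises the perimeter. Fubini's theorem writes the perimeter in \<open>\<Omega> \<times> (-M, M)\<close> as an
  integral of the interactions of pairs of vertical columns (\<open>Per_columns\<close>). Replacing every column of a
  competing set by the half-line of the same length does not increase any of these interactions
  (\<open>half_lines_minimise\<close>, by a calibration), and the interaction of two half-lines at height difference
  \<open>c\<close> and distance \<open>r\<close> is \<open>2 calG (c / r)\<close> divided by \<open>r\<^sup>n\<^sup>-\<^sup>1\<^sup>+\<^sup>s\<close>, plus a term that does not depend on \<open>c\<close>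
  (\<open>half_line_interaction\<close>). So among subgraphs the perimeter is twice the energy up to a constant, and a
  minimiser of the energy is compared with the rearranged set.
\<close>

section \<open>The profile functions\<close>

locale profile =
  fixes n :: nat and s :: real
  assumes n_pos: "1 \<le> n" and s_pos: "0 < s"
begin

abbreviation g :: "real \<Rightarrow> real" where "g \<equiv> g_fun n s"
abbreviation G :: "real \<Rightarrow> real" where "G \<equiv> G_fun n s"
abbreviation calG :: "real \<Rightarrow> real" where "calG \<equiv> calG_fun n s"

lemma one_plus_sq_pos: "0 < 1 + (t::real)\<^sup>2"
  by (simp add: add_pos_nonneg)

lemma g_pos: "0 < g t"
  using one_plus_sq_pos[of t] by (simp add: g_fun_def)

lemma g_minus [simp]: "g (- t) = g t"
  by (simp add: g_fun_def)

lemma isCont_g: "isCont g t"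
  unfolding g_fun_def using one_plus_sq_pos[of t] by (intro continuous_intros) auto

lemma continuous_on_g: "continuous_on S g"
  using isCont_g continuous_at_imp_continuous_on by blast

lemma measurable_g [measurable]: "g \<in> borel_measurable borel"
  by (intro borel_measurable_continuous_onI continuous_on_g)

lemma g_mono: "\<bar>t\<bar> \<le> R \<Longrightarrow> g R \<le> g t"
  unfolding g_fun_def using one_plus_sq_pos[of t] n_pos s_pos
  by (intro powr_mono2') (auto simp: abs_le_square_iff[symmetric])

lemma g_le_inverse: "g t \<le> inverse (1 + t\<^sup>2)"
proof -
  have "g t \<le> (1 + t\<^sup>2) powr (-1)"
    unfolding g_fun_def using n_pos s_pos by (intro powr_mono) auto
  then show ?thesis
    using one_plus_sq_pos[of t] by (simp add: powr_minus)
qed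

lemma LBINT_has_derivative:
  fixes f :: "real \<Rightarrow> real"
  assumes "\<And>x. isCont f x"
  shows "((\<lambda>t. LBINT \<tau>=0..t. f \<tau>) has_real_derivative f t) (at t)"
proof -
  have "((\<lambda>u. LBINT y=0..u. f y) has_vector_derivative f t) (at t within {-\<bar>t\<bar>-1..\<bar>t\<bar>+1})"
    unfolding zero_ereal_def
    by (rule interval_integral_FTC2) (use assms in \<open>auto intro!: continuous_at_imp_continuous_on\<close>)
  then have "((\<lambda>u. LBINT y=0..u. f y) has_vector_derivative f t) (at t)"
    by (subst (asm) at_within_Icc_at) auto
  then show ?thesis
    by (simp add: has_real_derivative_iff_has_vector_derivative)
qed

lemma G_deriv: "(G has_real_derivative g t) (at t)"
  using LBINT_has_derivative[of g t] isCont_g by (simp add: G_fun_def[abs_def])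

lemma isCont_G: "isCont G t"
  using G_deriv DERIV_isCont by blast

lemma calG_deriv: "(calG has_real_derivative G t) (at t)"
  using LBINT_has_derivative[of G t] isCont_G by (simp add: calG_fun_def[abs_def])

lemma G_zero [simp]: "G 0 = 0"
  by (simp add: G_fun_def zero_ereal_def[symmetric])

lemma calG_zero [simp]: "calG 0 = 0"
  by (simp add: calG_fun_def zero_ereal_def[symmetric])

lemma isCont_calG: "isCont calG t"
  using calG_deriv DERIV_isCont by blast

lemma continuous_on_calG: "continuous_on S calG"
  using isCont_calG continuous_at_imp_continuous_on by blast

lemma measurable_calG [measurable]: "calG \<in> borel_measurable borel"
  by (intro borel_measurable_continuous_onI continuous_on_calG)

lemma G_strict_mono: "x < y \<Longrightarrow> G x < G y"
  by (rule DERIV_pos_imp_increasing) (use G_deriv g_pos in blast)+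

lemma G_mono: "x \<le> y \<Longrightarrow> G x \<le> G y"
  using G_strict_mono[of x y] by (cases "x = y") auto

lemma G_minus [simp]: "G (- t) = - G t"
proof -
  have "((\<lambda>t. G (- t) + G t) has_real_derivative 0) (at x)" for x
    using DERIV_add[OF DERIV_mirror[THEN iffD1, OF G_deriv[of "- x"]] G_deriv[of x]] by simp
  then show ?thesis
    using DERIV_isconst_all[of "\<lambda>t. G (- t) + G t" t 0] by simp
qed

lemma calG_minus [simp]: "calG (- t) = calG t"
proof -
  have "((\<lambda>t. calG (- t) - calG t) has_real_derivative 0) (at x)" for x
    using DERIV_diff[OF DERIV_mirror[THEN iffD1, OF calG_deriv[of "- x"]] calG_deriv[of x]] by simp
  then show ?thesis
    using DERIV_isconst_all[of "\<lambda>t. calG (- t) - calG t" t 0] by simp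
qed

text \<open>As \<open>g t \<le> 1 / (1 + t\<^sup>2)\<close>, the function \<open>G\<close> stays below \<open>arctan\<close> for positive arguments.\<close>

lemma G_le_2: "G t \<le> 2"
proof (cases "t \<le> 0")
  case True
  then show ?thesis using G_mono[of t 0] by simp
next
  case False
  have "((\<lambda>t. arctan t - G t) has_real_derivative inverse (1 + x\<^sup>2) - g x) (at x)" for x
    by (intro DERIV_diff DERIV_arctan G_deriv)
  moreover have "0 \<le> inverse (1 + x\<^sup>2) - g x" for x
    using g_le_inverse[of x] by linarith
  ultimately have "arctan 0 - G 0 \<le> arctan t - G t"
    using False by (intro DERIV_nonneg_imp_nondecreasing[of 0 t "\<lambda>t. arctan t - G t"]) force+
  then have "G t \<le> arctan t"
    by simp
  then show ?thesis
    using arctan_ubound[of t] pi_half_less_two by linarith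
qed

lemma abs_G_le_2: "\<bar>G t\<bar> \<le> 2"
  using G_le_2[of t] G_le_2[of "- t"] by simp

lemma G_1_pos: "0 < G 1"
  using G_strict_mono[of 0 1] by simp

text \<open>Tangent lines lie below the graph, since the derivative \<open>G\<close> is increasing.\<close>

lemma calG_tangent: "calG a + G a * (b - a) \<le> calG b"
proof -
  have "G a * (b - a) \<le> calG b - calG a"
  proof (rule convex_on_imp_above_tangent[where A = UNIV])
    show "convex_on UNIV calG"
      by (rule f''_ge0_imp_convex[of _ _ G g]) (auto intro: calG_deriv G_deriv less_imp_le g_pos)
    show "(calG has_real_derivative G a) (at a within UNIV)"
      using calG_deriv by simp
  qed auto
  then show ?thesis by simp
qed

lemma calG_diff_le: "calG b - calG a \<le> 2 * \<bar>b - a\<bar>"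
proof -
  have "calG b - calG a \<le> G b * (b - a)"
    using calG_tangent[of b a] by (simp add: algebra_simps)
  also have "\<dots> \<le> \<bar>G b\<bar> * \<bar>b - a\<bar>"
    by (metis abs_ge_self abs_mult)
  also have "\<dots> \<le> 2 * \<bar>b - a\<bar>"
    by (intro mult_right_mono abs_G_le_2) auto
  finally show ?thesis .
qed

lemma calG_lipschitz: "\<bar>calG b - calG a\<bar> \<le> 2 * \<bar>b - a\<bar>"
  using calG_diff_le[of a b] calG_diff_le[of b a] by (auto simp: abs_minus_commute)

lemma calG_nonneg: "0 \<le> calG t"
  using calG_tangent[of 0 t] by simp

lemma calG_abs: "calG \<bar>t\<bar> = calG t"
  by (simp add: abs_if)

lemma calG_mono: "\<bar>a\<bar> \<le> \<bar>b\<bar> \<Longrightarrow> calG a \<le> calG b"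
proof -
  assume ab: "\<bar>a\<bar> \<le> \<bar>b\<bar>"
  have "0 \<le> G \<bar>a\<bar> * (\<bar>b\<bar> - \<bar>a\<bar>)"
    using ab G_mono[of 0 "\<bar>a\<bar>"] by simp
  then show ?thesis
    using calG_tangent[of "\<bar>a\<bar>" "\<bar>b\<bar>"] by (simp add: calG_abs)
qed

lemma calG_linear_growth: "G 1 * (\<bar>t\<bar> - 1) \<le> calG t"
  using calG_tangent[of 1 "\<bar>t\<bar>"] calG_nonneg[of 1] by (simp add: calG_abs)

text \<open>
  On \<open>[-R, R]\<close> the second derivative \<open>g\<close> of \<open>calG\<close> is at least \<open>g R\<close>, so subtracting
  \<open>g R t\<^sup>2 / 2\<close> leaves a convex function.
\<close>

lemma calG_midpoint_gap:
  assumes "\<bar>a\<bar> \<le> R" "\<bar>b\<bar> \<le> R"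
  shows "g R / 4 * (a - b)\<^sup>2 \<le> calG a + calG b - 2 * calG ((a + b) / 2)"
proof -
  define k where "k = g R"
  define f where "f t = calG t - k / 2 * t\<^sup>2" for t
  have "convex_on {-R..R} f"
  proof (rule f''_ge0_imp_convex[of _ _ "\<lambda>t. G t - k * t" "\<lambda>t. g t - k"])
    show "(f has_real_derivative G t - k * t) (at t)" for t
      unfolding f_def by (auto intro!: derivative_eq_intros calG_deriv)
    show "((\<lambda>t. G t - k * t) has_real_derivative g t - k) (at t)" for t
      by (auto intro!: derivative_eq_intros G_deriv)
    show "t \<in> {-R..R} \<Longrightarrow> 0 \<le> g t - k" for t
      using g_mono[of t R] by (auto simp: k_def abs_le_iff)
  qed auto
  then have "f ((1 - 1/2) *\<^sub>R a + (1/2) *\<^sub>R b) \<le> (1 - 1/2) * f a + (1/2) * f b"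
    by (rule convex_onD) (use assms in \<open>auto simp: abs_le_iff\<close>)
  then have "2 * f ((a + b) / 2) \<le> f a + f b"
    by (simp add: add_divide_distrib)
  moreover have "(a\<^sup>2 + b\<^sup>2) / 2 - ((a + b) / 2)\<^sup>2 = (a - b)\<^sup>2 / 4"
    by (simp add: power2_eq_square field_simps)
  then have "k / 2 * a\<^sup>2 + k / 2 * b\<^sup>2 - 2 * (k / 2 * ((a + b) / 2)\<^sup>2) = k * ((a - b)\<^sup>2 / 4)"
    by (simp add: algebra_simps) (simp add: field_simps power2_eq_square)
  ultimately show ?thesis
    unfolding f_def k_def by simp
qed

lemma calG_strict_convex:
  assumes "a \<noteq> b"
  shows "2 * calG ((a + b) / 2) < calG a + calG b"
proof -
  define R where "R = max \<bar>a\<bar> \<bar>b\<bar>"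
  have "0 < g R / 4 * (a - b)\<^sup>2"
    using g_pos[of R] assms by simp
  also have "\<dots> \<le> calG a + calG b - 2 * calG ((a + b) / 2)"
    by (rule calG_midpoint_gap) (auto simp: R_def)
  finally show ?thesis by simp
qed

lemma calG_convex: "2 * calG ((a + b) / 2) \<le> calG a + calG b"
  using calG_strict_convex[of a b] by (cases "a = b") auto

text \<open>
  Since \<open>n \<ge> 1\<close>, the integrand is at most \<open>t (1 + t\<^sup>2)\<close> to the power \<open>- (2 + s) / 2\<close>, which has the
  antiderivative \<open>- (1 + t\<^sup>2)\<close> to the power \<open>- s / 2\<close>, divided by \<open>s\<close>.
\<close>

lemma integrable_abs_g: "integrable lborel (\<lambda>t. \<bar>t\<bar> * g t)"
proof (rule integrableI_bounded)
  define f where "f t = t * (1 + t\<^sup>2) powr (- (2 + s) / 2)" for t :: real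
  have f_nonneg: "0 \<le> t \<Longrightarrow> 0 \<le> f t" for t by (simp add: f_def)
  have [measurable]: "f \<in> borel_measurable borel"
    unfolding f_def by measurable
  have "(\<integral>\<^sup>+t. ennreal (f t) * indicator {0..} t \<partial>lborel) = ennreal (0 - (- (1 / s) * (1 + 0\<^sup>2) powr (- s / 2)))"
  proof (rule nn_integral_FTC_atLeast)
    fix x :: real
    have "((\<lambda>t. - (1 / s) * (1 + t\<^sup>2) powr (- s / 2)) has_real_derivative
       (- (1 / s)) * (- s / 2 * (1 + x\<^sup>2) powr (- s / 2 - 1) * (2 * x))) (at x)"
      using one_plus_sq_pos[of x]
      by (auto intro!: derivative_eq_intros simp: powr_diff)
    moreover have "f x = - (1 / s) * (- s / 2 * (1 + x\<^sup>2) powr (- s / 2 - 1) * (2 * x))"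
    proof -
      have "- (2 + s) / 2 = - s / 2 - 1" by (simp add: field_simps)
      then have "f x = x * (1 + x\<^sup>2) powr (- s / 2 - 1)"
        unfolding f_def by (rule arg_cong)
      then show ?thesis using s_pos by simp
    qed
    ultimately show "((\<lambda>t. - (1 / s) * (1 + t\<^sup>2) powr (- s / 2)) has_real_derivative f x) (at x)"
      by metis
    show "0 \<le> x \<Longrightarrow> 0 \<le> f x" by (rule f_nonneg)
  next
    have lim: "filterlim (\<lambda>t::real. 1 + t\<^sup>2) at_top at_top"
      by (intro filterlim_tendsto_add_at_top[OF tendsto_const] filterlim_pow_at_top filterlim_ident) auto
    have "((\<lambda>t. (1 + t\<^sup>2) powr (- s / 2)) \<longlongrightarrow> 0) at_top"
      by (rule tendsto_neg_powr[OF _ lim]) (use s_pos in auto)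
    then show "((\<lambda>t. - (1 / s) * (1 + t\<^sup>2) powr (- s / 2)) \<longlongrightarrow> 0) at_top"
      using tendsto_mult_right_zero by blast
  qed simp
  then have fin: "(\<integral>\<^sup>+t. ennreal (f t) * indicator {0..} t \<partial>lborel) < \<infinity>" by simp
  have le: "ennreal (norm (\<bar>t\<bar> * g t)) \<le> ennreal (f t) * indicator {0..} t + ennreal (f (- t)) * indicator {0..} (- t)" for t
  proof -
    have "g t \<le> (1 + t\<^sup>2) powr (- (2 + s) / 2)"
      unfolding g_fun_def using n_pos by (intro powr_mono) auto
    then have "\<bar>t\<bar> * g t \<le> f \<bar>t\<bar>"
      unfolding f_def by (simp add: mult_left_mono)
    then have *: "ennreal (norm (\<bar>t\<bar> * g t)) \<le> ennreal (f \<bar>t\<bar>)"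
      using g_pos[of t] by (intro ennreal_leI) (simp add: abs_mult less_imp_le)
    show ?thesis
    proof (cases "0 \<le> t")
      case True
      then show ?thesis
        by (intro order_trans[OF *] add_increasing2) auto
    next
      case False
      then show ?thesis
        by (intro order_trans[OF *] add_increasing) auto
    qed
  qed
  have refl: "(\<integral>\<^sup>+t. ennreal (f (- t)) * indicator {0..} (- t) \<partial>lborel) = (\<integral>\<^sup>+t. ennreal (f t) * indicator {0..} t \<partial>lborel)"
    by (subst nn_integral_real_affine[of "\<lambda>t. ennreal (f t) * indicator {0..} t" "-1" 0]) auto
  have "(\<integral>\<^sup>+t. ennreal (norm (\<bar>t\<bar> * g t)) \<partial>lborel)
     \<le> (\<integral>\<^sup>+t. ennreal (f t) * indicator {0..} t + ennreal (f (- t)) * indicator {0..} (- t) \<partial>lborel)"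
    by (intro nn_integral_mono le)
  also have "\<dots> = (\<integral>\<^sup>+t. ennreal (f t) * indicator {0..} t \<partial>lborel) + (\<integral>\<^sup>+t. ennreal (f (- t)) * indicator {0..} (- t) \<partial>lborel)"
    by (subst nn_integral_add) auto
  also have "\<dots> < \<infinity>"
    unfolding refl using fin by simp
  finally show "(\<integral>\<^sup>+t. ennreal (norm (\<bar>t\<bar> * g t)) \<partial>lborel) < \<infinity>" .
qed measurable

lemma integrable_g: "integrable lborel g"
proof (rule Bochner_Integration.integrable_bound)
  show "integrable lborel (\<lambda>t. indicator {-1..1} t + \<bar>t\<bar> * g t)"
    by (intro Bochner_Integration.integrable_add integrable_abs_g) auto
  show "AE t in lborel. norm (g t) \<le> norm (indicator {-1..1} t + \<bar>t\<bar> * g t)"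
  proof (rule AE_I2)
    fix t :: real
    have "g t \<le> indicator {-1..1} t + \<bar>t\<bar> * g t"
    proof (cases "\<bar>t\<bar> \<le> 1")
      case True
      have "g t \<le> 1"
        using order_trans[OF g_le_inverse[of t]] by (simp add: inverse_le_1_iff)
      then show ?thesis using True g_pos[of t] by (simp add: abs_le_iff add_increasing2)
    next
      case False
      then have "1 * g t \<le> \<bar>t\<bar> * g t" using g_pos[of t] by (intro mult_right_mono) auto
      then show ?thesis using False by (auto simp: indicator_def)
    qed
    then show "norm (g t) \<le> norm (indicator {-1..1} t + \<bar>t\<bar> * g t)"
      using g_pos[of t] by simp
  qed
qed simp

text \<open>
  The interaction of two half-lines at height difference \<open>q\<close> is the left-hand side. As \<open>g\<close> is
  even, \<open>\<bar>w + q\<bar>\<close> may be replaced by \<open>(\<bar>w + q\<bar> + \<bar>w - q\<bar>) / 2 = max \<bar>w\<bar> q\<close>, and the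
  remaining integral of \<open>(q - \<bar>w\<bar>) g w\<close> over \<open>\<bar>w\<bar> \<le> q\<close> has an explicit antiderivative.
\<close>

lemma half_line_interaction:
  shows "integrable lborel (\<lambda>w. \<bar>w + q\<bar> * g w)"
    and "(LBINT w. \<bar>w + q\<bar> * g w) = (LBINT w. \<bar>w\<bar> * g w) + 2 * calG q"
proof -
  have int: "integrable lborel (\<lambda>w. \<bar>w + p\<bar> * g w)" for p
  proof (rule Bochner_Integration.integrable_bound)
    show "integrable lborel (\<lambda>w. \<bar>w\<bar> * g w + \<bar>p\<bar> * g w)"
      by (intro Bochner_Integration.integrable_add integrable_abs_g integrable_mult_right integrable_g)
    show "AE w in lborel. norm (\<bar>w + p\<bar> * g w) \<le> norm (\<bar>w\<bar> * g w + \<bar>p\<bar> * g w)"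
    proof (rule AE_I2)
      fix w
      have "\<bar>w + p\<bar> * g w \<le> (\<bar>w\<bar> + \<bar>p\<bar>) * g w"
        using g_pos[of w] by (intro mult_right_mono) auto
      moreover have "0 \<le> \<bar>w + p\<bar> * g w" using g_pos[of w] by simp
      ultimately show "norm (\<bar>w + p\<bar> * g w) \<le> norm (\<bar>w\<bar> * g w + \<bar>p\<bar> * g w)"
        by (simp add: distrib_right)
    qed
  qed measurable
  then show "integrable lborel (\<lambda>w. \<bar>w + q\<bar> * g w)" .
  define J where "J p = (LBINT w. \<bar>w + p\<bar> * g w)" for p
  have J_minus: "J (- p) = J p" for p
  proof -
    have "J (- p) = (LBINT w. \<bar>(0 + (-1) * w) + - p\<bar> * g (0 + (-1) * w))"
      unfolding J_def using lborel_integral_real_affine[of "-1" "\<lambda>w. \<bar>w + - p\<bar> * g w" 0] by simp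
    also have "\<dots> = J p"
      unfolding J_def by (intro Bochner_Integration.integral_cong) (auto simp: abs_if)
    finally show ?thesis .
  qed
  define p where "p = \<bar>q\<bar>"
  have p0: "0 \<le> p" by (simp add: p_def)
  have J_p: "J q = J p" by (simp add: p_def abs_if J_minus)
  have right: "has_bochner_integral lborel (\<lambda>w. (p - w) * g w * indicator {0..p} w) (calG p)"
  proof -
    have "has_bochner_integral lborel (\<lambda>w. (p - w) * g w * indicator {0..p} w)
        (((p - p) * G p + calG p) - ((p - 0) * G 0 + calG 0))"
      by (rule has_bochner_integral_FTC_Icc_real[OF p0])
        (auto intro!: derivative_eq_intros G_deriv calG_deriv continuous_intros isCont_g
           simp: algebra_simps)
    then show ?thesis by simp
  qed
  have left: "has_bochner_integral lborel (\<lambda>w. (p + w) * g w * indicator {-p..0} w) (calG p)"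
  proof -
    have "has_bochner_integral lborel (\<lambda>w. (p + w) * g w * indicator {-p..0} w)
        (((p + 0) * G 0 - calG 0) - ((p + - p) * G (- p) - calG (- p)))"
      by (rule has_bochner_integral_FTC_Icc_real)
        (use p0 in \<open>auto intro!: derivative_eq_intros G_deriv calG_deriv continuous_intros isCont_g
           simp: algebra_simps\<close>)
    then show ?thesis by simp
  qed
  have "2 * J p - 2 * J 0 = (J p + J (- p)) - 2 * J 0"
    by (simp add: J_minus)
  also have "\<dots> = (LBINT w. \<bar>w + p\<bar> * g w + \<bar>w + - p\<bar> * g w - 2 * (\<bar>w + 0\<bar> * g w))"
    unfolding J_def by (simp add: int[of p] int[of "- p", simplified] int[of 0, simplified])
  also have "\<dots> = (LBINT w. 2 * ((p - w) * g w * indicator {0..p} w + (p + w) * g w * indicator {-p..0} w))"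
  proof (rule integral_cong_AE)
    have "AE w in lborel. w \<noteq> (0::real)" by (rule AE_lborel_singleton)
    then show "AE w in lborel. \<bar>w + p\<bar> * g w + \<bar>w + - p\<bar> * g w - 2 * (\<bar>w + 0\<bar> * g w) =
        2 * ((p - w) * g w * indicator {0..p} w + (p + w) * g w * indicator {-p..0} w)"
      by eventually_elim (use p0 in \<open>auto simp: indicator_def abs_if algebra_simps\<close>)
  qed measurable
  also have "\<dots> = 2 * (calG p + calG p)"
    by (intro has_bochner_integral_integral_eq has_bochner_integral_mult_right
        has_bochner_integral_add right left)
  finally have "J p = J 0 + 2 * calG p" by simp
  then show "(LBINT w. \<bar>w + q\<bar> * g w) = (LBINT w. \<bar>w\<bar> * g w) + 2 * calG q"
    using J_p by (simp add: J_def p_def calG_abs)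
qed

end

section \<open>Integrals over Euclidean space\<close>

lemma fst_borel [measurable]: "(fst :: 'a::second_countable_topology \<times> 'b::second_countable_topology \<Rightarrow> 'a) \<in> borel \<rightarrow>\<^sub>M borel"
  by (metis borel_prod measurable_fst)

lemma snd_borel [measurable]: "(snd :: 'a::second_countable_topology \<times> 'b::second_countable_topology \<Rightarrow> 'b) \<in> borel \<rightarrow>\<^sub>M borel"
  by (metis borel_prod measurable_snd)

lemma Pair_borel [measurable (raw)]:
  fixes f :: "'c \<Rightarrow> 'a::second_countable_topology" and g :: "'c \<Rightarrow> 'b::second_countable_topology"
  assumes "f \<in> M \<rightarrow>\<^sub>M borel" "g \<in> M \<rightarrow>\<^sub>M borel"
  shows "(\<lambda>x. (f x, g x)) \<in> M \<rightarrow>\<^sub>M borel"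
  using measurable_Pair[OF assms] by (simp add: borel_prod)

lemma borel_measurable_infdist [measurable (raw)]:
  fixes f :: "'c \<Rightarrow> 'a::metric_space"
  assumes "f \<in> M \<rightarrow>\<^sub>M borel"
  shows "(\<lambda>x. infdist (f x) A) \<in> borel_measurable M"
proof -
  have "(\<lambda>x. infdist x A) \<in> borel_measurable borel"
    by (intro borel_measurable_continuous_onI continuous_on_infdist continuous_on_id)
  from measurable_compose[OF assms this] show ?thesis .
qed

lemma bounded_Compl_nonempty:
  fixes S :: "'a::euclidean_space set"
  assumes "bounded S"
  shows "- S \<noteq> {}"
proof
  assume "- S = {}"
  then have "S = UNIV" by auto
  then show False using assms not_bounded_UNIV by simp
qed

lemma measurable_lborel_pair:
  fixes f :: "'a::euclidean_space \<times> 'b::euclidean_space \<Rightarrow> 'c::topological_space"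
  assumes "f \<in> borel_measurable borel"
  shows "f \<in> borel_measurable (lborel \<Otimes>\<^sub>M lborel)"
  using assms by (simp add: lborel_prod)

lemma nn_integral_lborel_pair:
  fixes f :: "'a::euclidean_space \<times> 'b::euclidean_space \<Rightarrow> ennreal"
  assumes "f \<in> borel_measurable borel"
  shows "(\<integral>\<^sup>+z. f z \<partial>lborel) = (\<integral>\<^sup>+x. \<integral>\<^sup>+y. f (x, y) \<partial>lborel \<partial>lborel)"
    and "(\<integral>\<^sup>+z. f z \<partial>lborel) = (\<integral>\<^sup>+y. \<integral>\<^sup>+x. f (x, y) \<partial>lborel \<partial>lborel)"
  using lborel.nn_integral_fst[OF measurable_lborel_pair[OF assms]]
    lborel_pair.nn_integral_snd[OF measurable_lborel_pair[OF assms]]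
  by (auto simp: lborel_prod)

lemma nn_integral_lborel_swap:
  fixes f :: "'a::euclidean_space \<Rightarrow> 'b::euclidean_space \<Rightarrow> ennreal"
  assumes "(\<lambda>(x, y). f x y) \<in> borel_measurable borel"
  shows "(\<integral>\<^sup>+x. \<integral>\<^sup>+y. f x y \<partial>lborel \<partial>lborel) = (\<integral>\<^sup>+y. \<integral>\<^sup>+x. f x y \<partial>lborel \<partial>lborel)"
  using nn_integral_lborel_pair[OF assms] by simp

lemma borel_measurable_nn_integral_lborel [measurable (raw)]:
  fixes f :: "'a::euclidean_space \<Rightarrow> 'b::euclidean_space \<Rightarrow> ennreal"
  assumes "(\<lambda>z. f (fst z) (snd z)) \<in> borel_measurable borel"
  shows "(\<lambda>x. \<integral>\<^sup>+y. f x y \<partial>lborel) \<in> borel_measurable borel"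
proof -
  have "(\<lambda>(x, y). f x y) \<in> borel_measurable (lborel \<Otimes>\<^sub>M (lborel :: 'b measure))"
    using assms by (simp add: lborel_prod case_prod_beta')
  from lborel.borel_measurable_nn_integral[OF this] show ?thesis by simp
qed

lemma AE_lborel_fst:
  assumes "AE x in lborel. P x"
  shows "AE z in lborel. P (fst (z :: 'a::euclidean_space \<times> 'b::euclidean_space))"
proof -
  from AE_E[OF assms] obtain N where N: "{x. \<not> P x} \<subseteq> N" "emeasure lborel N = 0" "N \<in> sets lborel"
    by auto
  then have "N \<times> UNIV \<in> null_sets (lborel \<Otimes>\<^sub>M (lborel :: 'b measure))"
    by (intro lborel.times_in_null_sets1) auto
  then have "N \<times> UNIV \<in> null_sets (lborel :: ('a \<times> 'b) measure)"
    by (simp add: lborel_prod)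
  then show ?thesis
    by (rule AE_I') (use N in auto)
qed

lemma AE_lborel_snd:
  assumes "AE x in lborel. P x"
  shows "AE z in lborel. P (snd (z :: 'a::euclidean_space \<times> 'b::euclidean_space))"
proof -
  from AE_E[OF assms] obtain N where N: "{x. \<not> P x} \<subseteq> N" "emeasure lborel N = 0" "N \<in> sets lborel"
    by auto
  then have "UNIV \<times> N \<in> null_sets ((lborel :: 'a measure) \<Otimes>\<^sub>M lborel)"
    by (intro lborel.times_in_null_sets2) auto
  then have "UNIV \<times> N \<in> null_sets (lborel :: ('a \<times> 'b) measure)"
    by (simp add: lborel_prod)
  then show ?thesis
    by (rule AE_I') (use N in auto)
qed

lemma AE_lborel_pairD:
  assumes "AE z in lborel. P (z :: 'a::euclidean_space \<times> 'b::euclidean_space)"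
  shows "AE x in lborel. AE y in lborel. P (x, y)"
proof -
  have "AE z in (lborel :: 'a measure) \<Otimes>\<^sub>M (lborel :: 'b measure). P z"
    using assms unfolding lborel_prod .
  then show ?thesis by (rule lborel_pair.AE_pair)
qed

lemma nn_integral_lborel_translate:
  fixes f :: "'a::euclidean_space \<Rightarrow> ennreal"
  assumes "f \<in> borel_measurable borel"
  shows "(\<integral>\<^sup>+x. f (c + x) \<partial>lborel) = (\<integral>\<^sup>+x. f x \<partial>lborel)"
proof -
  have "(\<integral>\<^sup>+x. f x \<partial>lborel) = (\<integral>\<^sup>+x. f x \<partial>distr lborel borel ((+) c))"
    by (simp add: lborel_distr_plus)
  also have "\<dots> = (\<integral>\<^sup>+x. f (c + x) \<partial>lborel)"
    using assms by (intro nn_integral_distr) auto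
  finally show ?thesis by simp
qed

lemma nn_integral_lborel_reflect:
  fixes f :: "'a::euclidean_space \<Rightarrow> ennreal"
  assumes [measurable]: "f \<in> borel_measurable borel"
  shows "(\<integral>\<^sup>+x. f (c - x) \<partial>lborel) = (\<integral>\<^sup>+x. f x \<partial>lborel)"
proof -
  have eq: "lborel = density (distr lborel borel (\<lambda>x::'a. c + (-1) *\<^sub>R x)) (\<lambda>_. ennreal (\<bar>-1\<bar> ^ DIM('a)))"
    by (rule lborel_affine) simp
  have "(\<integral>\<^sup>+x. f x \<partial>lborel) = (\<integral>\<^sup>+x. f x \<partial>distr lborel borel (\<lambda>x::'a. c + (-1) *\<^sub>R x))"
    by (subst eq) (simp add: density_1)
  also have "\<dots> = (\<integral>\<^sup>+x. f (c - x) \<partial>lborel)"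
    by (subst nn_integral_distr) auto
  finally show ?thesis by simp
qed

lemma power_bracket:
  fixes b x :: real
  assumes "1 < b" "1 \<le> x"
  obtains k where "b ^ k \<le> x" "x < b ^ Suc k"
proof -
  obtain N where N: "x < b ^ N" using real_arch_pow[OF assms(1)] by blast
  define k where "k = (LEAST k. x < b ^ k)"
  have k: "x < b ^ k" unfolding k_def using N by (rule LeastI)
  have "k \<noteq> 0" using k assms(2) by (cases k) auto
  then obtain j where j: "k = Suc j" by (cases k) auto
  have "\<not> x < b ^ j" using not_less_Least[of j "\<lambda>k. x < b ^ k"] j by (simp add: k_def)
  with k j show ?thesis by (intro that[of j]) auto
qed

text \<open>Negative powers of the norm are integrated by comparison with constants on annuli.\<close>

lemma nn_integral_norm_powr_le_suminf:
  fixes S :: "'a::euclidean_space set" and a b :: "nat \<Rightarrow> real"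
  assumes cover: "\<And>z. z \<in> S \<Longrightarrow> \<exists>k. a k \<le> norm z \<and> norm z \<le> b k"
    and pos: "\<And>k. 0 < a k" "\<And>k. 0 < b k" and "0 \<le> q"
    and [measurable]: "S \<in> sets borel"
  shows "(\<integral>\<^sup>+z. ennreal (1 / norm z powr q) * indicator S z \<partial>lborel)
    \<le> (\<Sum>k. ennreal (unit_ball_vol DIM('a) * b k ^ DIM('a) / a k powr q))"
proof -
  define F where "F k z = ennreal (1 / a k powr q) * indicator (cball 0 (b k)) z" for k and z :: 'a
  have [measurable]: "F k \<in> borel_measurable borel" for k
    unfolding F_def[abs_def] by (intro borel_measurable_times_ennreal borel_measurable_const borel_measurable_indicator) auto
  have "ennreal (1 / norm z powr q) * indicator S z \<le> (\<Sum>k. F k z)" for z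
  proof (cases "z \<in> S")
    case True
    then obtain k where k: "a k \<le> norm z" "norm z \<le> b k" using cover by blast
    have "a k powr q \<le> norm z powr q"
      using k pos \<open>0 \<le> q\<close> by (intro powr_mono2) (auto simp: less_imp_le)
    then have "ennreal (1 / norm z powr q) \<le> F k z"
    proof -
      have "0 < norm z" using k(1) pos(1)[of k] by linarith
      then have "1 / norm z powr q \<le> 1 / a k powr q"
        using \<open>a k powr q \<le> norm z powr q\<close> pos(1)[of k] by (intro divide_left_mono) auto
      then show ?thesis unfolding F_def using k(2) by (simp add: ennreal_leI)
    qed
    also have "\<dots> = (\<Sum>i\<in>{k}. F i z)" by simp
    also have "\<dots> \<le> (\<Sum>k. F k z)" by (intro sum_le_suminf) auto
    finally show ?thesis using True by simp
  qed simp
  then have "(\<integral>\<^sup>+z. ennreal (1 / norm z powr q) * indicator S z \<partial>lborel) \<le> (\<integral>\<^sup>+z. (\<Sum>k. F k z) \<partial>lborel)"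
    by (intro nn_integral_mono)
  also have "\<dots> = (\<Sum>k. \<integral>\<^sup>+z. F k z \<partial>lborel)"
    by (rule nn_integral_suminf) auto
  also have "(\<lambda>k. \<integral>\<^sup>+z. F k z \<partial>lborel) = (\<lambda>k. ennreal (unit_ball_vol DIM('a) * b k ^ DIM('a) / a k powr q))"
  proof
    fix k
    have "(\<integral>\<^sup>+z. F k z \<partial>lborel) = ennreal (1 / a k powr q) * ennreal (unit_ball_vol DIM('a) * b k ^ DIM('a))"
      unfolding F_def using pos[of k] by (simp add: nn_integral_cmult_indicator emeasure_cball less_imp_le)
    also have "\<dots> = ennreal (1 / a k powr q * (unit_ball_vol DIM('a) * b k ^ DIM('a)))"
      by (intro ennreal_mult'[symmetric]) auto
    finally show "(\<integral>\<^sup>+z. F k z \<partial>lborel) = ennreal (unit_ball_vol DIM('a) * b k ^ DIM('a) / a k powr q)"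
      by simp
  qed
  finally show ?thesis .
qed

lemma suminf_geometric_ennreal:
  assumes "0 \<le> c" "0 \<le> t" "t < 1"
  shows "(\<Sum>k. ennreal (c * t ^ k)) = ennreal (c / (1 - t))"
proof (rule suminf_ennreal_eq)
  show "(\<lambda>k. c * t ^ k) sums (c / (1 - t))"
    using sums_mult[OF geometric_sums[of t], of c] assms by simp
qed (use assms in auto)

text \<open>
  The constant comes from the annuli of radii \<open>2\<^sup>k \<rho>\<close>: on each of them the integral of
  \<open>\<bar>z\<bar>\<^sup>-\<^sup>n\<^sup>-\<^sup>s\<close> is at most a multiple of \<open>(2\<^sup>k \<rho>)\<^sup>-\<^sup>s\<close>, and these bounds form a geometric series.
\<close>

definition kernel_tail_const :: "'a::euclidean_space itself \<Rightarrow> real \<Rightarrow> real" where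
  "kernel_tail_const _ s = unit_ball_vol DIM('a) * 2 ^ DIM('a) / (1 - 2 powr - s)"

lemma kernel_tail_const_pos: "0 < s \<Longrightarrow> 0 < kernel_tail_const TYPE('a::euclidean_space) s"
  unfolding kernel_tail_const_def by (auto intro!: divide_pos_pos mult_pos_pos simp: powr_less_one)

lemma kernel_tail:
  assumes s: "0 < s" and \<rho>: "0 < \<rho>"
  shows "(\<integral>\<^sup>+z. ennreal (1 / norm (z::'a::euclidean_space) powr (real DIM('a) + s)) * indicator {z. \<rho> \<le> norm z} z \<partial>lborel)
    \<le> ennreal (kernel_tail_const TYPE('a) s * \<rho> powr - s)"
proof -
  let ?n = "DIM('a)"
  define c where "c = unit_ball_vol ?n * 2 ^ ?n * \<rho> powr - s"
  have "(\<integral>\<^sup>+z. ennreal (1 / norm (z::'a) powr (real ?n + s)) * indicator {z. \<rho> \<le> norm z} z \<partial>lborel)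
     \<le> (\<Sum>k. ennreal (unit_ball_vol ?n * (\<rho> * 2 ^ Suc k) ^ ?n / (\<rho> * 2 ^ k) powr (real ?n + s)))"
  proof (rule nn_integral_norm_powr_le_suminf)
    fix z :: 'a assume "z \<in> {z. \<rho> \<le> norm z}"
    then have "1 \<le> norm z / \<rho>" using \<rho> by simp
    from power_bracket[of 2, OF _ this] obtain k where "2 ^ k \<le> norm z / \<rho>" "norm z / \<rho> < 2 ^ Suc k"
      by auto
    then show "\<exists>k. \<rho> * 2 ^ k \<le> norm z \<and> norm z \<le> \<rho> * 2 ^ Suc k"
      using \<rho> by (intro exI[of _ k]) (simp add: field_simps)
  qed (use \<rho> s in auto)
  also have "(\<lambda>k. unit_ball_vol ?n * (\<rho> * 2 ^ Suc k) ^ ?n / (\<rho> * 2 ^ k) powr (real ?n + s)) = (\<lambda>k. c * (2 powr - s) ^ k)"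
  proof
    fix k
    define a where "a = \<rho> * 2 ^ k"
    have a: "0 < a" using \<rho> by (simp add: a_def)
    have "(\<rho> * 2 ^ Suc k) ^ ?n = 2 ^ ?n * a ^ ?n"
      by (simp add: a_def power_mult_distrib)
    moreover have "a powr (real ?n + s) = a ^ ?n * a powr s"
      using a by (simp add: powr_add powr_realpow)
    ultimately have "unit_ball_vol ?n * (\<rho> * 2 ^ Suc k) ^ ?n / a powr (real ?n + s) = unit_ball_vol ?n * 2 ^ ?n * a powr - s"
      using a by (simp add: powr_minus divide_inverse)
    also have "a powr - s = \<rho> powr - s * (2 powr - s) ^ k"
      unfolding a_def using \<rho> by (simp add: powr_mult powr_powr powr_realpow[symmetric] mult.commute)
    finally show "unit_ball_vol ?n * (\<rho> * 2 ^ Suc k) ^ ?n / (\<rho> * 2 ^ k) powr (real ?n + s) = c * (2 powr - s) ^ k"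
      by (simp add: c_def a_def)
  qed
  also have "(\<Sum>k. ennreal (c * (2 powr - s) ^ k)) = ennreal (c / (1 - 2 powr - s))"
    using s by (intro suminf_geometric_ennreal) (auto simp: c_def powr_less_one)
  also have "c / (1 - 2 powr - s) = kernel_tail_const TYPE('a) s * \<rho> powr - s"
    by (simp add: c_def kernel_tail_const_def)
  finally show ?thesis .
qed

lemma kernel_near:
  assumes "0 \<le> q" "q < real DIM('a::euclidean_space)" "0 < R"
  shows "(\<integral>\<^sup>+z. ennreal (1 / norm (z::'a) powr q) * indicator (cball 0 R) z \<partial>lborel) < \<infinity>"
proof -
  let ?n = "DIM('a)"
  define p where "p = real ?n - q"
  define c where "c = unit_ball_vol ?n * R powr p * 2 powr q"
  have p: "0 < p" using assms by (simp add: p_def)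
  have "(\<integral>\<^sup>+z. ennreal (1 / norm (z::'a) powr q) * indicator (cball 0 R) z \<partial>lborel)
    = (\<integral>\<^sup>+z. ennreal (1 / norm (z::'a) powr q) * indicator (cball 0 R - {0}) z \<partial>lborel)"
  proof (rule nn_integral_cong_AE)
    have "AE z in lborel. z \<noteq> (0::'a)" by (rule AE_lborel_singleton)
    then show "AE z::'a in lborel. ennreal (1 / norm z powr q) * indicator (cball 0 R) z =
      ennreal (1 / norm z powr q) * indicator (cball 0 R - {0}) z"
      by eventually_elim (auto simp: indicator_def)
  qed
  also have "\<dots> \<le> (\<Sum>k. ennreal (unit_ball_vol ?n * (R / 2 ^ k) ^ ?n / (R / 2 ^ Suc k) powr q))"
  proof (rule nn_integral_norm_powr_le_suminf)
    fix z :: 'a assume z: "z \<in> cball 0 R - {0}"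
    then have "1 \<le> R / norm z" by simp
    from power_bracket[of 2, OF _ this] obtain k where "2 ^ k \<le> R / norm z" "R / norm z < 2 ^ Suc k"
      by auto
    then show "\<exists>k. R / 2 ^ Suc k \<le> norm z \<and> norm z \<le> R / 2 ^ k"
      using z by (intro exI[of _ k]) (auto simp: field_simps)
  qed (use assms in auto)
  also have "(\<lambda>k. unit_ball_vol ?n * (R / 2 ^ k) ^ ?n / (R / 2 ^ Suc k) powr q) = (\<lambda>k. c * (2 powr - p) ^ k)"
  proof
    fix k
    define a where "a = R / 2 ^ k"
    have a: "0 < a" using assms by (simp add: a_def)
    have "(R / 2 ^ Suc k) powr q = a powr q / 2 powr q"
      using a by (simp add: a_def powr_divide[symmetric] assms mult.commute)
    moreover have "a ^ ?n = a powr p * a powr q"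
      using a by (simp add: powr_add[symmetric] powr_realpow[symmetric] p_def)
    ultimately have "unit_ball_vol ?n * a ^ ?n / (R / 2 ^ Suc k) powr q = unit_ball_vol ?n * a powr p * 2 powr q"
      using a by simp
    also have "a powr p = R powr p * (2 powr - p) ^ k"
    proof -
      have "(2 powr p) ^ k = (2 ^ k) powr p"
        by (simp add: powr_powr powr_realpow[symmetric] mult.commute)
      then show ?thesis
        unfolding a_def using assms by (simp add: powr_divide powr_minus power_inverse inverse_eq_divide power_divide)
    qed
    finally show "unit_ball_vol ?n * (R / 2 ^ k) ^ ?n / (R / 2 ^ Suc k) powr q = c * (2 powr - p) ^ k"
      by (simp add: c_def a_def)
  qed
  also have "(\<Sum>k. ennreal (c * (2 powr - p) ^ k)) = ennreal (c / (1 - 2 powr - p))"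
    using p by (intro suminf_geometric_ennreal) (auto simp: c_def powr_less_one)
  also have "\<dots> < \<infinity>" by simp
  finally show ?thesis .
qed

definition gagliardo :: "real \<Rightarrow> ('a::euclidean_space \<Rightarrow> real) \<Rightarrow> ennreal" where
  "gagliardo s f =
    (\<integral>\<^sup>+z. ennreal (\<bar>f (fst z) - f (snd z)\<bar> / norm (fst z - snd z) powr (real DIM('a) + s)) \<partial>lborel)"

lemma exterior_potential:
  fixes \<Omega> :: "'a::euclidean_space set"
  assumes s: "0 < s" and \<Omega>: "open \<Omega>" "- \<Omega> \<noteq> {}" and x: "x \<in> \<Omega>"
  shows "(\<integral>\<^sup>+y. ennreal (1 / norm (x - y) powr (real DIM('a) + s)) * indicator (- \<Omega>) y \<partial>lborel)
    \<le> ennreal (kernel_tail_const TYPE('a) s * infdist x (- \<Omega>) powr - s)"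
proof -
  define \<rho> where "\<rho> = infdist x (- \<Omega>)"
  define F where "F z = ennreal (1 / norm z powr (real DIM('a) + s)) * indicator {z. \<rho> \<le> norm z} z" for z :: 'a
  have \<rho>: "0 < \<rho>"
    unfolding \<rho>_def using \<Omega> x by (intro infdist_pos_not_in_closed) auto
  have [measurable]: "F \<in> borel_measurable borel"
    unfolding F_def[abs_def] by measurable
  have "(\<integral>\<^sup>+y. ennreal (1 / norm (x - y) powr (real DIM('a) + s)) * indicator (- \<Omega>) y \<partial>lborel)
     \<le> (\<integral>\<^sup>+y. F (x - y) \<partial>lborel)"
  proof (intro nn_integral_mono)
    fix y
    have "\<rho> \<le> norm (x - y)" if "y \<in> - \<Omega>"
      using infdist_le[OF that, of x] by (simp add: \<rho>_def dist_norm)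
    then show "ennreal (1 / norm (x - y) powr (real DIM('a) + s)) * indicator (- \<Omega>) y \<le> F (x - y)"
      by (auto simp: F_def indicator_def)
  qed
  also have "\<dots> = (\<integral>\<^sup>+z. F z \<partial>lborel)"
    by (rule nn_integral_lborel_reflect) measurable
  also have "\<dots> \<le> ennreal (kernel_tail_const TYPE('a) s * \<rho> powr - s)"
    unfolding F_def by (rule kernel_tail[OF s \<rho>])
  finally show ?thesis by (simp add: \<rho>_def)
qed

text \<open>
  For a function vanishing outside \<open>\<Omega>\<close>, the pairs with one point outside contribute the integral
  of \<open>\<bar>f\<bar>\<close> against the exterior potential, which is bounded by a negative power of the distance
  to the complement.
\<close>

lemma gagliardo_zero_extension:
  fixes \<Omega> :: "'a::euclidean_space set"
  assumes s: "0 < s" and \<Omega>: "open \<Omega>" "- \<Omega> \<noteq> {}"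
    and f [measurable]: "f \<in> borel_measurable borel" and zero: "\<And>x. x \<notin> \<Omega> \<Longrightarrow> f x = 0"
    and hardy: "(\<integral>\<^sup>+x. ennreal (\<bar>f x\<bar> * infdist x (- \<Omega>) powr - s) \<partial>lborel) < \<infinity>"
    and inner: "(\<integral>\<^sup>+z. ennreal (\<bar>f (fst z) - f (snd z)\<bar> / norm (fst z - snd z) powr (real DIM('a) + s))
        * indicator (\<Omega> \<times> \<Omega>) z \<partial>lborel) < \<infinity>"
  shows "gagliardo s f < \<infinity>"
proof -
  let ?q = "real DIM('a) + s"
  define I where "I z = ennreal (\<bar>f (fst z) - f (snd z)\<bar> / norm (fst z - snd z) powr ?q)" for z
  define F where "F x y = ennreal \<bar>f x\<bar> * (ennreal (1 / norm (x - y) powr ?q) * indicator (- \<Omega>) y)" for x y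
  have [measurable]: "\<Omega> \<in> sets borel" using \<Omega> by auto
  have [measurable]: "I \<in> borel_measurable borel" unfolding I_def[abs_def] by measurable
  have [measurable]: "\<Omega> \<times> \<Omega> \<in> sets borel" by (rule borel_Times) auto
  have mF [measurable]: "(\<lambda>z. F (fst z) (snd z)) \<in> borel_measurable borel"
    unfolding F_def[abs_def] by measurable
  have mF': "(\<lambda>z. F (snd z) (fst z)) \<in> borel_measurable borel"
    unfolding F_def[abs_def] by measurable
  have F_fin: "(\<integral>\<^sup>+x. \<integral>\<^sup>+y. F x y \<partial>lborel \<partial>lborel) < \<infinity>"
  proof -
    let ?C = "kernel_tail_const TYPE('a) s"
    have C: "0 \<le> ?C" using kernel_tail_const_pos[OF s, where 'a='a] by simp
    have "(\<integral>\<^sup>+y. F x y \<partial>lborel) \<le> ennreal ?C * ennreal (\<bar>f x\<bar> * infdist x (- \<Omega>) powr - s)" for x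
    proof (cases "x \<in> \<Omega>")
      case True
      have "(\<integral>\<^sup>+y. F x y \<partial>lborel) = ennreal \<bar>f x\<bar> * (\<integral>\<^sup>+y. ennreal (1 / norm (x - y) powr ?q) * indicator (- \<Omega>) y \<partial>lborel)"
        unfolding F_def by (rule nn_integral_cmult) measurable
      also have "\<dots> \<le> ennreal \<bar>f x\<bar> * ennreal (?C * infdist x (- \<Omega>) powr - s)"
        by (intro mult_left_mono exterior_potential[OF s \<Omega> True]) auto
      also have "\<dots> = ennreal ?C * ennreal (\<bar>f x\<bar> * infdist x (- \<Omega>) powr - s)"
        using C by (simp add: ennreal_mult[symmetric] mult_ac)
      finally show ?thesis .
    qed (simp add: F_def zero)
    then have "(\<integral>\<^sup>+x. \<integral>\<^sup>+y. F x y \<partial>lborel \<partial>lborel)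
        \<le> (\<integral>\<^sup>+x. ennreal ?C * ennreal (\<bar>f x\<bar> * infdist x (- \<Omega>) powr - s) \<partial>lborel)"
      by (intro nn_integral_mono)
    also have "\<dots> = ennreal ?C * (\<integral>\<^sup>+x. ennreal (\<bar>f x\<bar> * infdist x (- \<Omega>) powr - s) \<partial>lborel)"
      by (rule nn_integral_cmult) measurable
    also have "\<dots> < \<infinity>"
      using hardy by (simp add: ennreal_mult_less_top)
    finally show ?thesis .
  qed
  have "I z \<le> I z * indicator (\<Omega> \<times> \<Omega>) z + (F (fst z) (snd z) + F (snd z) (fst z))" for z
  proof -
    have "I z \<le> F (fst z) (snd z)" if "fst z \<in> \<Omega>" "snd z \<notin> \<Omega>"
      using that by (simp add: I_def F_def zero ennreal_mult'[symmetric])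
    moreover have "I z \<le> F (snd z) (fst z)" if "fst z \<notin> \<Omega>" "snd z \<in> \<Omega>"
      using that by (simp add: I_def F_def zero ennreal_mult'[symmetric] norm_minus_commute)
    moreover have "I z = 0" if "fst z \<notin> \<Omega>" "snd z \<notin> \<Omega>"
      using that by (simp add: I_def zero)
    ultimately show ?thesis
      by (cases "fst z \<in> \<Omega>"; cases "snd z \<in> \<Omega>")
        (auto simp: indicator_def mem_Times_iff intro: add_increasing add_increasing2)
  qed
  then have "gagliardo s f \<le> (\<integral>\<^sup>+z. I z * indicator (\<Omega> \<times> \<Omega>) z + (F (fst z) (snd z) + F (snd z) (fst z)) \<partial>lborel)"
    unfolding gagliardo_def I_def[symmetric] by (intro nn_integral_mono)
  also have "\<dots> = (\<integral>\<^sup>+z. I z * indicator (\<Omega> \<times> \<Omega>) z \<partial>lborel)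
      + ((\<integral>\<^sup>+z. F (fst z) (snd z) \<partial>lborel) + (\<integral>\<^sup>+z. F (snd z) (fst z) \<partial>lborel))"
    using mF mF' by (simp add: nn_integral_add)
  also have "(\<integral>\<^sup>+z. F (fst z) (snd z) \<partial>lborel) = (\<integral>\<^sup>+x. \<integral>\<^sup>+y. F x y \<partial>lborel \<partial>lborel)"
    by (subst nn_integral_lborel_pair(1)[OF mF]) simp
  also have "(\<integral>\<^sup>+z. F (snd z) (fst z) \<partial>lborel) = (\<integral>\<^sup>+x. \<integral>\<^sup>+y. F x y \<partial>lborel \<partial>lborel)"
    by (subst nn_integral_lborel_pair(2)[OF mF']) simp
  also have "(\<integral>\<^sup>+z. I z * indicator (\<Omega> \<times> \<Omega>) z \<partial>lborel) + ((\<integral>\<^sup>+x. \<integral>\<^sup>+y. F x y \<partial>lborel \<partial>lborel) + (\<integral>\<^sup>+x. \<integral>\<^sup>+y. F x y \<partial>lborel \<partial>lborel)) < \<infinity>"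
    using inner F_fin by (simp add: I_def)
  finally show ?thesis .
qed

section \<open>A fractional Hardy inequality on Lipschitz domains\<close>

definition layer :: "'a::euclidean_space set \<Rightarrow> real \<Rightarrow> 'a set" where
  "layer \<Omega> h = {x \<in> \<Omega>. infdist x (- \<Omega>) < h}"

definition mass :: "'a::euclidean_space set \<Rightarrow> ('a \<Rightarrow> real) \<Rightarrow> ennreal" where
  "mass S u = (\<integral>\<^sup>+x. ennreal \<bar>u x\<bar> * indicator S x \<partial>lborel)"

definition short_range :: "'a::euclidean_space set \<Rightarrow> ('a \<Rightarrow> real) \<Rightarrow> real \<Rightarrow> ennreal" where
  "short_range \<Omega> u R =
    (\<integral>\<^sup>+x. \<integral>\<^sup>+y. ennreal \<bar>u x - u y\<bar> * of_bool (x \<in> \<Omega> \<and> y \<in> \<Omega> \<and> norm (x - y) < R) \<partial>lborel \<partial>lborel)"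

lemma layer_borel [measurable]: "open \<Omega> \<Longrightarrow> layer \<Omega> h \<in> sets borel"
proof -
  assume "open \<Omega>"
  then have [measurable]: "\<Omega> \<in> sets borel" by simp
  show ?thesis unfolding layer_def by measurable
qed

lemma mass_mono: "S \<subseteq> T \<Longrightarrow> mass S u \<le> mass T u"
  unfolding mass_def by (intro nn_integral_mono mult_left_mono) (auto simp: indicator_def)

text \<open>
  One step of the Hardy argument inside a boundary chart. A thin piece \<open>S\<close> of the boundary layer
  is moved inwards by the vectors \<open>j H \<nu> + w\<close>, \<open>1 \<le> j \<le> m\<close>. For fixed \<open>w\<close> its \<open>m\<close> images are
  disjoint and lie in the layer that is about \<open>m\<close> times thicker, so \<open>m\<close> times the mass of \<open>S\<close> is
  at most the mass of that layer, up to differences \<open>\<bar>u x - u y\<bar>\<close>. Averaging over \<open>w\<close> in a ball of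
  radius \<open>h\<close> turns these differences along fixed directions into the double integral.
\<close>

lemma layer_step_chart:
  fixes \<Omega> :: "'a::euclidean_space set" and u :: "'a \<Rightarrow> real"
  assumes u [measurable]: "u \<in> borel_measurable borel" and \<Omega>: "open \<Omega>" "- \<Omega> \<noteq> {}"
    and \<nu>: "norm \<nu> = 1" and lip: "K-lipschitz_on {z. z \<bullet> \<nu> = 0} \<gamma>"
    and chart: "\<Omega> \<inter> ball p r = {x \<in> ball p r. \<gamma> (x - (x \<bullet> \<nu>) *\<^sub>R \<nu>) < x \<bullet> \<nu>}"
    and \<kappa>: "1 + K \<le> \<kappa>" and h: "0 < h" and R: "(real m + 2) * (\<kappa> * h) \<le> r / 4"
    and S: "S \<subseteq> layer \<Omega> h \<inter> ball p (r / 2)" and [measurable]: "S \<in> sets borel"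
  shows "of_nat m * mass S u \<le> mass (layer \<Omega> ((real m + 2) * (\<kappa> * h))) u
     + ennreal (real m / (unit_ball_vol DIM('a) * h ^ DIM('a))) * short_range \<Omega> u ((real m + 2) * (\<kappa> * h))"
proof -
  (* t is the height above the boundary graph in direction \<nu>. A point of S has height below H,
     and a shift by w changes the height by less than H. *)
  define H where "H = \<kappa> * h"
  define R where "R = (real m + 2) * H"
  define t where "t x = x \<bullet> \<nu> - \<gamma> (x - (x \<bullet> \<nu>) *\<^sub>R \<nu>)" for x
  have [measurable]: "\<Omega> \<in> sets borel" "layer \<Omega> R \<in> sets borel" using \<Omega> by auto
  have K: "0 \<le> K" using lip by (rule lipschitz_on_nonneg)
  have \<nu>\<nu>: "\<nu> \<bullet> \<nu> = 1" using \<nu> by (simp add: norm_eq_1)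
  have "1 * h \<le> \<kappa> * h" using \<kappa> K h by (intro mult_right_mono) auto
  then have hH: "h \<le> H" by (simp add: H_def)
  have H: "h \<le> H" "0 < H" using hH h by linarith+
  have R4: "R \<le> r / 4" using R by (simp add: R_def H_def)
  have HR: "2 * H \<le> R" using H by (simp add: R_def distrib_right)
  have t_shift: "t (x + c *\<^sub>R \<nu>) = t x + c" for x c
    by (simp add: t_def inner_add_left \<nu>\<nu> algebra_simps)
  have t_lip: "\<bar>t x - t y\<bar> \<le> (1 + K) * norm (x - y)" for x y
  proof -
    have proj: "norm (v - (v \<bullet> \<nu>) *\<^sub>R \<nu>) \<le> norm v" for v
    proof -
      have "(norm (v - (v \<bullet> \<nu>) *\<^sub>R \<nu>))\<^sup>2 = (norm v)\<^sup>2 - (v \<bullet> \<nu>)\<^sup>2"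
        unfolding power2_norm_eq_inner
        by (simp add: inner_diff_left inner_diff_right \<nu>\<nu> inner_commute power2_eq_square)
      then have "(norm (v - (v \<bullet> \<nu>) *\<^sub>R \<nu>))\<^sup>2 \<le> (norm v)\<^sup>2" by simp
      then show ?thesis by (rule power2_le_imp_le) simp
    qed
    have "\<bar>\<gamma> (x - (x \<bullet> \<nu>) *\<^sub>R \<nu>) - \<gamma> (y - (y \<bullet> \<nu>) *\<^sub>R \<nu>)\<bar>
        \<le> K * dist (x - (x \<bullet> \<nu>) *\<^sub>R \<nu>) (y - (y \<bullet> \<nu>) *\<^sub>R \<nu>)"
      unfolding dist_real_def[symmetric]
      by (rule lipschitz_onD[OF lip]) (auto simp: inner_diff_left \<nu>\<nu>)
    also have "dist (x - (x \<bullet> \<nu>) *\<^sub>R \<nu>) (y - (y \<bullet> \<nu>) *\<^sub>R \<nu>) = norm ((x - y) - ((x - y) \<bullet> \<nu>) *\<^sub>R \<nu>)"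
      by (simp add: dist_norm inner_diff_left algebra_simps)
    also have "K * \<dots> \<le> K * norm (x - y)" using K proj by (intro mult_left_mono) auto
    finally have "\<bar>\<gamma> (x - (x \<bullet> \<nu>) *\<^sub>R \<nu>) - \<gamma> (y - (y \<bullet> \<nu>) *\<^sub>R \<nu>)\<bar> \<le> K * norm (x - y)" .
    moreover have "\<bar>x \<bullet> \<nu> - y \<bullet> \<nu>\<bar> \<le> norm (x - y)"
      using Cauchy_Schwarz_ineq2[of "x - y" \<nu>] \<nu> by (simp add: inner_diff_left)
    ultimately show ?thesis by (simp add: t_def distrib_right)
  qed
  have mem: "x \<in> \<Omega> \<longleftrightarrow> 0 < t x" if "x \<in> ball p r" for x
  proof -
    have "x \<in> \<Omega> \<longleftrightarrow> x \<in> \<Omega> \<inter> ball p r" using that by simp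
    also have "\<dots> \<longleftrightarrow> 0 < t x" unfolding chart using that by (simp add: t_def)
    finally show ?thesis .
  qed
  have r: "0 < r" using R4 HR H by linarith
  have tS: "0 < t x \<and> t x < H" if x: "x \<in> S" for x
  proof
    have xb: "dist p x < r / 2" "x \<in> \<Omega>" and xd: "infdist x (- \<Omega>) < h"
      using S x by (auto simp: layer_def)
    then show "0 < t x" using mem[of x] r by auto
    show "t x < H"
    proof (rule ccontr)
      assume tx: "\<not> t x < H"
      have "h \<le> dist x y" if y: "y \<in> - \<Omega>" for y
      proof (rule ccontr)
        assume "\<not> h \<le> dist x y"
        then have d: "dist x y < h" by simp
        then have "dist p y < r" using xb dist_triangle[of p y x] H HR R4 r by linarith
        moreover have "\<bar>t y - t x\<bar> \<le> (1 + K) * dist x y"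
          using t_lip[of y x] by (simp add: dist_norm norm_minus_commute)
        then have "\<bar>t y - t x\<bar> < (1 + K) * h"
          using d K by (smt (verit) mult_strict_left_mono)
        moreover have "(1 + K) * h \<le> H" unfolding H_def using \<kappa> h by (intro mult_right_mono) auto
        ultimately have "0 < t y" using tx by linarith
        with y mem[of y] \<open>dist p y < r\<close> show False by auto
      qed
      then have "h \<le> infdist x (- \<Omega>)"
        using \<Omega> by (auto simp: infdist_notempty intro!: cINF_greatest)
      with xd show False by simp
    qed
  qed
  have move: "x + ((real j * H) *\<^sub>R \<nu> + w) \<in> layer \<Omega> R \<and> norm ((real j * H) *\<^sub>R \<nu> + w) < R"
    if x: "x \<in> S" and w: "norm w < h" and j: "1 \<le> j" "j \<le> m" for x w j
  proof -
    define y where "y = x + ((real j * H) *\<^sub>R \<nu> + w)"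
    have "norm ((real j * H) *\<^sub>R \<nu> + w) \<le> norm ((real j * H) *\<^sub>R \<nu>) + norm w" by (rule norm_triangle_ineq)
    also have "norm ((real j * H) *\<^sub>R \<nu>) = real j * H" using \<nu> H by simp
    also have "real j * H \<le> real m * H" using j H by (intro mult_right_mono) auto
    finally have step: "norm ((real j * H) *\<^sub>R \<nu> + w) < R"
      using w H by (simp add: R_def distrib_right)
    have "y = (x + w) + (real j * H) *\<^sub>R \<nu>" by (simp add: y_def)
    then have ty: "t y = t (x + w) + real j * H" by (simp add: t_shift)
    have "\<bar>t (x + w) - t x\<bar> \<le> (1 + K) * norm w" using t_lip[of "x + w" x] by simp
    also have "\<dots> \<le> \<kappa> * norm w" using \<kappa> by (intro mult_right_mono) auto
    also have "\<dots> < H" unfolding H_def using w \<kappa> K by (intro mult_strict_left_mono) auto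
    finally have "\<bar>t (x + w) - t x\<bar> < H" .
    moreover have "H \<le> real j * H" using j H by simp
    moreover have "real j * H \<le> real m * H" using j H by (intro mult_right_mono) auto
    moreover have "R = real m * H + 2 * H" by (simp add: R_def distrib_right)
    ultimately have ty: "0 < t y" "t y < R"
      using tS[OF x] ty by linarith+
    have "dist p x < r / 2" using S x by auto
    moreover have "dist x y = norm ((real j * H) *\<^sub>R \<nu> + w)"
      unfolding y_def dist_norm by (metis add_diff_cancel_left' norm_minus_commute)
    then have "dist x y < r / 4"
      using step R4 by linarith
    ultimately have dy: "dist p y < 3 * r / 4"
      using dist_triangle[of p y x] by linarith
    then have y: "y \<in> \<Omega>" using mem[of y] ty r by auto
    (* The point of the graph below y does not belong to \<Omega>, so t y bounds the distance of y
       to the complement. *)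
    define y' where "y' = y + (- t y) *\<^sub>R \<nu>"
    have "t y' = 0" unfolding y'_def t_shift by simp
    moreover have dyy': "dist y y' = t y" using ty \<nu> by (simp add: y'_def dist_norm)
    have "dist p y' < r" using dy dyy' ty R4 dist_triangle[of p y' y] by linarith
    ultimately have "y' \<in> - \<Omega>" using mem[of y'] by auto
    then have "infdist y (- \<Omega>) \<le> t y" using infdist_le[of y' "- \<Omega>" y] dyy' by simp
    with ty y step show ?thesis by (simp add: layer_def y_def)
  qed
  have unique: "j = j'"
    if "y - ((real j * H) *\<^sub>R \<nu> + w) \<in> S" "y - ((real j' * H) *\<^sub>R \<nu> + w) \<in> S" for y w j j'
  proof -
    have *: "y - ((real i * H) *\<^sub>R \<nu> + w) = (y - w) + (- (real i * H)) *\<^sub>R \<nu>" for i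
      by simp
    have "t (y - ((real i * H) *\<^sub>R \<nu> + w)) = t (y - w) - real i * H" for i
      unfolding * t_shift by simp
    from this[of j] this[of j'] tS[OF that(1)] tS[OF that(2)] have "\<bar>real j * H - real j' * H\<bar> < H"
      by linarith
    then have "\<bar>real j - real j'\<bar> * H < 1 * H"
      using H by (simp add: left_diff_distrib[symmetric] abs_mult)
    then have "\<bar>real j - real j'\<bar> < 1" using H by simp
    then show ?thesis by linarith
  qed
  define c where "c j w = (real j * H) *\<^sub>R \<nu> + w" for j w
  define U where "U x y = ennreal \<bar>u x - u y\<bar>" for x y
  define V where "V x = ennreal \<bar>u x\<bar>" for x
  have [measurable]: "V \<in> borel_measurable borel" unfolding V_def[abs_def] by measurable
  have U_meas [measurable (raw)]: "(\<lambda>z. U (a z) (b z)) \<in> borel_measurable N"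
    if [measurable]: "a \<in> N \<rightarrow>\<^sub>M borel" "b \<in> N \<rightarrow>\<^sub>M borel" for N :: "'b measure" and a b
    unfolding U_def by measurable
  have c_meas [measurable (raw)]: "(\<lambda>z. c j (a z)) \<in> N \<rightarrow>\<^sub>M borel"
    if [measurable]: "a \<in> N \<rightarrow>\<^sub>M borel" for N :: "'b measure" and a j
    unfolding c_def by measurable
  define E where "E j w = (\<integral>\<^sup>+x. U x (x + c j w) * indicator S x \<partial>lborel)" for j w
  have E_meas: "E j \<in> borel_measurable borel" for j
    unfolding E_def[abs_def] by (intro borel_measurable_nn_integral_lborel) measurable
  have fixed_w: "of_nat m * mass S u \<le> mass (layer \<Omega> R) u + (\<Sum>j\<in>{1..m}. E j w)" if w: "norm w < h" for w
  proof -
    have one: "mass S u \<le> (\<integral>\<^sup>+y. V y * indicator S (y - c j w) \<partial>lborel) + E j w" for j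
    proof -
      have "V x * indicator S x \<le> V (x + c j w) * indicator S x + U x (x + c j w) * indicator S x" for x
        unfolding V_def U_def
        by (auto simp: indicator_def ennreal_plus[symmetric] simp del: ennreal_plus intro!: ennreal_leI)
      then have "mass S u \<le> (\<integral>\<^sup>+x. V (x + c j w) * indicator S x + U x (x + c j w) * indicator S x \<partial>lborel)"
        unfolding mass_def V_def[symmetric] by (intro nn_integral_mono)
      also have "\<dots> = (\<integral>\<^sup>+x. V (x + c j w) * indicator S x \<partial>lborel) + E j w"
        unfolding E_def by (rule nn_integral_add) measurable
      also have "(\<integral>\<^sup>+x. V (x + c j w) * indicator S x \<partial>lborel) = (\<integral>\<^sup>+y. V y * indicator S (y - c j w) \<partial>lborel)"
        by (subst nn_integral_lborel_translate[where c = "c j w", symmetric]) (auto simp: add.commute)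
      finally show ?thesis .
    qed
    have "of_nat m * mass S u = (\<Sum>j\<in>{1..m}. mass S u)" by simp
    also have "\<dots> \<le> (\<Sum>j\<in>{1..m}. (\<integral>\<^sup>+y. V y * indicator S (y - c j w) \<partial>lborel) + E j w)"
      by (intro sum_mono one)
    also have "\<dots> = (\<integral>\<^sup>+y. (\<Sum>j\<in>{1..m}. V y * indicator S (y - c j w)) \<partial>lborel) + (\<Sum>j\<in>{1..m}. E j w)"
      by (subst nn_integral_sum) (auto simp: sum.distrib)
    also have "(\<integral>\<^sup>+y. (\<Sum>j\<in>{1..m}. V y * indicator S (y - c j w)) \<partial>lborel) \<le> mass (layer \<Omega> R) u"
      unfolding mass_def V_def[symmetric]
    proof (rule nn_integral_mono)
      fix y
      show "(\<Sum>j\<in>{1..m}. V y * indicator S (y - c j w)) \<le> V y * indicator (layer \<Omega> R) y"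
      proof (cases "\<exists>j\<in>{1..m}. y - c j w \<in> S")
        case True
        then obtain j where j: "j \<in> {1..m}" "y - c j w \<in> S" by blast
        have "(\<Sum>i\<in>{1..m}. V y * indicator S (y - c i w)) = (\<Sum>i\<in>{j}. V y * indicator S (y - c i w))"
        proof (rule sum.mono_neutral_right)
          show "\<forall>i\<in>{1..m} - {j}. V y * indicator S (y - c i w) = 0"
          proof
            fix i assume "i \<in> {1..m} - {j}"
            then have "y - c i w \<notin> S" using unique[of y i w j] j(2) by (auto simp: c_def)
            then show "V y * indicator S (y - c i w) = 0" by simp
          qed
        qed (use j in auto)
        moreover have "y \<in> layer \<Omega> R"
          using move[OF j(2) w, of j] j(1) by (auto simp: c_def)
        ultimately show ?thesis using j by simp
      next
        case False
        then have "(\<Sum>j\<in>{1..m}. V y * indicator S (y - c j w)) = 0"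
          by (intro sum.neutral) auto
        then show ?thesis by (metis zero_le)
      qed
    qed
    finally show ?thesis by (simp add: add_right_mono)
  qed
  define b where "b = unit_ball_vol DIM('a) * h ^ DIM('a)"
  have b: "0 < b" using h by (simp add: b_def)
  define B where "B = ball (0::'a) h"
  have [measurable]: "B \<in> sets borel" by (simp add: B_def)
  have B_iff: "w \<in> B \<longleftrightarrow> norm w < h" for w by (simp add: B_def)
  have ball: "emeasure lborel B = ennreal b"
    using h by (simp add: b_def B_def emeasure_ball)
  have avg_E: "(\<integral>\<^sup>+w. E j w * indicator B w \<partial>lborel) \<le> short_range \<Omega> u R" if j: "j \<in> {1..m}" for j
  proof -
    have "(\<integral>\<^sup>+w. E j w * indicator B w \<partial>lborel)
        = (\<integral>\<^sup>+w. \<integral>\<^sup>+x. U x (x + c j w) * indicator S x * indicator B w \<partial>lborel \<partial>lborel)"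
      unfolding E_def by (intro nn_integral_cong nn_integral_multc[symmetric]) measurable
    also have "\<dots> = (\<integral>\<^sup>+x. \<integral>\<^sup>+w. U x (x + c j w) * indicator S x * indicator B w \<partial>lborel \<partial>lborel)"
    proof (rule nn_integral_lborel_swap)
      have [measurable]: "(\<lambda>z::'a \<times> 'a. indicator S (snd z) :: ennreal) \<in> borel_measurable borel"
        by (rule measurable_compose[OF snd_borel borel_measurable_indicator]) simp
      have [measurable]: "(\<lambda>z::'a \<times> 'a. indicator B (fst z) :: ennreal) \<in> borel_measurable borel"
        by (rule measurable_compose[OF fst_borel borel_measurable_indicator]) simp
      have [measurable]: "(\<lambda>z::'a \<times> 'a. u (snd z)) \<in> borel_measurable borel"
        by (rule measurable_compose[OF snd_borel u])
      have [measurable]: "(\<lambda>z::'a \<times> 'a. u (snd z + c j (fst z))) \<in> borel_measurable borel"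
        unfolding c_def
        by (rule measurable_compose[where N = borel and g = u])
          (intro borel_measurable_add borel_measurable_const fst_borel snd_borel u)+
      show "(\<lambda>(w, x). U x (x + c j w) * indicator S x * indicator B w) \<in> borel_measurable borel"
        unfolding U_def case_prod_beta' by measurable
    qed
    also have "\<dots> \<le> (\<integral>\<^sup>+x. \<integral>\<^sup>+w. U x (x + c j w) * of_bool (x \<in> \<Omega> \<and> x + c j w \<in> \<Omega> \<and> norm (x - (x + c j w)) < R) \<partial>lborel \<partial>lborel)"
    proof (intro nn_integral_mono)
      fix x w
      show "U x (x + c j w) * indicator S x * indicator B w
          \<le> U x (x + c j w) * of_bool (x \<in> \<Omega> \<and> x + c j w \<in> \<Omega> \<and> norm (x - (x + c j w)) < R)"
      proof (cases "x \<in> S \<and> norm w < h")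
        case True
        then have "x + c j w \<in> layer \<Omega> R \<and> norm (c j w) < R"
          using move[of x w j] j by (simp add: c_def)
        moreover have "x \<in> \<Omega>" using True S by (auto simp: layer_def)
        ultimately show ?thesis using True by (simp add: layer_def B_iff)
      qed (auto simp: indicator_def B_iff)
    qed
    also have "\<dots> = short_range \<Omega> u R"
      unfolding short_range_def U_def[symmetric]
    proof (rule nn_integral_cong)
      fix x :: 'a
      have "(\<integral>\<^sup>+y. U x y * of_bool (x \<in> \<Omega> \<and> y \<in> \<Omega> \<and> norm (x - y) < R) \<partial>lborel)
         = (\<integral>\<^sup>+w. U x ((x + (real j * H) *\<^sub>R \<nu>) + w) * of_bool (x \<in> \<Omega> \<and> (x + (real j * H) *\<^sub>R \<nu>) + w \<in> \<Omega> \<and> norm (x - ((x + (real j * H) *\<^sub>R \<nu>) + w)) < R) \<partial>lborel)"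
        by (subst nn_integral_lborel_translate) auto
      then show "(\<integral>\<^sup>+w. U x (x + c j w) * of_bool (x \<in> \<Omega> \<and> x + c j w \<in> \<Omega> \<and> norm (x - (x + c j w)) < R) \<partial>lborel)
        = (\<integral>\<^sup>+y. U x y * of_bool (x \<in> \<Omega> \<and> y \<in> \<Omega> \<and> norm (x - y) < R) \<partial>lborel)"
        by (simp add: c_def add.assoc)
    qed
    finally show ?thesis .
  qed
  have "of_nat m * mass S u * ennreal b = (\<integral>\<^sup>+w. (of_nat m * mass S u) * indicator B (w::'a) \<partial>lborel)"
    by (simp add: nn_integral_cmult_indicator ball)
  also have "\<dots> \<le> (\<integral>\<^sup>+w. mass (layer \<Omega> R) u * indicator B w + (\<Sum>j\<in>{1..m}. E j w * indicator B w) \<partial>lborel)"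
    by (intro nn_integral_mono) (use fixed_w in \<open>auto simp: indicator_def B_iff\<close>)
  also have "\<dots> = mass (layer \<Omega> R) u * ennreal b + (\<Sum>j\<in>{1..m}. \<integral>\<^sup>+w. E j w * indicator B w \<partial>lborel)"
  proof -
    have [measurable]: "E j \<in> borel_measurable borel" for j by (rule E_meas)
    have "(\<integral>\<^sup>+w. mass (layer \<Omega> R) u * indicator B w + (\<Sum>j\<in>{1..m}. E j w * indicator B w) \<partial>lborel)
        = (\<integral>\<^sup>+w. mass (layer \<Omega> R) u * indicator B w \<partial>lborel)
          + (\<integral>\<^sup>+w. (\<Sum>j\<in>{1..m}. E j w * indicator B w) \<partial>lborel)"
      by (rule nn_integral_add) measurable
    also have "(\<integral>\<^sup>+w. mass (layer \<Omega> R) u * indicator B w \<partial>lborel) = mass (layer \<Omega> R) u * ennreal b"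
      by (simp add: nn_integral_cmult_indicator ball)
    also have "(\<integral>\<^sup>+w. (\<Sum>j\<in>{1..m}. E j w * indicator B w) \<partial>lborel)
        = (\<Sum>j\<in>{1..m}. \<integral>\<^sup>+w. E j w * indicator B w \<partial>lborel)"
      by (rule nn_integral_sum) measurable
    finally show ?thesis .
  qed
  also have "\<dots> \<le> mass (layer \<Omega> R) u * ennreal b + (\<Sum>j\<in>{1..m}. short_range \<Omega> u R)"
    by (intro add_left_mono sum_mono avg_E)
  finally have ineq: "of_nat m * mass S u * ennreal b \<le> mass (layer \<Omega> R) u * ennreal b + of_nat m * short_range \<Omega> u R"
    by simp
  have inv: "ennreal b * ennreal (1 / b) = 1"
    using b by (simp add: ennreal_mult[symmetric])
  have "of_nat m * mass S u = (of_nat m * mass S u * ennreal b) * ennreal (1 / b)"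
    using inv by (simp add: mult.assoc)
  also have "\<dots> \<le> (mass (layer \<Omega> R) u * ennreal b + of_nat m * short_range \<Omega> u R) * ennreal (1 / b)"
    by (intro mult_right_mono ineq) simp
  also have "\<dots> = mass (layer \<Omega> R) u + (of_nat m * ennreal (1 / b)) * short_range \<Omega> u R"
    using inv by (simp add: distrib_right mult.assoc) (simp add: mult_ac)
  also have "of_nat m * ennreal (1 / b) = ennreal (real m / b)"
    using b by (simp add: ennreal_of_nat_eq_real_of_nat ennreal_mult[symmetric])
  finally show ?thesis by (simp add: R_def H_def b_def)
qed

text \<open>
  The conclusion of the chart lemma, summed over finitely many charts. The constants serve all
  functions \<open>u\<close> and all \<open>m\<close> at once.
\<close>

definition layer_estimate :: "'a::euclidean_space set \<Rightarrow> real \<Rightarrow> real \<Rightarrow> nat \<Rightarrow> bool" where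
  "layer_estimate \<Omega> \<kappa> h1 L \<longleftrightarrow> (\<forall>u m h. u \<in> borel_measurable borel \<longrightarrow> 0 < h \<longrightarrow> (real m + 2) * (\<kappa> * h) \<le> h1 \<longrightarrow>
      of_nat m * mass (layer \<Omega> h) u \<le> of_nat L * (mass (layer \<Omega> ((real m + 2) * (\<kappa> * h))) u
       + ennreal (real m / (unit_ball_vol DIM('a) * h ^ DIM('a))) * short_range \<Omega> u ((real m + 2) * (\<kappa> * h))))"

text \<open>
  The charts are combined by compactness of the boundary; their number \<open>L\<close> does not depend on
  \<open>m\<close>, which is what makes a large \<open>m\<close> useful later.
\<close>

lemma layer_step:
  fixes \<Omega> :: "'a::euclidean_space set"
  assumes \<Omega>: "open \<Omega>" "bounded \<Omega>" "lipschitz_boundary \<Omega>"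
  obtains \<kappa> h1 :: real and L :: nat where "1 \<le> \<kappa>" "0 < h1" "layer_estimate \<Omega> \<kappa> h1 L"
proof -
  have compl: "- \<Omega> \<noteq> {}" using \<Omega>(2) by (rule bounded_Compl_nonempty)
  (* Naming the chart condition keeps its set equation out of the choice of radii below. *)
  define is_chart where "is_chart p r \<nu> \<gamma> K \<longleftrightarrow> norm \<nu> = 1 \<and> K-lipschitz_on {z. z \<bullet> \<nu> = 0} \<gamma> \<and>
        \<Omega> \<inter> ball p r = {x \<in> ball p r. \<gamma> (x - (x \<bullet> \<nu>) *\<^sub>R \<nu>) < x \<bullet> \<nu>}" for p r \<nu> \<gamma> K
  have "\<forall>p\<in>frontier \<Omega>. \<exists>r>0. \<exists>\<nu> \<gamma> K. is_chart p r \<nu> \<gamma> K"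
    using \<Omega>(3) unfolding lipschitz_boundary_def is_chart_def .
  then have "\<forall>p\<in>frontier \<Omega>. \<exists>r K. 0 < r \<and> (\<exists>\<nu> \<gamma>. is_chart p r \<nu> \<gamma> K)" by blast
  then have "\<exists>r K. \<forall>p\<in>frontier \<Omega>. 0 < r p \<and> (\<exists>\<nu> \<gamma>. is_chart p (r p) \<nu> \<gamma> (K p))" by metis
  then obtain r K where rK: "\<And>p. p \<in> frontier \<Omega> \<Longrightarrow> 0 < r p"
    "\<And>p. p \<in> frontier \<Omega> \<Longrightarrow> \<exists>\<nu> \<gamma>. is_chart p (r p) \<nu> \<gamma> (K p)"
    by blast
  have cf: "compact (frontier \<Omega>)" using \<Omega>(2) by (rule compact_frontier_bounded)
  have cov: "frontier \<Omega> \<subseteq> (\<Union>p\<in>frontier \<Omega>. ball p (r p / 2))"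
  proof
    fix p assume p: "p \<in> frontier \<Omega>"
    then have "p \<in> ball p (r p / 2)" using rK(1)[OF p] by simp
    with p show "p \<in> (\<Union>p\<in>frontier \<Omega>. ball p (r p / 2))" by (rule UN_I)
  qed
  obtain P where P: "P \<subseteq> frontier \<Omega>" "finite P" "frontier \<Omega> \<subseteq> (\<Union>p\<in>P. ball p (r p / 2))"
    by (rule compactE_image[where f = "\<lambda>p. ball p (r p / 2)", OF cf open_ball cov])
  define \<kappa> where "\<kappa> = Max (insert 1 ((\<lambda>p. 1 + K p) ` P))"
  have \<kappa>: "1 \<le> \<kappa>" "\<And>p. p \<in> P \<Longrightarrow> 1 + K p \<le> \<kappa>"
    unfolding \<kappa>_def by (intro Max_ge; use P(2) in simp)+
  define W where "W = (\<Union>p\<in>P. ball p (r p / 2))"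
  have "compact (closure \<Omega> - W)"
  proof (rule compact_diff)
    show "compact (closure \<Omega>)" using \<Omega>(2) by (simp add: compact_closure)
    show "open W" unfolding W_def by (intro open_UN ballI open_ball)
  qed
  moreover have "closed (- \<Omega>)" using \<Omega>(1) by auto
  moreover have "(closure \<Omega> - W) \<inter> (- \<Omega>) = {}"
    using P(3) \<Omega>(1) unfolding W_def[symmetric] by (auto simp: frontier_def interior_open)
  ultimately obtain d where d: "0 < d" "\<And>x y. x \<in> closure \<Omega> - W \<Longrightarrow> y \<in> - \<Omega> \<Longrightarrow> d \<le> dist x y"
    using separate_compact_closed[of "closure \<Omega> - W" "- \<Omega>"] by metis
  (* Layers thinner than d stay inside the union W of the half-size chart balls. *)
  define h1 where "h1 = Min (insert d ((\<lambda>p. r p / 4) ` P))"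
  have h1_pos: "0 < h1"
  proof -
    have "h1 \<in> insert d ((\<lambda>p. r p / 4) ` P)"
      unfolding h1_def by (rule Min_in) (simp_all only: P(2) finite_insert finite_imageI insert_not_empty not_False_eq_True)
    then show ?thesis
    proof (elim insertE imageE)
      assume "h1 = d"
      then show ?thesis using d(1) by simp
    next
      fix p assume "h1 = r p / 4" "p \<in> P"
      then show ?thesis using rK(1)[of p] P(1) by (simp add: subset_iff)
    qed
  qed
  have h1: "h1 \<le> d" "\<And>p. p \<in> P \<Longrightarrow> h1 \<le> r p / 4"
    unfolding h1_def by (intro Min_le; use P(2) in simp)+
  show thesis
  proof (rule that[OF \<kappa>(1) h1_pos, where L = "card P"], unfold layer_estimate_def, intro allI impI)
    fix u :: "'a \<Rightarrow> real" and m :: nat and h :: real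
    assume u: "u \<in> borel_measurable borel" and h: "0 < h" and R: "(real m + 2) * (\<kappa> * h) \<le> h1"
    let ?R = "(real m + 2) * (\<kappa> * h)"
    let ?X = "mass (layer \<Omega> ?R) u + ennreal (real m / (unit_ball_vol DIM('a) * h ^ DIM('a))) * short_range \<Omega> u ?R"
    have "h \<le> \<kappa> * h" using \<kappa>(1) h by simp
    also have "\<dots> \<le> ?R" using \<kappa>(1) h by (simp add: distrib_right)
    finally have hd: "h \<le> d" using R h1(1) by linarith
    have cover: "layer \<Omega> h \<subseteq> (\<Union>p\<in>P. layer \<Omega> h \<inter> ball p (r p / 2))"
    proof
      fix x assume x: "x \<in> layer \<Omega> h"
      have "x \<in> W"
      proof (rule ccontr)
        assume "x \<notin> W"
        with x have "x \<in> closure \<Omega> - W" using closure_subset by (auto simp: layer_def)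
        then have "d \<le> infdist x (- \<Omega>)"
          unfolding infdist_notempty[OF compl] using d(2) compl by (intro cINF_greatest)
        with x hd show False by (simp add: layer_def)
      qed
      with x show "x \<in> (\<Union>p\<in>P. layer \<Omega> h \<inter> ball p (r p / 2))" unfolding W_def by blast
    qed
    have piece: "of_nat m * mass (layer \<Omega> h \<inter> ball p (r p / 2)) u \<le> ?X" if p: "p \<in> P" for p
    proof -
      obtain \<nu> \<gamma> where "is_chart p (r p) \<nu> \<gamma> (K p)"
        using rK(2)[of p] p P(1) by blast
      note c = this[unfolded is_chart_def]
      have "?R \<le> r p / 4" using R h1(2)[OF p] by linarith
      then show ?thesis
        by (rule layer_step_chart[OF u \<Omega>(1) compl conjunct1[OF c] conjunct1[OF conjunct2[OF c]] conjunct2[OF conjunct2[OF c]] \<kappa>(2)[OF p] h _ subset_refl])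
          (intro sets.Int layer_borel borel_open open_ball \<Omega>(1))
    qed
    have [measurable]: "layer \<Omega> h \<in> sets borel" using \<Omega>(1) by simp
    define T where "T p = layer \<Omega> h \<inter> ball p (r p / 2)" for p
    have mT [measurable]: "T p \<in> sets borel" for p
      unfolding T_def by (intro sets.Int layer_borel borel_open open_ball \<Omega>(1))
    note [measurable] = u
    have "mass (layer \<Omega> h) u \<le> (\<Sum>p\<in>P. mass (T p) u)"
    proof -
      have "ennreal \<bar>u x\<bar> * indicator (layer \<Omega> h) x \<le> (\<Sum>p\<in>P. ennreal \<bar>u x\<bar> * indicator (T p) x)" for x
      proof (cases "x \<in> layer \<Omega> h")
        case True
        then obtain p where p: "p \<in> P" "x \<in> T p" using cover unfolding T_def by blast
        have "ennreal \<bar>u x\<bar> * indicator (layer \<Omega> h) x = ennreal \<bar>u x\<bar> * indicator (T p) x"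
          using True p(2) by simp
        also have "\<dots> \<le> (\<Sum>p\<in>P. ennreal \<bar>u x\<bar> * indicator (T p) x)"
          by (rule member_le_sum[OF p(1)]) (use P(2) in auto)
        finally show ?thesis .
      qed simp
      then have "mass (layer \<Omega> h) u \<le> (\<integral>\<^sup>+x. (\<Sum>p\<in>P. ennreal \<bar>u x\<bar> * indicator (T p) x) \<partial>lborel)"
        unfolding mass_def by (intro nn_integral_mono)
      also have "\<dots> = (\<Sum>p\<in>P. mass (T p) u)"
        unfolding mass_def by (intro nn_integral_sum) (use u in measurable)
      finally show ?thesis .
    qed
    then have "of_nat m * mass (layer \<Omega> h) u \<le> of_nat m * (\<Sum>p\<in>P. mass (layer \<Omega> h \<inter> ball p (r p / 2)) u)"
      unfolding T_def
      by (intro mult_left_mono) auto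
    also have "\<dots> = (\<Sum>p\<in>P. of_nat m * mass (layer \<Omega> h \<inter> ball p (r p / 2)) u)"
      by (rule sum_distrib_left)
    also have "\<dots> \<le> (\<Sum>p\<in>P. ?X)" by (intro sum_mono piece)
    finally show "of_nat m * mass (layer \<Omega> h) u \<le> of_nat (card P) * ?X" by simp
  qed
qed

text \<open>
  A geometric sum cut off at \<open>lam\<^sup>k < X\<close> is comparable to its last term. It is used with \<open>X\<close>
  proportional to \<open>1 / \<bar>x - y\<bar>\<close> and turns the sum over all scales of short-range differences into
  the Gagliardo kernel.
\<close>

lemma geometric_cutoff_bound:
  fixes lam e X :: real
  assumes lam: "1 < lam" and e: "0 < e" and X: "0 < X"
  shows "(\<Sum>k<N. (lam powr e) ^ k * of_bool (lam ^ k < X)) \<le> lam powr e / (lam powr e - 1) * X powr e"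
proof (induction N)
  case 0
  have "1 < lam powr e" using lam e by simp
  then show ?case by simp
next
  case (Suc N)
  define \<mu> where "\<mu> = lam powr e"
  have \<mu>: "1 < \<mu>" using lam e by (simp add: \<mu>_def)
  show ?case
  proof (cases "lam ^ N < X")
    case True
    have "(\<Sum>k<Suc N. \<mu> ^ k * of_bool (lam ^ k < X)) \<le> (\<Sum>k<Suc N. \<mu> ^ k)"
      using \<mu> by (intro sum_mono) auto
    also have "\<dots> = (\<mu> ^ Suc N - 1) / (\<mu> - 1)"
      using \<mu> by (subst geometric_sum) auto
    also have "\<dots> \<le> \<mu> ^ Suc N / (\<mu> - 1)"
      using \<mu> by (intro divide_right_mono) auto
    also have "\<dots> = \<mu> / (\<mu> - 1) * \<mu> ^ N" by simp
    also have "\<mu> ^ N = (lam ^ N) powr e"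
      using lam by (simp add: \<mu>_def powr_powr powr_realpow[symmetric] mult.commute)
    also have "\<mu> / (\<mu> - 1) * \<dots> \<le> \<mu> / (\<mu> - 1) * X powr e"
      using \<mu> True lam e by (intro mult_left_mono powr_mono2) auto
    finally show ?thesis by (simp add: \<mu>_def)
  next
    case False
    then show ?thesis using Suc.IH by simp
  qed
qed

lemma summable_of_contraction:
  fixes a b :: "nat \<Rightarrow> real"
  assumes a: "\<And>k. 0 \<le> a k" and b: "\<And>k. 0 \<le> b k" "summable b"
    and q: "0 \<le> q" "q < 1" and step: "\<And>k. a (Suc k) \<le> q * a k + b k"
  shows "summable a"
proof (rule summableI_nonneg_bounded[where x = "(a 0 + suminf b) / (1 - q)"])
  fix N
  have "sum a {..<N} \<le> sum a {..<Suc N}" using a by simp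
  also have S: "\<dots> = a 0 + (\<Sum>k<N. a (Suc k))" by (rule sum.lessThan_Suc_shift)
  also have "\<dots> \<le> a 0 + (\<Sum>k<N. q * a k + b k)" using step by (intro add_left_mono sum_mono)
  also have "\<dots> = a 0 + q * sum a {..<N} + sum b {..<N}"
    by (simp add: sum.distrib sum_distrib_left)
  also have "sum b {..<N} \<le> suminf b" using b by (intro sum_le_suminf) auto
  finally have "(1 - q) * sum a {..<N} \<le> a 0 + suminf b" by (simp add: algebra_simps)
  then show "sum a {..<N} \<le> (a 0 + suminf b) / (1 - q)"
    using q(2) by (simp add: pos_le_divide_eq mult.commute)
qed (rule a)

text \<open>
  Summing the layer estimate over the thicknesses \<open>h1 / lam\<^sup>k\<close> with weights \<open>h\<^sup>-\<^sup>s\<close>: the factor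
  gained from one layer to the next is \<open>(L / m) ((m + 2) \<kappa>)\<^sup>s\<close>, and as \<open>s < 1\<close> it is below 1
  for large \<open>m\<close>.
\<close>

theorem fractional_hardy:
  fixes \<Omega> :: "'a::euclidean_space set" and u :: "'a \<Rightarrow> real"
  assumes s: "0 < s" "s < 1" and \<Omega>: "open \<Omega>" "bounded \<Omega>" "lipschitz_boundary \<Omega>"
    and u [measurable]: "u \<in> borel_measurable borel" and L1: "mass \<Omega> u < \<infinity>"
    and inner: "(\<integral>\<^sup>+z. ennreal (\<bar>u (fst z) - u (snd z)\<bar> / norm (fst z - snd z) powr (real DIM('a) + s))
        * indicator (\<Omega> \<times> \<Omega>) z \<partial>lborel) < \<infinity>"
  shows "(\<integral>\<^sup>+x. ennreal (\<bar>u x\<bar> * infdist x (- \<Omega>) powr - s) * indicator \<Omega> x \<partial>lborel) < \<infinity>"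
proof -
  let ?n = "real DIM('a)"
  define e where "e = ?n + s"
  have e: "0 < e" using s by (simp add: e_def)
  have [measurable]: "\<Omega> \<in> sets borel" using \<Omega> by auto
  have compl: "- \<Omega> \<noteq> {}" using \<Omega>(2) by (rule bounded_Compl_nonempty)
  obtain \<kappa> h1 :: real and L :: nat where \<kappa>: "1 \<le> \<kappa>" and h1: "0 < h1" and step: "layer_estimate \<Omega> \<kappa> h1 L"
    by (rule layer_step[OF \<Omega>])
  (* As (m + 2) \<kappa> \<le> 3 \<kappa> m, this choice of m makes the factor q below smaller than 1. *)
  obtain m :: nat where m: "1 \<le> m" and q1: "real L * (3 * \<kappa>) powr s * real m powr (s - 1) < 1"
  proof -
    have "(\<lambda>m. real L * (3 * \<kappa>) powr s * real m powr (s - 1)) \<longlonglongrightarrow> real L * (3 * \<kappa>) powr s * 0"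
      using s by (intro tendsto_mult tendsto_const tendsto_neg_powr filterlim_real_sequentially) simp
    then have "\<forall>\<^sub>F m in sequentially. real L * (3 * \<kappa>) powr s * real m powr (s - 1) < 1"
      by (intro order_tendstoD) auto
    then obtain N where N: "\<And>m. N \<le> m \<Longrightarrow> real L * (3 * \<kappa>) powr s * real m powr (s - 1) < 1"
      unfolding eventually_sequentially by blast
    show thesis by (rule that[of "max N 1"]) (use N[of "max N 1"] in simp_all)
  qed
  define lam where "lam = (real m + 2) * \<kappa>"
  have m2: "3 \<le> real m + 2" using m by simp
  have lam: "1 < lam"
  proof -
    have "3 * 1 \<le> (real m + 2) * \<kappa>" using m2 \<kappa> by (intro mult_mono) simp_all
    then show ?thesis by (simp add: lam_def)
  qed
  define q where "q = real L / real m * lam powr s"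
  have q0: "0 \<le> q" by (simp add: q_def)
  have q: "q < 1"
  proof -
    have "lam \<le> (3 * real m) * \<kappa>" unfolding lam_def using m \<kappa> by (intro mult_right_mono) simp_all
    then have "lam powr s \<le> ((3 * \<kappa>) * real m) powr s"
      using lam s by (intro powr_mono2) (simp_all add: mult_ac)
    also have "\<dots> = (3 * \<kappa>) powr s * real m powr s" using \<kappa> by (simp add: powr_mult)
    finally have "q \<le> real L / real m * ((3 * \<kappa>) powr s * real m powr s)"
      unfolding q_def by (intro mult_left_mono) simp_all
    also have "\<dots> = real L * (3 * \<kappa>) powr s * real m powr (s - 1)"
      using m by (simp add: powr_diff)
    finally show ?thesis using q1 by linarith
  qed
  define hh where "hh k = h1 / lam ^ k" for k :: nat
  have hh: "0 < hh k" for k using h1 lam by (simp add: hh_def)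
  have hh_Suc: "lam * hh (Suc k) = hh k" for k using lam by (simp add: hh_def)
  have hh_le: "hh k \<le> h1" for k
    using h1 lam by (simp add: hh_def divide_le_eq one_le_power)
  have fin: "mass S u < \<infinity>" if "S \<subseteq> \<Omega>" for S
    using mass_mono[OF that, of u] L1 by (rule le_less_trans)
  have layer_sub: "layer \<Omega> h \<subseteq> \<Omega>" for h by (auto simp: layer_def)
  define c where "c = real L / unit_ball_vol DIM('a)"
  have c0: "0 \<le> c" by (simp add: c_def)
  define B where "B k = ennreal (c * hh (Suc k) powr - e) * short_range \<Omega> u (hh k)" for k
  define A where "A k = ennreal (hh k powr - s) * mass (layer \<Omega> (hh k)) u" for k
  have A_step: "A (Suc k) \<le> ennreal q * A k + B k" for k
  proof -
    define h where "h = hh (Suc k)"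
    have h: "0 < h" by (simp add: h_def hh)
    have R: "(real m + 2) * (\<kappa> * h) = hh k"
      using hh_Suc[of k] by (simp add: lam_def h_def mult.assoc)
    let ?M = "mass (layer \<Omega> (hh k)) u" and ?D = "short_range \<Omega> u (hh k)"
    have "of_nat m * mass (layer \<Omega> h) u \<le> of_nat L * (?M + ennreal (real m / (unit_ball_vol DIM('a) * h ^ DIM('a))) * ?D)"
      using step[unfolded layer_estimate_def, rule_format, OF u h, of m] hh_le[of k] unfolding R by simp
    then have main: "ennreal (h powr - s / real m) * (of_nat m * mass (layer \<Omega> h) u)
      \<le> ennreal (h powr - s / real m) * (of_nat L * (?M + ennreal (real m / (unit_ball_vol DIM('a) * h ^ DIM('a))) * ?D))"
      by (intro mult_left_mono) simp_all
    have e1: "ennreal (h powr - s / real m) * (of_nat m * mass (layer \<Omega> h) u) = A (Suc k)"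
    proof -
      have "ennreal (h powr - s / real m) * of_nat m = ennreal (h powr - s)"
        using m by (simp add: ennreal_of_nat_eq_real_of_nat ennreal_mult[symmetric])
      then show ?thesis by (simp add: A_def h_def mult.assoc[symmetric])
    qed
    have e2: "ennreal (h powr - s / real m) * (of_nat L * (?M + ennreal (real m / (unit_ball_vol DIM('a) * h ^ DIM('a))) * ?D))
      = ennreal (h powr - s / real m * real L) * ?M
        + ennreal (h powr - s / real m * real L * (real m / (unit_ball_vol DIM('a) * h ^ DIM('a)))) * ?D"
    proof -
      have XL: "ennreal (h powr - s / real m) * of_nat L = ennreal (h powr - s / real m * real L)"
        unfolding ennreal_of_nat_eq_real_of_nat by (rule ennreal_mult[symmetric]) simp_all
      have XLY: "ennreal (h powr - s / real m * real L * (real m / (unit_ball_vol DIM('a) * h ^ DIM('a))))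
        = ennreal (h powr - s / real m * real L) * ennreal (real m / (unit_ball_vol DIM('a) * h ^ DIM('a)))"
        using h by (intro ennreal_mult) simp_all
      show ?thesis unfolding XLY XL[symmetric] by (simp only: distrib_left mult.assoc)
    qed
    have e3: "h powr - s / real m * real L = q * hh k powr - s"
    proof -
      have "hh k powr - s = lam powr - s * h powr - s"
      proof -
        have "hh k powr - s = (lam * h) powr - s" by (simp only: h_def hh_Suc)
        then show ?thesis using lam h by (simp only: powr_mult)
      qed
      moreover have "lam powr s * lam powr - s = 1" using lam by (simp add: powr_minus)
      ultimately show ?thesis by (simp add: q_def)
    qed
    have e4: "h powr - s / real m * real L * (real m / (unit_ball_vol DIM('a) * h ^ DIM('a))) = c * h powr - e"
    proof -
      have "h powr e = h ^ DIM('a) * h powr s"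
        using h by (simp add: e_def powr_add powr_realpow)
      then have "h powr - e = h powr - s / h ^ DIM('a)"
        by (simp add: powr_minus divide_inverse)
      then show ?thesis using m by (simp add: c_def)
    qed
    have "A (Suc k) \<le> ennreal (q * hh k powr - s) * ?M + ennreal (c * h powr - e) * ?D"
      using main unfolding e1 e2 e4 unfolding e3 .
    then show ?thesis
      using q0 by (simp add: A_def B_def h_def ennreal_mult mult.assoc)
  qed
  define I where "I = (\<integral>\<^sup>+z. ennreal (\<bar>u (fst z) - u (snd z)\<bar> / norm (fst z - snd z) powr e)
        * indicator (\<Omega> \<times> \<Omega>) z \<partial>lborel)"
  define Cb where "Cb = c * hh 1 powr - e * (lam powr e / (lam powr e - 1) * h1 powr e)"
  have lam_e: "1 < lam powr e" using lam e by simp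
  have Cb0: "0 \<le> Cb"
    unfolding Cb_def using c0 lam_e by simp
  have B_sum: "(\<Sum>k<N. B k) \<le> ennreal Cb * I" for N
  proof -
    have [measurable]: "\<Omega> \<times> \<Omega> \<in> sets borel" by (rule borel_Times) auto
    have short: "short_range \<Omega> u R = (\<integral>\<^sup>+z. ennreal \<bar>u (fst z) - u (snd z)\<bar> * (indicator (\<Omega> \<times> \<Omega>) z * of_bool (norm (fst z - snd z) < R)) \<partial>lborel)" for R
      unfolding short_range_def
      by (subst nn_integral_lborel_pair(1)) (auto intro!: nn_integral_cong simp: indicator_def)
    have pt: "(\<Sum>k<N. c * hh (Suc k) powr - e * of_bool (r < hh k)) \<le> Cb / r powr e" if r: "0 < r" for r
    proof -
      have X1: "hh (Suc k) powr - e = hh 1 powr - e * (lam powr e) ^ k" for k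
      proof -
        have "hh (Suc k) = hh 1 / lam ^ k" by (simp add: hh_def)
        then have "hh (Suc k) powr - e = hh 1 powr - e / (lam ^ k) powr - e"
          using lam hh[of 1] by (simp add: powr_divide)
        also have "(lam ^ k) powr - e = inverse ((lam powr e) ^ k)"
          using lam by (simp add: powr_minus powr_powr powr_realpow[symmetric] mult.commute)
        finally show ?thesis by (simp only: divide_inverse inverse_inverse_eq)
      qed
      have X2: "r < hh k \<longleftrightarrow> lam ^ k < h1 / r" for k
        using r lam by (simp add: hh_def field_simps)
      have "(\<Sum>k<N. c * hh (Suc k) powr - e * of_bool (r < hh k))
         = c * hh 1 powr - e * (\<Sum>k<N. (lam powr e) ^ k * of_bool (lam ^ k < h1 / r))"
        unfolding sum_distrib_left by (intro sum.cong refl) (simp only: X1 X2 mult.assoc)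
      also have "\<dots> \<le> c * hh 1 powr - e * (lam powr e / (lam powr e - 1) * (h1 / r) powr e)"
        using c0 r h1 by (intro mult_left_mono geometric_cutoff_bound lam e) simp_all
      also have "\<dots> = Cb / r powr e"
        using r h1 by (simp add: Cb_def powr_divide)
      finally show ?thesis .
    qed
    have "(\<Sum>k<N. B k) = (\<integral>\<^sup>+z. (\<Sum>k<N. ennreal (c * hh (Suc k) powr - e) * (ennreal \<bar>u (fst z) - u (snd z)\<bar> * (indicator (\<Omega> \<times> \<Omega>) z * of_bool (norm (fst z - snd z) < hh k)))) \<partial>lborel)"
      unfolding B_def short by (simp add: nn_integral_sum nn_integral_cmult)
    also have "\<dots> \<le> (\<integral>\<^sup>+z. ennreal Cb * (ennreal (\<bar>u (fst z) - u (snd z)\<bar> / norm (fst z - snd z) powr e) * indicator (\<Omega> \<times> \<Omega>) z) \<partial>lborel)"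
    proof (rule nn_integral_mono)
      fix z :: "'a \<times> 'a"
      define r where "r = norm (fst z - snd z)"
      define a where "a = \<bar>u (fst z) - u (snd z)\<bar>"
      show "(\<Sum>k<N. ennreal (c * hh (Suc k) powr - e) * (ennreal \<bar>u (fst z) - u (snd z)\<bar> * (indicator (\<Omega> \<times> \<Omega>) z * of_bool (norm (fst z - snd z) < hh k))))
        \<le> ennreal Cb * (ennreal (\<bar>u (fst z) - u (snd z)\<bar> / norm (fst z - snd z) powr e) * indicator (\<Omega> \<times> \<Omega>) z)"
        unfolding r_def[symmetric] a_def[symmetric]
      proof (cases "z \<in> \<Omega> \<times> \<Omega> \<and> r \<noteq> 0")
        case True
        then have r: "0 < r" by (simp add: r_def)
        have "(\<Sum>k<N. ennreal (c * hh (Suc k) powr - e) * (ennreal a * (indicator (\<Omega> \<times> \<Omega>) z * of_bool (r < hh k))))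
          = (\<Sum>k<N. ennreal (a * (c * hh (Suc k) powr - e * of_bool (r < hh k))))"
          using True c0 by (intro sum.cong) (simp_all add: ennreal_mult[symmetric] of_bool_def mult_ac a_def)
        also have "\<dots> = ennreal (a * (\<Sum>k<N. c * hh (Suc k) powr - e * of_bool (r < hh k)))"
          unfolding sum_distrib_left by (rule sum_ennreal) (use c0 in \<open>simp add: a_def\<close>)
        also have "\<dots> \<le> ennreal (a * (Cb / r powr e))"
          by (intro ennreal_leI mult_left_mono pt r) (simp add: a_def)
        also have "\<dots> = ennreal Cb * (ennreal (a / r powr e) * indicator (\<Omega> \<times> \<Omega>) z)"
          using True Cb0 by (simp add: ennreal_mult[symmetric] a_def mult_ac)
        finally show "(\<Sum>k<N. ennreal (c * hh (Suc k) powr - e) * (ennreal a * (indicator (\<Omega> \<times> \<Omega>) z * of_bool (r < hh k))))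
           \<le> ennreal Cb * (ennreal (a / r powr e) * indicator (\<Omega> \<times> \<Omega>) z)" .
      next
        case False
        then have "z \<notin> \<Omega> \<times> \<Omega> \<or> a = 0" by (auto simp: r_def a_def)
        then show "(\<Sum>k<N. ennreal (c * hh (Suc k) powr - e) * (ennreal a * (indicator (\<Omega> \<times> \<Omega>) z * of_bool (r < hh k))))
           \<le> ennreal Cb * (ennreal (a / r powr e) * indicator (\<Omega> \<times> \<Omega>) z)" by (elim disjE) simp_all
      qed
    qed
    also have "\<dots> = ennreal Cb * I"
      unfolding I_def by (rule nn_integral_cmult) measurable
    finally show ?thesis .
  qed
  have I: "I < \<infinity>" using inner by (simp add: I_def e_def)
  have B_sum_fin: "ennreal Cb * I < \<infinity>" using I by (simp add: ennreal_mult_less_top)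
  have B_fin: "B k < \<infinity>" for k
  proof -
    have "B k \<le> (\<Sum>k<Suc k. B k)" by (rule member_le_sum) simp_all
    with B_sum[of "Suc k"] B_sum_fin show ?thesis by (meson le_less_trans order_trans)
  qed
  have A_fin: "A k < \<infinity>" for k
    unfolding A_def using fin[OF layer_sub] by (simp add: ennreal_mult_less_top)
  define a where "a k = enn2real (A k)" for k
  define b where "b k = enn2real (B k)" for k
  have Aa: "A k = ennreal (a k)" for k using A_fin[of k] by (simp add: a_def less_top)
  have Bb: "B k = ennreal (b k)" for k using B_fin[of k] by (simp add: b_def less_top)
  have a0: "0 \<le> a k" and b0: "0 \<le> b k" for k by (simp_all add: a_def b_def)
  have "summable b"
  proof (rule summableI_nonneg_bounded[where x = "enn2real (ennreal Cb * I)"])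
    fix N
    have "ennreal (\<Sum>k<N. b k) \<le> ennreal Cb * I"
      using B_sum[of N] by (simp add: Bb b0 sum_ennreal)
    also have "\<dots> = ennreal (enn2real (ennreal Cb * I))" using B_sum_fin by (simp add: less_top)
    finally show "(\<Sum>k<N. b k) \<le> enn2real (ennreal Cb * I)" by (simp add: ennreal_le_iff)
  qed (rule b0)
  moreover have "a (Suc k) \<le> q * a k + b k" for k
    using A_step[of k] a0 b0 q0
    by (simp add: Aa Bb ennreal_mult[symmetric] ennreal_plus[symmetric] ennreal_le_iff del: ennreal_plus)
  ultimately have "summable a"
    by (intro summable_of_contraction[OF a0 b0 _ q0 q])
  then have sumA: "(\<Sum>k. A k) < \<infinity>"
    unfolding Aa using a0 by (simp add: suminf_ennreal2 less_top[symmetric])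
  have pt: "ennreal (\<bar>u x\<bar> * infdist x (- \<Omega>) powr - s) * indicator \<Omega> x
      \<le> ennreal (h1 powr - s) * (ennreal \<bar>u x\<bar> * indicator \<Omega> x)
        + (\<Sum>k. ennreal (lam powr s * hh k powr - s) * (ennreal \<bar>u x\<bar> * indicator (layer \<Omega> (hh k)) x))" for x
  proof (cases "x \<in> \<Omega>")
    case x: True
    define \<delta> where "\<delta> = infdist x (- \<Omega>)"
    have \<delta>: "0 < \<delta>"
      unfolding \<delta>_def using \<Omega>(1) x compl by (intro infdist_pos_not_in_closed) auto
    show ?thesis
    proof (cases "h1 \<le> \<delta>")
      case True
      then have "\<delta> powr - s \<le> h1 powr - s" using h1 s by (intro powr_mono2') simp_all
      then have "ennreal (\<bar>u x\<bar> * \<delta> powr - s) \<le> ennreal (h1 powr - s * \<bar>u x\<bar>)"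
        by (intro ennreal_leI) (metis abs_ge_zero mult.commute mult_left_mono)
      also have "\<dots> = ennreal (h1 powr - s) * (ennreal \<bar>u x\<bar> * indicator \<Omega> x)"
        using x by (simp add: ennreal_mult)
      finally show ?thesis using x by (simp add: \<delta>_def add_increasing2)
    next
      case False
      then have "1 \<le> h1 / \<delta>" using \<delta> by simp
      from power_bracket[OF lam this] obtain k where k: "lam ^ k \<le> h1 / \<delta>" "h1 / \<delta> < lam ^ Suc k" by blast
      (* Layers are defined by a strict inequality, hence the shift of the index if \<delta> is itself
         one of the thicknesses. *)
      obtain k where k: "\<delta> < hh k" "hh (Suc k) \<le> \<delta>"
      proof (cases "lam ^ k = h1 / \<delta>")
        case True
        then have "\<delta> = hh k" using \<delta> lam by (simp add: hh_def field_simps)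
        moreover have "k \<noteq> 0" using True False \<delta> by (intro notI) (simp add: field_simps)
        then obtain j where j: "k = Suc j" by (cases k) auto
        moreover have "hh (Suc j) < hh j" 
        proof -
          have "1 * hh (Suc j) < lam * hh (Suc j)" by (intro mult_strict_right_mono lam hh)
          then show ?thesis by (simp only: hh_Suc mult_1)
        qed
        ultimately show thesis by (intro that[of j]) simp_all
      next
        case False
        with k have "lam ^ k < h1 / \<delta>" by simp
        with k(2) show thesis
          using \<delta> lam by (intro that[of k]) (simp_all add: hh_def field_simps)
      qed
      have "hh k \<le> lam * \<delta>" using hh_Suc[of k] k(2) lam by (metis mult_left_mono less_imp_le less_trans zero_less_one)
      then have "(lam * \<delta>) powr - s \<le> hh k powr - s" using hh[of k] s by (intro powr_mono2') simp_all
      then have "\<delta> powr - s \<le> lam powr s * hh k powr - s"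
        using lam \<delta> by (simp add: powr_mult powr_minus field_simps)
      then have "ennreal (\<bar>u x\<bar> * \<delta> powr - s) \<le> ennreal (lam powr s * hh k powr - s * \<bar>u x\<bar>)"
        by (intro ennreal_leI) (metis abs_ge_zero mult.commute mult_left_mono)
      also have "\<dots> = ennreal (lam powr s * hh k powr - s) * (ennreal \<bar>u x\<bar> * indicator (layer \<Omega> (hh k)) x)"
        using x k(1) by (simp add: ennreal_mult layer_def \<delta>_def)
      also have "\<dots> = (\<Sum>i\<in>{k}. ennreal (lam powr s * hh i powr - s) * (ennreal \<bar>u x\<bar> * indicator (layer \<Omega> (hh i)) x))"
        by simp
      also have "\<dots> \<le> (\<Sum>i. ennreal (lam powr s * hh i powr - s) * (ennreal \<bar>u x\<bar> * indicator (layer \<Omega> (hh i)) x))"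
        by (intro sum_le_suminf) simp_all
      finally show ?thesis using x by (simp add: \<delta>_def add_increasing)
    qed
  qed simp
  have [measurable]: "layer \<Omega> h \<in> sets borel" for h using \<Omega>(1) by simp
  have "(\<integral>\<^sup>+x. ennreal (\<bar>u x\<bar> * infdist x (- \<Omega>) powr - s) * indicator \<Omega> x \<partial>lborel)
     \<le> (\<integral>\<^sup>+x. ennreal (h1 powr - s) * (ennreal \<bar>u x\<bar> * indicator \<Omega> x)
        + (\<Sum>k. ennreal (lam powr s * hh k powr - s) * (ennreal \<bar>u x\<bar> * indicator (layer \<Omega> (hh k)) x)) \<partial>lborel)"
    by (intro nn_integral_mono pt)
  also have "\<dots> = ennreal (h1 powr - s) * mass \<Omega> u
      + (\<Sum>k. ennreal (lam powr s * hh k powr - s) * mass (layer \<Omega> (hh k)) u)"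
    unfolding mass_def by (simp add: nn_integral_add nn_integral_cmult nn_integral_suminf)
  also have "(\<lambda>k. ennreal (lam powr s * hh k powr - s) * mass (layer \<Omega> (hh k)) u) = (\<lambda>k. ennreal (lam powr s) * A k)"
    by (simp add: A_def ennreal_mult mult.assoc)
  also have "ennreal (h1 powr - s) * mass \<Omega> u + (\<Sum>k. ennreal (lam powr s) * A k) < \<infinity>"
    using L1 sumA by (simp add: ennreal_mult_less_top)
  finally show ?thesis .
qed

section \<open>The energy on the class of competitors\<close>

locale obstacle_setting =
  fixes s :: real and \<Omega> :: "'a::euclidean_space set" and \<phi> :: "'a \<Rightarrow> real"
  assumes s: "0 < s" "s < 1" and \<Omega>: "open \<Omega>" "bounded \<Omega>" "lipschitz_boundary \<Omega>"
    and \<phi> [measurable]: "\<phi> \<in> borel_measurable borel"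

sublocale obstacle_setting \<subseteq> profile "DIM('a)" s
  by unfold_locales (use s DIM_positive[where 'a='a] in auto)

context obstacle_setting
begin

lemma \<Omega>_borel [measurable]: "\<Omega> \<in> sets borel"
  using \<Omega> by simp

lemma \<Omega>\<Omega>_borel [measurable]: "\<Omega> \<times> \<Omega> \<in> sets borel"
  by (rule borel_Times) simp_all

lemma compl_nonempty: "- \<Omega> \<noteq> {}"
  using \<Omega>(2) by (rule bounded_Compl_nonempty)

lemma emeasure_\<Omega>: "emeasure lborel \<Omega> < \<infinity>"
  using \<Omega>(2) by (rule emeasure_bounded_finite)

definition inner_seminorm :: "('a \<Rightarrow> real) \<Rightarrow> ennreal" where
  "inner_seminorm u = (\<integral>\<^sup>+z. ennreal (\<bar>u (fst z) - u (snd z)\<bar> / norm (fst z - snd z) powr (real DIM('a) + s))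
     * indicator (\<Omega> \<times> \<Omega>) z \<partial>lborel)"

lemma gagliardo_finite:
  assumes f [measurable]: "f \<in> borel_measurable borel" and zero: "\<And>x. x \<notin> \<Omega> \<Longrightarrow> f x = 0"
    and fin: "mass \<Omega> f < \<infinity>" "inner_seminorm f < \<infinity>"
  shows "gagliardo s f < \<infinity>"
proof (rule gagliardo_zero_extension[OF s(1) \<Omega>(1) compl_nonempty f zero])
  have "(\<integral>\<^sup>+x. ennreal (\<bar>f x\<bar> * infdist x (- \<Omega>) powr - s) \<partial>lborel)
    = (\<integral>\<^sup>+x. ennreal (\<bar>f x\<bar> * infdist x (- \<Omega>) powr - s) * indicator \<Omega> x \<partial>lborel)"
    by (intro nn_integral_cong) (simp add: indicator_def zero)
  also have "\<dots> < \<infinity>"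
    by (rule fractional_hardy[OF s \<Omega> f fin(1) fin(2)[unfolded inner_seminorm_def]])
  finally show "(\<integral>\<^sup>+x. ennreal (\<bar>f x\<bar> * infdist x (- \<Omega>) powr - s) \<partial>lborel) < \<infinity>" .
qed (use fin(2) in \<open>simp_all add: inner_seminorm_def\<close>)

lemma mass_sum_le:
  assumes "\<And>x. x \<in> \<Omega> \<Longrightarrow> \<bar>w x\<bar> \<le> \<bar>u x\<bar> + \<bar>v x\<bar>"
    and [measurable]: "u \<in> borel_measurable borel" "v \<in> borel_measurable borel"
  shows "mass \<Omega> w \<le> mass \<Omega> u + mass \<Omega> v"
proof -
  have "mass \<Omega> w \<le> (\<integral>\<^sup>+x. ennreal \<bar>u x\<bar> * indicator \<Omega> x + ennreal \<bar>v x\<bar> * indicator \<Omega> x \<partial>lborel)"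
    unfolding mass_def
  proof (rule nn_integral_mono)
    fix x
    show "ennreal \<bar>w x\<bar> * indicator \<Omega> x \<le> ennreal \<bar>u x\<bar> * indicator \<Omega> x + ennreal \<bar>v x\<bar> * indicator \<Omega> x"
      using assms(1)[of x] by (cases "x \<in> \<Omega>") (simp_all add: ennreal_plus[symmetric] ennreal_leI del: ennreal_plus)
  qed
  also have "\<dots> = mass \<Omega> u + mass \<Omega> v"
    unfolding mass_def by (rule nn_integral_add) measurable
  finally show ?thesis .
qed

lemma inner_seminorm_sum_le:
  assumes "\<And>x y. x \<in> \<Omega> \<Longrightarrow> y \<in> \<Omega> \<Longrightarrow> \<bar>w x - w y\<bar> \<le> \<bar>u x - u y\<bar> + \<bar>v x - v y\<bar>"
    and [measurable]: "u \<in> borel_measurable borel" "v \<in> borel_measurable borel"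
  shows "inner_seminorm w \<le> inner_seminorm u + inner_seminorm v"
proof -
  let ?f = "\<lambda>u z. ennreal (\<bar>u (fst z) - u (snd z)\<bar> / norm (fst z - snd z) powr (real DIM('a) + s)) * indicator (\<Omega> \<times> \<Omega>) z"
  have "inner_seminorm w \<le> (\<integral>\<^sup>+z. ?f u z + ?f v z \<partial>lborel)"
    unfolding inner_seminorm_def
  proof (rule nn_integral_mono)
    fix z :: "'a \<times> 'a"
    show "?f w z \<le> ?f u z + ?f v z"
    proof (cases "z \<in> \<Omega> \<times> \<Omega>")
      case True
      then have "\<bar>w (fst z) - w (snd z)\<bar> / norm (fst z - snd z) powr (real DIM('a) + s)
         \<le> (\<bar>u (fst z) - u (snd z)\<bar> + \<bar>v (fst z) - v (snd z)\<bar>) / norm (fst z - snd z) powr (real DIM('a) + s)"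
        by (intro divide_right_mono assms(1)) (simp_all add: mem_Times_iff)
      then show ?thesis
        using True by (simp add: ennreal_plus[symmetric] add_divide_distrib ennreal_leI del: ennreal_plus)
    qed simp
  qed
  also have "\<dots> = inner_seminorm u + inner_seminorm v"
    unfolding inner_seminorm_def by (rule nn_integral_add) measurable
  finally show ?thesis .
qed

text \<open>
  Competitors are Borel functions that equal the exterior datum at every point outside \<open>\<Omega>\<close>. Every
  Lebesgue measurable function of class \<open>W\<^sup>s\<^sup>,\<^sup>1\<close> in \<open>\<Omega>\<close> with this datum has such a version, and differences of
  competitors vanish outside \<open>\<Omega>\<close>.
\<close>

definition competitors :: "('a \<Rightarrow> real) set" where
  "competitors = {u \<in> borel_measurable borel. (\<forall>x. x \<notin> \<Omega> \<longrightarrow> u x = \<phi> x) \<and> mass \<Omega> u < \<infinity> \<and> inner_seminorm u < \<infinity>}"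

lemma competitors_borel: "u \<in> competitors \<Longrightarrow> u \<in> borel_measurable borel"
  and competitors_outside: "u \<in> competitors \<Longrightarrow> x \<notin> \<Omega> \<Longrightarrow> u x = \<phi> x"
  and competitors_mass: "u \<in> competitors \<Longrightarrow> mass \<Omega> u < \<infinity>"
  and competitors_inner: "u \<in> competitors \<Longrightarrow> inner_seminorm u < \<infinity>"
  by (simp_all add: competitors_def)

lemma competitors_dominated:
  assumes u: "u \<in> competitors" and v: "v \<in> competitors" and w: "w \<in> borel_measurable borel"
    and "\<And>x. x \<notin> \<Omega> \<Longrightarrow> w x = \<phi> x" and "\<And>x. x \<in> \<Omega> \<Longrightarrow> \<bar>w x\<bar> \<le> \<bar>u x\<bar> + \<bar>v x\<bar>"
    and "\<And>x y. x \<in> \<Omega> \<Longrightarrow> y \<in> \<Omega> \<Longrightarrow> \<bar>w x - w y\<bar> \<le> \<bar>u x - u y\<bar> + \<bar>v x - v y\<bar>"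
  shows "w \<in> competitors"
proof -
  have "mass \<Omega> u + mass \<Omega> v < \<infinity>" "inner_seminorm u + inner_seminorm v < \<infinity>"
    using competitors_mass[OF u] competitors_mass[OF v] competitors_inner[OF u] competitors_inner[OF v] by simp_all
  moreover have "mass \<Omega> w \<le> mass \<Omega> u + mass \<Omega> v"
    by (intro mass_sum_le assms(5) competitors_borel u v)
  moreover have "inner_seminorm w \<le> inner_seminorm u + inner_seminorm v"
    by (intro inner_seminorm_sum_le assms(6) competitors_borel u v)
  ultimately show ?thesis
    using w assms(4) unfolding competitors_def by (auto intro: le_less_trans)
qed

definition midpoint :: "('a \<Rightarrow> real) \<Rightarrow> ('a \<Rightarrow> real) \<Rightarrow> 'a \<Rightarrow> real" where
  "midpoint u v x = (u x + v x) / 2"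

lemma midpoint_competitor:
  assumes u: "u \<in> competitors" and v: "v \<in> competitors"
  shows "midpoint u v \<in> competitors"
proof (rule competitors_dominated[OF u v])
  note [measurable] = competitors_borel[OF u] competitors_borel[OF v]
  show "midpoint u v \<in> borel_measurable borel" unfolding midpoint_def[abs_def] by measurable
  show "x \<notin> \<Omega> \<Longrightarrow> midpoint u v x = \<phi> x" for x
    using competitors_outside[OF u] competitors_outside[OF v] by (simp add: midpoint_def)
  show "\<bar>midpoint u v x\<bar> \<le> \<bar>u x\<bar> + \<bar>v x\<bar>" for x by (simp add: midpoint_def)
  show "\<bar>midpoint u v x - midpoint u v y\<bar> \<le> \<bar>u x - u y\<bar> + \<bar>v x - v y\<bar>" for x y
  proof -
    have "midpoint u v x - midpoint u v y = ((u x - u y) + (v x - v y)) / 2"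
      by (simp add: midpoint_def field_simps)
    then have "\<bar>midpoint u v x - midpoint u v y\<bar> = \<bar>(u x - u y) + (v x - v y)\<bar> / 2" by (simp only: abs_divide abs_numeral)
    then show ?thesis
      using abs_triangle_ineq[of "u x - u y" "v x - v y"] abs_ge_zero[of "u x - u y"] abs_ge_zero[of "v x - v y"]
      by linarith
  qed
qed

definition clamp_inside :: "real \<Rightarrow> ('a \<Rightarrow> real) \<Rightarrow> 'a \<Rightarrow> real" where
  "clamp_inside N u x = (if x \<in> \<Omega> then max (- N) (min N (u x)) else u x)"

lemma clamp_competitor:
  assumes u: "u \<in> competitors" and N: "0 \<le> N"
  shows "clamp_inside N u \<in> competitors"
proof (rule competitors_dominated[OF u u])
  note [measurable] = competitors_borel[OF u]
  show "clamp_inside N u \<in> borel_measurable borel" unfolding clamp_inside_def[abs_def] by measurable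
  show "x \<notin> \<Omega> \<Longrightarrow> clamp_inside N u x = \<phi> x" for x
    using competitors_outside[OF u] by (simp add: clamp_inside_def)
  show "\<bar>clamp_inside N u x\<bar> \<le> \<bar>u x\<bar> + \<bar>u x\<bar>" for x
    using N by (auto simp: clamp_inside_def)
  show "x \<in> \<Omega> \<Longrightarrow> y \<in> \<Omega> \<Longrightarrow> \<bar>clamp_inside N u x - clamp_inside N u y\<bar> \<le> \<bar>u x - u y\<bar> + \<bar>u x - u y\<bar>" for x y
    using N by (simp add: clamp_inside_def max_def min_def)
qed

definition plateau :: "real \<Rightarrow> 'a \<Rightarrow> real" where
  "plateau c x = (if x \<in> \<Omega> then c else \<phi> x)"

lemma plateau_competitor: "plateau c \<in> competitors"
proof -
  have "plateau c \<in> borel_measurable borel" unfolding plateau_def[abs_def] by measurable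
  moreover have "mass \<Omega> (plateau c) = (\<integral>\<^sup>+x. ennreal \<bar>c\<bar> * indicator \<Omega> x \<partial>lborel)"
    unfolding mass_def by (intro nn_integral_cong) (simp add: indicator_def plateau_def)
  then have "mass \<Omega> (plateau c) < \<infinity>"
    using emeasure_\<Omega> by (simp add: nn_integral_cmult_indicator ennreal_mult_less_top)
  moreover have "inner_seminorm (plateau c) = (\<integral>\<^sup>+z. 0 \<partial>(lborel :: ('a \<times> 'a) measure))"
    unfolding inner_seminorm_def by (intro nn_integral_cong) (auto simp: indicator_def plateau_def)
  ultimately show ?thesis by (simp add: competitors_def plateau_def)
qed

text \<open>
  By the Hardy inequality the difference of two competitors has finite Gagliardo seminorm over the
  whole space. This is what makes energy differences integrable, although the datum far away
  is arbitrary: \<open>calG\<close> is Lipschitz, so \<open>\<phi>\<close> cancels.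
\<close>

lemma gagliardo_difference:
  assumes u: "u \<in> competitors" and v: "v \<in> competitors"
  shows "gagliardo s (\<lambda>x. u x - v x) < \<infinity>"
proof (rule gagliardo_finite)
  note [measurable] = competitors_borel[OF u] competitors_borel[OF v]
  show "(\<lambda>x. u x - v x) \<in> borel_measurable borel" by measurable
  show "x \<notin> \<Omega> \<Longrightarrow> u x - v x = 0" for x
    using competitors_outside[OF u] competitors_outside[OF v] by simp
  have "mass \<Omega> (\<lambda>x. u x - v x) \<le> mass \<Omega> u + mass \<Omega> v" by (rule mass_sum_le) simp_all
  also have "\<dots> < \<infinity>" using competitors_mass[OF u] competitors_mass[OF v] by simp
  finally show "mass \<Omega> (\<lambda>x. u x - v x) < \<infinity>" .
  have "inner_seminorm (\<lambda>x. u x - v x) \<le> inner_seminorm u + inner_seminorm v"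
    by (rule inner_seminorm_sum_le) simp_all
  also have "\<dots> < \<infinity>" using competitors_inner[OF u] competitors_inner[OF v] by simp
  finally show "inner_seminorm (\<lambda>x. u x - v x) < \<infinity>" .
qed

text \<open>The fractional perimeter of \<open>\<Omega>\<close> is finite, as \<open>s < 1\<close>.\<close>

lemma gagliardo_indicator: "gagliardo s (indicator \<Omega> :: 'a \<Rightarrow> real) < \<infinity>"
proof -
  have "gagliardo s (\<lambda>x. plateau 1 x - plateau 0 x) < \<infinity>"
    by (rule gagliardo_difference[OF plateau_competitor plateau_competitor])
  also have "(\<lambda>x. plateau 1 x - plateau 0 x) = (indicator \<Omega> :: 'a \<Rightarrow> real)"
    by (rule ext) (simp add: plateau_def indicator_def)
  finally show ?thesis .
qed

definition gradient_kernel :: "('a \<Rightarrow> real) \<Rightarrow> 'a \<times> 'a \<Rightarrow> real" where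
  "gradient_kernel f z = \<bar>f (fst z) - f (snd z)\<bar> / norm (fst z - snd z) powr (real DIM('a) + s)"

lemma gradient_kernel_borel [measurable (raw)]:
  "f \<in> borel_measurable borel \<Longrightarrow> gradient_kernel f \<in> borel_measurable borel"
proof -
  assume [measurable]: "f \<in> borel_measurable borel"
  show ?thesis unfolding gradient_kernel_def[abs_def] by measurable
qed

lemma gradient_kernel_nonneg: "0 \<le> gradient_kernel f z"
  by (simp add: gradient_kernel_def)

lemma integrable_gradient_kernel:
  assumes [measurable]: "f \<in> borel_measurable borel" and fin: "gagliardo s f < \<infinity>"
  shows "integrable lborel (gradient_kernel f)"
proof (rule integrableI_nonneg)
  show "(\<integral>\<^sup>+z. ennreal (gradient_kernel f z) \<partial>lborel) < \<infinity>"
    using fin by (simp add: gagliardo_def gradient_kernel_def)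
qed (simp_all add: gradient_kernel_nonneg gradient_kernel_borel)

definition slope :: "('a \<Rightarrow> real) \<Rightarrow> 'a \<times> 'a \<Rightarrow> real" where
  "slope u z = (u (fst z) - u (snd z)) / norm (fst z - snd z)"

definition weight :: "'a \<times> 'a \<Rightarrow> real" where
  "weight z = norm (fst z - snd z) powr (real DIM('a) - 1 + s)"

lemma weight_nonneg: "0 \<le> weight z" by (simp add: weight_def)

lemma weight_pos: "fst z \<noteq> snd z \<Longrightarrow> 0 < weight z" by (simp add: weight_def)

lemma weight_borel [measurable]: "weight \<in> borel_measurable borel"
  unfolding weight_def[abs_def] by measurable

lemma slope_borel [measurable (raw)]: "f \<in> borel_measurable borel \<Longrightarrow> slope f \<in> borel_measurable borel"
proof -
  assume [measurable]: "f \<in> borel_measurable borel"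
  show ?thesis unfolding slope_def[abs_def] by measurable
qed

lemma energy_diff_slope: "energy_diff s u v z = (calG (slope u z) - calG (slope v z)) / weight z"
  by (simp add: energy_diff_def slope_def weight_def split_beta)

lemma energy_diff_borel [measurable (raw)]:
  fixes u v :: "'a \<Rightarrow> real"
  assumes [measurable]: "u \<in> borel_measurable borel" "v \<in> borel_measurable borel"
  shows "energy_diff s u v \<in> borel_measurable borel"
proof -
  have "(\<lambda>z. (calG (slope u z) - calG (slope v z)) / weight z) \<in> borel_measurable borel" by measurable
  then show ?thesis by (simp add: energy_diff_slope[abs_def])
qed

lemma divide_norm_weight: "a / norm (fst z - snd z) / weight z = a / norm (fst z - snd z) powr (real DIM('a) + s)"
proof (cases "fst z = snd z")
  case False
  then have "norm (fst z - snd z) powr (real DIM('a) + s) = norm (fst z - snd z) * weight z"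
    unfolding weight_def by (subst powr_mult_base) (simp_all add: algebra_simps)
  then show ?thesis by simp
qed simp

lemma abs_slope_weight: "\<bar>slope f z\<bar> / weight z = gradient_kernel f z"
  using divide_norm_weight[of "\<bar>f (fst z) - f (snd z)\<bar>" z]
  by (simp add: slope_def gradient_kernel_def abs_divide)

lemma slope_diff: "slope u z - slope v z = slope (\<lambda>x. u x - v x) z"
  by (simp add: slope_def diff_divide_distrib)

lemma abs_energy_diff_le: "\<bar>energy_diff s u v z\<bar> \<le> 2 * gradient_kernel (\<lambda>x. u x - v x) z"
proof -
  have "\<bar>energy_diff s u v z\<bar> = \<bar>calG (slope u z) - calG (slope v z)\<bar> / weight z"
    by (simp add: energy_diff_slope abs_divide weight_nonneg)
  also have "\<dots> \<le> 2 * \<bar>slope u z - slope v z\<bar> / weight z"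
    by (intro divide_right_mono calG_lipschitz weight_nonneg)
  also have "\<dots> = 2 * gradient_kernel (\<lambda>x. u x - v x) z"
    by (simp add: slope_diff abs_slope_weight[symmetric])
  finally show ?thesis .
qed

lemma integrable_energy_diff:
  assumes u: "u \<in> competitors" and v: "v \<in> competitors"
  shows "integrable lborel (energy_diff s u v)"
proof (rule Bochner_Integration.integrable_bound)
  note [measurable] = competitors_borel[OF u] competitors_borel[OF v]
  show "integrable lborel (\<lambda>z. 2 * gradient_kernel (\<lambda>x. u x - v x) z)"
    by (intro integrable_mult_right integrable_gradient_kernel gagliardo_difference u v) measurable
  show "energy_diff s u v \<in> borel_measurable lborel" by simp
  show "AE z in lborel. norm (energy_diff s u v z) \<le> norm (2 * gradient_kernel (\<lambda>x. u x - v x) z)"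
    by (intro AE_I2) (simp add: abs_energy_diff_le gradient_kernel_nonneg)
qed

definition energy_gap :: "('a \<Rightarrow> real) \<Rightarrow> ('a \<Rightarrow> real) \<Rightarrow> real" where
  "energy_gap u v = (\<integral>z. energy_diff s u v z \<partial>lborel)"

lemma energy_gap_trans:
  assumes "u \<in> competitors" "v \<in> competitors" "w \<in> competitors"
  shows "energy_gap u w = energy_gap u v + energy_gap v w"
proof -
  have "energy_gap u v + energy_gap v w = (\<integral>z. energy_diff s u v z + energy_diff s v w z \<partial>lborel)"
    unfolding energy_gap_def by (rule Bochner_Integration.integral_add[symmetric]) (intro integrable_energy_diff assms)+
  also have "\<dots> = energy_gap u w"
    unfolding energy_gap_def by (intro Bochner_Integration.integral_cong refl) (simp add: energy_diff_slope add_divide_distrib[symmetric])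
  finally show ?thesis by simp
qed

lemma energy_diff_outside:
  assumes "u \<in> competitors" "v \<in> competitors" "z \<notin> Q_set \<Omega>"
  shows "energy_diff s u v z = 0"
  using assms(3) competitors_outside[OF assms(1)] competitors_outside[OF assms(2)]
  by (cases z) (simp add: energy_diff_slope slope_def Q_set_def)

lemma energy_diff_swap:
  fixes x y :: 'a
  shows "energy_diff s u v (y, x) = energy_diff s u v (x, y)"
proof -
  have "slope f (y, x) = - slope f (x, y)" for f :: "'a \<Rightarrow> real"
    by (simp add: slope_def norm_minus_commute minus_divide_left)
  then show ?thesis by (simp add: energy_diff_slope weight_def norm_minus_commute)
qed

text \<open>The exponent \<open>n - 1 + s\<close> of the weight is smaller than the dimension.\<close>

lemma weight_integral_finite: "(\<integral>\<^sup>+z. ennreal (1 / weight z) * indicator (\<Omega> \<times> \<Omega>) z \<partial>lborel) < \<infinity>"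
proof -
  obtain R0 where R0: "\<And>x. x \<in> \<Omega> \<Longrightarrow> norm x \<le> R0" using \<Omega>(2) unfolding bounded_iff by blast
  define R where "R = 2 * \<bar>R0\<bar> + 1"
  let ?q = "real DIM('a) - 1 + s"
  define J where "J = (\<integral>\<^sup>+z. ennreal (1 / norm (z::'a) powr ?q) * indicator (cball 0 R) z \<partial>lborel)"
  have J: "J < \<infinity>"
    unfolding J_def by (rule kernel_near) (use s DIM_positive[where 'a='a] in \<open>simp_all add: R_def\<close>)
  have cb: "cball (0::'a) R \<in> sets borel" by simp
  define F where "F z = ennreal (1 / norm z powr ?q) * indicator (cball 0 R) z" for z :: 'a
  have [measurable]: "F \<in> borel_measurable borel"
    unfolding F_def[abs_def] using cb by measurable
  have "(\<integral>\<^sup>+z. ennreal (1 / weight z) * indicator (\<Omega> \<times> \<Omega>) z \<partial>lborel)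
    = (\<integral>\<^sup>+x. \<integral>\<^sup>+y. ennreal (1 / weight (x, y)) * indicator (\<Omega> \<times> \<Omega>) (x, y) \<partial>lborel \<partial>lborel)"
    by (rule nn_integral_lborel_pair(1)) measurable
  also have "\<dots> \<le> (\<integral>\<^sup>+x. \<integral>\<^sup>+y. indicator \<Omega> x * F (x - y) \<partial>lborel \<partial>lborel)"
  proof (intro nn_integral_mono)
    fix x y :: 'a
    show "ennreal (1 / weight (x, y)) * indicator (\<Omega> \<times> \<Omega>) (x, y) \<le> indicator \<Omega> x * F (x - y)"
    proof (cases "x \<in> \<Omega> \<and> y \<in> \<Omega>")
      case True
      then have "norm (x - y) \<le> R"
        using norm_triangle_ineq4[of x y] R0[of x] R0[of y] by (simp add: R_def)
      then show ?thesis using True by (simp add: F_def weight_def)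
    qed (auto simp: indicator_def)
  qed
  also have "\<dots> = (\<integral>\<^sup>+x. indicator \<Omega> x * J \<partial>lborel)"
  proof (rule nn_integral_cong)
    fix x :: 'a
    have "(\<integral>\<^sup>+y. indicator \<Omega> x * F (x - y) \<partial>lborel) = indicator \<Omega> x * (\<integral>\<^sup>+y. F (x - y) \<partial>lborel)"
      by (rule nn_integral_cmult) measurable
    also have "(\<integral>\<^sup>+y. F (x - y) \<partial>lborel) = J"
      unfolding J_def F_def[symmetric] by (rule nn_integral_lborel_reflect) measurable
    finally show "(\<integral>\<^sup>+y. indicator \<Omega> x * F (x - y) \<partial>lborel) = indicator \<Omega> x * J" .
  qed
  also have "\<dots> = emeasure lborel \<Omega> * J"
    by (simp add: nn_integral_multc)
  also have "\<dots> < \<infinity>" using J emeasure_\<Omega> by (simp add: ennreal_mult_less_top)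
  finally show ?thesis .
qed

text \<open>
  Since \<open>calG\<close> grows linearly, a bounded function whose energy inside \<open>\<Omega>\<close> is finite belongs to
  \<open>W\<^sup>s\<^sup>,\<^sup>1\<close>.
\<close>

lemma competitor_of_finite_energy:
  assumes u [measurable]: "u \<in> borel_measurable borel" and out: "\<And>x. x \<notin> \<Omega> \<Longrightarrow> u x = \<phi> x"
    and bd: "\<And>x. x \<in> \<Omega> \<Longrightarrow> \<bar>u x\<bar> \<le> N"
    and fin: "(\<integral>\<^sup>+z. ennreal (calG (slope u z) / weight z) * indicator (\<Omega> \<times> \<Omega>) z \<partial>lborel) < \<infinity>"
  shows "u \<in> competitors"
proof -
  have "mass \<Omega> u \<le> (\<integral>\<^sup>+x. ennreal N * indicator \<Omega> x \<partial>lborel)"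
    unfolding mass_def by (intro nn_integral_mono) (simp add: indicator_def bd ennreal_leI)
  also have "\<dots> < \<infinity>"
    using emeasure_\<Omega> by (simp add: nn_integral_cmult_indicator ennreal_mult_less_top)
  finally have m: "mass \<Omega> u < \<infinity>" .
  have pt: "gradient_kernel u z \<le> 1 / G 1 * (calG (slope u z) / weight z) + 1 / weight z" for z
  proof -
    have "\<bar>slope u z\<bar> \<le> 1 / G 1 * calG (slope u z) + 1"
      using calG_linear_growth[of "slope u z"] G_1_pos by (simp add: field_simps)
    then have "\<bar>slope u z\<bar> / weight z \<le> (1 / G 1 * calG (slope u z) + 1) / weight z"
      by (rule divide_right_mono) (rule weight_nonneg)
    then show ?thesis by (simp add: abs_slope_weight add_divide_distrib)
  qed
  let ?A = "\<lambda>z. ennreal (1 / G 1) * (ennreal (calG (slope u z) / weight z) * indicator (\<Omega> \<times> \<Omega>) z)"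
  let ?B = "\<lambda>z. ennreal (1 / weight z) * indicator (\<Omega> \<times> \<Omega>) z"
  have "inner_seminorm u \<le> (\<integral>\<^sup>+z. ?A z + ?B z \<partial>lborel)"
    unfolding inner_seminorm_def gradient_kernel_def[symmetric]
  proof (rule nn_integral_mono)
    fix z
    show "ennreal (gradient_kernel u z) * indicator (\<Omega> \<times> \<Omega>) z \<le> ?A z + ?B z"
    proof (cases "z \<in> \<Omega> \<times> \<Omega>")
      case True
      have "ennreal (gradient_kernel u z) \<le> ennreal (1 / G 1 * (calG (slope u z) / weight z) + 1 / weight z)"
        by (rule ennreal_leI[OF pt])
      also have "\<dots> = ennreal (1 / G 1) * ennreal (calG (slope u z) / weight z) + ennreal (1 / weight z)"
        using G_1_pos by (subst ennreal_plus) (simp_all add: ennreal_mult[symmetric] calG_nonneg weight_nonneg)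
      finally show ?thesis using True by simp
    qed simp
  qed
  also have "\<dots> = ennreal (1 / G 1) * (\<integral>\<^sup>+z. ennreal (calG (slope u z) / weight z) * indicator (\<Omega> \<times> \<Omega>) z \<partial>lborel) + (\<integral>\<^sup>+z. ?B z \<partial>lborel)"
    by (subst nn_integral_add) (simp_all add: nn_integral_cmult)
  also have "\<dots> < \<infinity>"
    using fin weight_integral_finite by (simp add: ennreal_mult_less_top)
  finally show ?thesis using m u out by (simp add: competitors_def)
qed

end

section \<open>Truncation\<close>

text \<open>
  The exterior datum is only controlled by \<open>B\<close> near \<open>\<Omega>\<close>. The factor \<open>\<Theta>\<close> is so large that the
  attraction by the controlled part outweighs anything the rest can do.
\<close>

locale bounded_obstacle_setting = obstacle_setting +
  fixes B \<Theta> :: real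
  assumes B: "0 \<le> B" and \<Theta>2: "2 \<le> \<Theta>"
    and \<Theta>: "2 * kernel_tail_const TYPE('a) s * \<Theta> powr - s \<le> G_fun DIM('a) s (1/2) * unit_ball_vol DIM('a) * 2 powr - (real DIM('a) + s)"
    and diam: "0 < diameter \<Omega>"
    and \<phi>_bound: "AE y in lborel. y \<notin> \<Omega> \<and> infdist y \<Omega> < \<Theta> * diameter \<Omega> \<longrightarrow> \<bar>\<phi> y\<bar> \<le> B"
begin

abbreviation d :: real where "d \<equiv> diameter \<Omega>"

lemma outside_of_far: "x \<in> \<Omega> \<Longrightarrow> d < norm (x - y) \<Longrightarrow> y \<notin> \<Omega>"
  using diameter_bounded_bound[OF \<Omega>(2), of x y] by (auto simp: dist_norm)

lemma infdist_le_norm: "x \<in> \<Omega> \<Longrightarrow> infdist y \<Omega> \<le> norm (x - y)"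
  using infdist_le[of x \<Omega> y] by (simp add: dist_norm norm_minus_commute)

definition annulus :: "'a \<Rightarrow> 'a set" where
  "annulus x = ball x (2 * d) - cball x d"

lemma annulus_iff: "y \<in> annulus x \<longleftrightarrow> d < norm (x - y) \<and> norm (x - y) < 2 * d"
  by (auto simp: annulus_def dist_norm)

lemma annulus_borel [measurable]: "annulus x \<in> sets borel"
  unfolding annulus_def by simp

lemma annulus_volume: "unit_ball_vol DIM('a) * d ^ DIM('a) \<le> measure lborel (annulus x)"
  and annulus_finite: "emeasure lborel (annulus x) < \<infinity>"
proof -
  have fin: "emeasure lborel (ball x (2 * d)) < \<infinity>" by (rule emeasure_bounded_finite) simp
  have sub: "cball x d \<subseteq> ball x (2 * d)" using diam by (auto simp: dist_norm)
  have "measure lborel (annulus x) = measure lborel (ball x (2 * d)) - measure lborel (cball x d)"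
    unfolding annulus_def by (rule measure_Diff) (use fin sub in simp_all)
  also have "\<dots> = unit_ball_vol DIM('a) * d ^ DIM('a) * (2 ^ DIM('a) - 1)"
    using diam by (simp add: content_ball content_cball power_mult_distrib algebra_simps)
  finally have eq: "measure lborel (annulus x) = unit_ball_vol DIM('a) * d ^ DIM('a) * (2 ^ DIM('a) - 1)" .
  have "(2::real) ^ 1 \<le> 2 ^ DIM('a)" by (rule power_increasing) simp_all
  then have "unit_ball_vol DIM('a) * d ^ DIM('a) * 1 \<le> unit_ball_vol DIM('a) * d ^ DIM('a) * (2 ^ DIM('a) - 1)"
    using diam by (intro mult_left_mono) simp_all
  then show "unit_ball_vol DIM('a) * d ^ DIM('a) \<le> measure lborel (annulus x)" by (simp only: eq mult_1_right)
  show "emeasure lborel (annulus x) < \<infinity>"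
    by (rule emeasure_bounded_finite) (auto simp: annulus_def intro: bounded_subset[OF bounded_ball])
qed

text \<open>The hypothesis says that \<open>a\<close> lies between 0 and \<open>b\<close>.\<close>

lemma calG_decrease:
  assumes "\<bar>b - a\<bar> = \<bar>b\<bar> - \<bar>a\<bar>" "c \<le> \<bar>a\<bar>"
  shows "calG a - calG b \<le> - G c * \<bar>b - a\<bar>"
proof -
  have "G c * \<bar>b - a\<bar> \<le> G \<bar>a\<bar> * (\<bar>b\<bar> - \<bar>a\<bar>)"
    unfolding assms(1)[symmetric] by (intro mult_right_mono G_mono assms(2)) simp
  then show ?thesis
    using calG_tangent[of "\<bar>a\<bar>" "\<bar>b\<bar>"] by (simp add: calG_abs)
qed

text \<open>
  Bound for the change of the energy density between \<open>x\<close> and \<open>y\<close> when the value at \<open>x\<close> is cut, per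
  unit of displacement: a gain on the annulus and a possible loss far away.
\<close>

definition truncation_bound :: "'a \<Rightarrow> 'a \<Rightarrow> real" where
  "truncation_bound x y = (- G (1/2) * indicator (annulus x) y + 2 * indicator {y. \<Theta> * d \<le> norm (x - y)} y)
      / norm (x - y) powr (real DIM('a) + s)"

lemma truncation_bound_integral:
  shows "integrable lborel (truncation_bound x)" and "(\<integral>y. truncation_bound x y \<partial>lborel) \<le> 0"
proof -
  let ?q = "real DIM('a) + s" and ?C = "kernel_tail_const TYPE('a) s"
  define p where "p y = indicator (annulus x) y / norm (x - y) powr ?q" for y
  define r where "r y = indicator {y. \<Theta> * d \<le> norm (x - y)} y / norm (x - y) powr ?q" for y
  have \<Theta>d: "0 < \<Theta> * d" using \<Theta>2 diam by simp
  have C: "0 < ?C" by (rule kernel_tail_const_pos[OF s(1)])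
  have tail: "(\<integral>\<^sup>+y. ennreal (indicator {y. \<rho> \<le> norm (x - y)} y / norm (x - y) powr ?q) \<partial>lborel) \<le> ennreal (?C * \<rho> powr - s)"
    if \<rho>: "0 < \<rho>" for \<rho>
  proof -
    have "(\<integral>\<^sup>+y. ennreal (indicator {y. \<rho> \<le> norm (x - y)} y / norm (x - y) powr ?q) \<partial>lborel)
      = (\<integral>\<^sup>+y. ennreal (1 / norm (x - y) powr ?q) * indicator {z. \<rho> \<le> norm z} (x - y) \<partial>lborel)"
      by (intro nn_integral_cong) (simp add: indicator_def)
    also have "\<dots> = (\<integral>\<^sup>+z. ennreal (1 / norm (z::'a) powr ?q) * indicator {z. \<rho> \<le> norm z} z \<partial>lborel)"
      by (rule nn_integral_lborel_reflect[where f = "\<lambda>z::'a. ennreal (1 / norm z powr ?q) * indicator {z. \<rho> \<le> norm z} z"]) measurable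
    also have "\<dots> \<le> ennreal (?C * \<rho> powr - s)" by (rule kernel_tail[OF s(1) \<rho>])
    finally show ?thesis .
  qed
  have r_borel: "r \<in> borel_measurable borel" unfolding r_def[abs_def] by measurable
  have r_le: "(\<integral>\<^sup>+y. ennreal (r y) \<partial>lborel) \<le> ennreal (?C * (\<Theta> * d) powr - s)"
    unfolding r_def by (rule tail[OF \<Theta>d])
  have r_int: "integrable lborel r"
    by (rule integrableI_nonneg) (use r_borel r_le in \<open>auto simp: r_def[abs_def] intro: le_less_trans\<close>)
  have "ennreal (\<integral>y. r y \<partial>lborel) \<le> ennreal (?C * (\<Theta> * d) powr - s)"
    using r_le by (subst nn_integral_eq_integral[OF r_int, symmetric]) (simp_all add: r_def)
  then have r_val: "(\<integral>y. r y \<partial>lborel) \<le> ?C * (\<Theta> * d) powr - s"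
    using C by (subst (asm) ennreal_le_iff) simp_all
  have p_borel: "p \<in> borel_measurable borel" unfolding p_def[abs_def] by measurable
  have p_int: "integrable lborel p"
  proof (rule integrableI_nonneg)
    have "(\<integral>\<^sup>+y. ennreal (p y) \<partial>lborel) \<le> (\<integral>\<^sup>+y. ennreal (indicator {y. d \<le> norm (x - y)} y / norm (x - y) powr ?q) \<partial>lborel)"
      unfolding p_def
      by (intro nn_integral_mono ennreal_leI divide_right_mono) (simp_all add: indicator_def annulus_iff)
    also have "\<dots> < \<infinity>" using tail[OF diam] by (rule le_less_trans) simp
    finally show "(\<integral>\<^sup>+y. ennreal (p y) \<partial>lborel) < \<infinity>" .
  qed (use p_borel in \<open>simp_all add: p_def\<close>)
  have p_val: "unit_ball_vol DIM('a) * 2 powr - ?q * d powr - s \<le> (\<integral>y. p y \<partial>lborel)"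
  proof -
    have "unit_ball_vol DIM('a) * 2 powr - ?q * d powr - s = (2 * d) powr - ?q * (unit_ball_vol DIM('a) * d ^ DIM('a))"
    proof -
      have "d powr - s = d powr - ?q * d ^ DIM('a)"
        using diam by (simp add: powr_realpow[symmetric] powr_add[symmetric])
      then show ?thesis using diam by (simp add: powr_mult)
    qed
    also have "\<dots> \<le> (2 * d) powr - ?q * measure lborel (annulus x)"
      by (intro mult_left_mono annulus_volume) simp
    also have "\<dots> = (\<integral>y. (2 * d) powr - ?q * indicator (annulus x) y \<partial>lborel)" by simp
    also have "\<dots> \<le> (\<integral>y. p y \<partial>lborel)"
    proof (rule integral_mono)
      show "integrable lborel (\<lambda>y. (2 * d) powr - ?q * indicator (annulus x) y)"
        using annulus_finite by (intro integrable_mult_right integrable_real_indicator) simp_all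
      show "(2 * d) powr - ?q * indicator (annulus x) y \<le> p y" for y
      proof (cases "y \<in> annulus x")
        case True
        then have "d < norm (x - y)" "norm (x - y) \<le> 2 * d" by (simp_all add: annulus_iff)
        then have "0 < norm (x - y)" "norm (x - y) \<le> 2 * d" using diam by linarith+
        then have "(2 * d) powr - ?q \<le> norm (x - y) powr - ?q" using s by (intro powr_mono2') simp_all
        then show ?thesis using True unfolding p_def powr_minus_divide[of "norm (x - y)"] by simp
      qed (simp add: p_def)
    qed (rule p_int)
    finally show ?thesis .
  qed
  have eq: "truncation_bound x = (\<lambda>y. - G (1/2) * p y + 2 * r y)"
    by (rule ext) (simp add: truncation_bound_def p_def r_def diff_divide_distrib)
  show "integrable lborel (truncation_bound x)"
    unfolding eq by (intro Bochner_Integration.integrable_add integrable_mult_right p_int r_int)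
  have "(\<integral>y. truncation_bound x y \<partial>lborel) = - G (1/2) * (\<integral>y. p y \<partial>lborel) + 2 * (\<integral>y. r y \<partial>lborel)"
    unfolding eq using p_int r_int by simp
  also have "\<dots> \<le> - G (1/2) * (unit_ball_vol DIM('a) * 2 powr - ?q * d powr - s) + 2 * (?C * (\<Theta> * d) powr - s)"
  proof -
    have "0 \<le> G (1/2)" using G_mono[of 0 "1/2"] by simp
    then have "G (1/2) * (unit_ball_vol DIM('a) * 2 powr - ?q * d powr - s) \<le> G (1/2) * (\<integral>y. p y \<partial>lborel)"
      by (intro mult_left_mono p_val)
    with r_val show ?thesis by simp
  qed
  also have "\<dots> \<le> 0"
  proof -
    have "(2 * ?C * \<Theta> powr - s) * d powr - s \<le> (G (1/2) * unit_ball_vol DIM('a) * 2 powr - ?q) * d powr - s"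
      by (intro mult_right_mono \<Theta>) simp
    then show ?thesis using \<Theta>2 diam by (simp add: powr_mult mult_ac)
  qed
  finally show "(\<integral>y. truncation_bound x y \<partial>lborel) \<le> 0" .
qed

text \<open>
  Cutting a competitor at a height \<open>N \<ge> B + d\<close> lowers its energy. Inside \<open>\<Omega>\<close> this is clear; a point
  that is moved by \<open>\<delta>\<close> gains at least \<open>G (1/2) \<delta>\<close> per unit of kernel mass from the annulus, where
  the slope exceeds \<open>1/2\<close>, and loses at most \<open>2 \<delta>\<close> from the far exterior, as \<open>\<bar>G\<bar> \<le> 2\<close>.
\<close>

lemma truncation_decreases_energy:
  assumes u: "u \<in> competitors" and N: "B + d \<le> N"
  shows "energy_gap (clamp_inside N u) u \<le> 0"
proof -
  define v where "v = clamp_inside N u"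
  have N0: "0 \<le> N" using N B diam by linarith
  have v: "v \<in> competitors" unfolding v_def by (rule clamp_competitor[OF u N0])
  define e where "e = energy_diff s v u"
  define k where "k z = indicator \<Omega> (fst z) * indicator (- \<Omega>) (snd z) * e z" for z
  have e_int: "integrable lborel e" unfolding e_def by (rule integrable_energy_diff[OF v u])
  have [measurable]: "e \<in> borel_measurable borel" using e_int by (simp add: borel_measurable_integrable)
  have k_int: "integrable lborel k"
  proof (rule Bochner_Integration.integrable_bound[OF e_int])
    show "k \<in> borel_measurable lborel"
      unfolding k_def[abs_def] by measurable
    show "AE z in lborel. norm (k z) \<le> norm (e z)"
      by (intro AE_I2) (simp add: k_def indicator_def)
  qed
  have pt: "e z \<le> k z + k (snd z, fst z)" for z
  proof -
    obtain x y where z: "z = (x, y)" by (cases z)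
    have inside: "e (x, y) \<le> 0" if "x \<in> \<Omega>" "y \<in> \<Omega>"
    proof -
      have "\<bar>v x - v y\<bar> \<le> \<bar>u x - u y\<bar>"
        using that N0 by (simp add: v_def clamp_inside_def max_def min_def)
      then have "\<bar>slope v (x, y)\<bar> \<le> \<bar>slope u (x, y)\<bar>"
        unfolding slope_def by (simp add: abs_divide divide_right_mono)
      then have "calG (slope v (x, y)) - calG (slope u (x, y)) \<le> 0" using calG_mono by simp
      then show ?thesis unfolding e_def energy_diff_slope by (intro divide_nonpos_nonneg weight_nonneg)
    qed
    have outside: "e (x, y) = 0" if "x \<notin> \<Omega>" "y \<notin> \<Omega>"
      unfolding e_def by (rule energy_diff_outside[OF v u]) (use that in \<open>simp add: Q_set_def\<close>)
    have "e (y, x) = e (x, y)" unfolding e_def by (rule energy_diff_swap)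
    with inside outside show ?thesis unfolding z
      by (cases "x \<in> \<Omega>"; cases "y \<in> \<Omega>") (simp_all add: k_def)
  qed
  have row: "(\<integral>y. k (x, y) \<partial>lborel) \<le> 0" for x
  proof (cases "x \<in> \<Omega> \<and> integrable lborel (\<lambda>y. k (x, y))")
    case True
    define \<delta> where "\<delta> = \<bar>u x - v x\<bar>"
    have "AE y in lborel. k (x, y) \<le> \<delta> * truncation_bound x y"
      using \<phi>_bound
    proof eventually_elim
      case (elim y)
      define r where "r = norm (x - y)"
      have W: "X * \<delta> / r / weight (x, y) = \<delta> * (X / r powr (real DIM('a) + s))" for X
        using divide_norm_weight[of "X * \<delta>" "(x, y)"] by (simp add: r_def mult.commute)
      show ?case
      proof (cases "y \<in> \<Omega>")
        case yin: True
        then have rd: "r \<le> d" 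
            by (intro leI notI) (use outside_of_far[of x y] True yin in \<open>simp add: r_def\<close>)
        then have "y \<notin> annulus x" by (simp add: annulus_iff r_def)
        moreover have "\<not> \<Theta> * d \<le> norm (x - y)"
        proof -
          have "1 * d < \<Theta> * d" using \<Theta>2 diam by (intro mult_strict_right_mono) simp_all
          then show ?thesis using rd by (simp add: r_def)
        qed
        ultimately show ?thesis using yin by (simp add: k_def truncation_bound_def)
      next
        case yout: False
        then have r: "0 < r" using True by (auto simp: r_def)
        define a where "a = slope v (x, y)"
        define b where "b = slope u (x, y)"
        have a: "a = (v x - \<phi> y) / r" and b: "b = (u x - \<phi> y) / r"
          using competitors_outside[OF u yout] competitors_outside[OF v yout]
          by (simp_all add: a_def b_def slope_def r_def)
        have "b - a = (u x - v x) / r" unfolding a b diff_divide_distrib[symmetric] by simp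
        then have ab: "\<bar>b - a\<bar> = \<delta> / r" using r by (simp add: \<delta>_def abs_divide)
        have ke: "k (x, y) = (calG a - calG b) / weight (x, y)"
          using True yout by (simp add: k_def e_def energy_diff_slope a_def b_def)
        have lip: "calG a - calG b \<le> 2 * \<delta> / r" using calG_diff_le[of a b] ab by (simp add: abs_minus_commute)
        have near: "calG a - calG b \<le> - G c * \<delta> / r" if rn: "r < \<Theta> * d" and c: "c * r \<le> d" "0 \<le> c" for c
        proof (cases "u x = v x")
          case True
          then show ?thesis by (simp add: \<delta>_def a b)
        next
          case False
          have "infdist y \<Omega> < \<Theta> * d" using infdist_le_norm[of x y] True rn by (simp add: r_def)
          then have \<phi>y: "\<bar>\<phi> y\<bar> \<le> B" using elim yout by simp
          have "(u x > N \<and> v x = N) \<or> (u x < - N \<and> v x = - N)"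
            using False True N0 by (auto simp: v_def clamp_inside_def max_def min_def split: if_splits)
          then have "\<bar>u x - v x\<bar> = \<bar>u x - \<phi> y\<bar> - \<bar>v x - \<phi> y\<bar> \<and> d \<le> \<bar>v x - \<phi> y\<bar>"
            using \<phi>y N diam by (elim disjE) (simp_all add: abs_if split: if_splits)
          then have eq: "\<bar>u x - v x\<bar> = \<bar>u x - \<phi> y\<bar> - \<bar>v x - \<phi> y\<bar>" and dv: "d \<le> \<bar>v x - \<phi> y\<bar>" by blast+
          have 1: "\<bar>b - a\<bar> = \<bar>b\<bar> - \<bar>a\<bar>"
            unfolding ab unfolding a b \<delta>_def eq
            by (simp only: abs_divide abs_of_pos[OF r] diff_divide_distrib[of "\<bar>u x - \<phi> y\<bar>"])
          have "c \<le> \<bar>a\<bar>" unfolding a using r c dv by (simp add: abs_divide pos_le_divide_eq)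
          from calG_decrease[OF 1 this] show ?thesis by (simp add: ab)
        qed
        consider (ring) "y \<in> annulus x" | (far) "y \<notin> annulus x" "\<Theta> * d \<le> r" | (rest) "y \<notin> annulus x" "r < \<Theta> * d"
          by linarith
        then show ?thesis
        proof cases
          case ring
          then have r2: "r < 2 * d" by (simp add: annulus_iff r_def)
          moreover have "2 * d \<le> \<Theta> * d" using \<Theta>2 diam by (intro mult_right_mono) simp_all
          ultimately have rn: "r < \<Theta> * d" by linarith
          have "calG a - calG b \<le> - G (1/2) * \<delta> / r" by (rule near[OF rn]) (use r2 in simp_all)
          then have "k (x, y) \<le> - G (1/2) * \<delta> / r / weight (x, y)"
            unfolding ke by (rule divide_right_mono) (rule weight_nonneg)
          from this[unfolded W] show ?thesis using ring rn by (simp add: truncation_bound_def r_def)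
        next
          case far
          have "k (x, y) \<le> 2 * \<delta> / r / weight (x, y)"
            unfolding ke by (rule divide_right_mono[OF lip weight_nonneg])
          from this[unfolded W] show ?thesis using far by (simp add: truncation_bound_def r_def)
        next
          case rest
          have "calG a - calG b \<le> - G 0 * \<delta> / r" by (rule near[OF rest(2)]) (use diam in simp_all)
          then have "k (x, y) \<le> 0" unfolding ke by (intro divide_nonpos_nonneg weight_nonneg) simp
          then show ?thesis using rest by (simp add: truncation_bound_def r_def)
        qed
      qed
    qed
    then have "(\<integral>y. k (x, y) \<partial>lborel) \<le> (\<integral>y. \<delta> * truncation_bound x y \<partial>lborel)"
      by (intro integral_mono_AE) (use True truncation_bound_integral(1) in simp_all)
    also have "\<dots> = \<delta> * (\<integral>y. truncation_bound x y \<partial>lborel)" by simp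
    also have "\<dots> \<le> 0" using truncation_bound_integral(2) by (intro mult_nonneg_nonpos) (simp_all add: \<delta>_def)
    finally show ?thesis .
  next
    case False
    then show ?thesis
      by (cases "x \<in> \<Omega>") (simp_all add: not_integrable_integral_eq k_def)
  qed
  have k_int': "integrable (lborel \<Otimes>\<^sub>M lborel) k" using k_int by (simp add: lborel_prod)
  have swap: "integrable lborel (\<lambda>z. k (snd z, fst z))" "(\<integral>z. k (snd z, fst z) \<partial>lborel) = (\<integral>z. k z \<partial>lborel)"
    using lborel_pair.integrable_product_swap[OF k_int'] lborel_pair.integral_product_swap[of k] k_int'
    by (simp_all add: lborel_prod case_prod_beta' borel_measurable_integrable)
  have "(\<integral>z. k z \<partial>lborel) = (\<integral>x. \<integral>y. k (x, y) \<partial>lborel \<partial>lborel)"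
    using lborel_pair.integral_fst'[OF k_int'] by (simp add: lborel_prod)
  also have "\<dots> \<le> 0"
  proof -
    have "0 \<le> (\<integral>x. - (\<integral>y. k (x, y) \<partial>lborel) \<partial>lborel)"
      by (rule integral_nonneg_AE) (use row in simp)
    then show ?thesis by simp
  qed
  finally have k0: "(\<integral>z. k z \<partial>lborel) \<le> 0" .
  have "energy_gap v u \<le> (\<integral>z. k z + k (snd z, fst z) \<partial>lborel)"
    unfolding energy_gap_def e_def[symmetric]
    by (rule integral_mono) (use e_int k_int swap(1) pt in simp_all)
  also have "\<dots> = (\<integral>z. k z \<partial>lborel) + (\<integral>z. k z \<partial>lborel)"
    using k_int swap by simp
  finally show ?thesis using k0 by (simp add: v_def)
qed

end

section \<open>Existence and uniqueness of the minimiser\<close>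

context obstacle_setting
begin

definition midpoint_excess :: "('a \<Rightarrow> real) \<Rightarrow> ('a \<Rightarrow> real) \<Rightarrow> 'a \<times> 'a \<Rightarrow> real" where
  "midpoint_excess u v z = energy_diff s u (midpoint u v) z + energy_diff s v (midpoint u v) z"

lemma midpoint_excess_slope:
  "midpoint_excess u v z = (calG (slope u z) + calG (slope v z) - 2 * calG ((slope u z + slope v z) / 2)) / weight z"
proof -
  have m: "slope (midpoint u v) z = (slope u z + slope v z) / 2"
    by (simp add: slope_def midpoint_def diff_divide_distrib add_divide_distrib)
  show ?thesis
    unfolding midpoint_excess_def energy_diff_slope m add_divide_distrib[of "calG (slope u z) - _", symmetric] by simp
qed

lemma midpoint_excess_nonneg: "0 \<le> midpoint_excess u v z"
  unfolding midpoint_excess_slope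
  by (intro divide_nonneg_nonneg weight_nonneg) (use calG_convex[of "slope u z" "slope v z"] in simp)

lemma midpoint_excess_integral:
  assumes u: "u \<in> competitors" and v: "v \<in> competitors"
  shows "integrable lborel (midpoint_excess u v)"
    and "(\<integral>z. midpoint_excess u v z \<partial>lborel) = energy_gap u (midpoint u v) + energy_gap v (midpoint u v)"
proof -
  note m = midpoint_competitor[OF u v]
  note int = integrable_energy_diff[OF u m] integrable_energy_diff[OF v m]
  show "integrable lborel (midpoint_excess u v)"
    unfolding midpoint_excess_def[abs_def] by (intro Bochner_Integration.integrable_add int)
  show "(\<integral>z. midpoint_excess u v z \<partial>lborel) = energy_gap u (midpoint u v) + energy_gap v (midpoint u v)"
    unfolding midpoint_excess_def energy_gap_def by (intro Bochner_Integration.integral_add int)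
qed

definition above_obstacle :: "'a set \<Rightarrow> ('a \<Rightarrow> real) \<Rightarrow> ('a \<Rightarrow> real) \<Rightarrow> bool" where
  "above_obstacle A \<psi> u \<longleftrightarrow> (AE x in lborel. x \<in> A \<longrightarrow> \<psi> x \<le> u x)"

lemma above_obstacle_midpoint:
  assumes "above_obstacle A \<psi> u" "above_obstacle A \<psi> v"
  shows "above_obstacle A \<psi> (midpoint u v)"
  using assms unfolding above_obstacle_def by eventually_elim (auto simp: midpoint_def)

text \<open>
  The midpoint of two minimisers has no larger energy only if the slopes agree almost everywhere,
  by strict convexity; the common exterior datum then fixes the values.
\<close>

lemma minimiser_unique:
  assumes u: "u \<in> competitors" "above_obstacle A \<psi> u" and v: "v \<in> competitors" "above_obstacle A \<psi> v"
    and min_u: "\<And>w. w \<in> competitors \<Longrightarrow> above_obstacle A \<psi> w \<Longrightarrow> energy_gap u w \<le> 0"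
    and min_v: "\<And>w. w \<in> competitors \<Longrightarrow> above_obstacle A \<psi> w \<Longrightarrow> energy_gap v w \<le> 0"
  shows "AE x in lborel. u x = v x"
proof -
  let ?D = "midpoint_excess u v"
  note m = midpoint_competitor[OF u(1) v(1)] above_obstacle_midpoint[OF u(2) v(2)]
  have "(\<integral>z. ?D z \<partial>lborel) \<le> 0"
    using min_u[OF m] min_v[OF m] midpoint_excess_integral(2)[OF u(1) v(1)] by simp
  moreover have "0 \<le> (\<integral>z. ?D z \<partial>lborel)"
    by (rule integral_nonneg_AE) (simp add: midpoint_excess_nonneg)
  ultimately have "(\<integral>z. ?D z \<partial>lborel) = 0" by simp
  then have "AE z in lborel. ?D z = 0"
    using integral_nonneg_eq_0_iff_AE[OF midpoint_excess_integral(1)[OF u(1) v(1)]]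
    by (simp add: midpoint_excess_nonneg)
  then have "AE z in lborel. fst z \<in> \<Omega> \<and> snd z \<notin> \<Omega> \<longrightarrow> u (fst z) = v (fst z)"
  proof eventually_elim
    case (elim z)
    show ?case
    proof
      assume z: "fst z \<in> \<Omega> \<and> snd z \<notin> \<Omega>"
      then have ne: "fst z \<noteq> snd z" by auto
      have "calG (slope u z) + calG (slope v z) - 2 * calG ((slope u z + slope v z) / 2) = 0"
        using elim weight_pos[OF ne] unfolding midpoint_excess_slope by simp
      then have "slope u z = slope v z"
        using calG_strict_convex[of "slope u z" "slope v z"] by linarith
      then have "u (fst z) - u (snd z) = v (fst z) - v (snd z)"
        using ne by (simp add: slope_def)
      then show "u (fst z) = v (fst z)"
        using competitors_outside[OF u(1), of "snd z"] competitors_outside[OF v(1), of "snd z"] z by simp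
    qed
  qed
  then have "AE x in lborel. AE y in lborel. x \<in> \<Omega> \<and> y \<notin> \<Omega> \<longrightarrow> u x = v x"
    using AE_lborel_pairD[of "\<lambda>z. fst z \<in> \<Omega> \<and> snd z \<notin> \<Omega> \<longrightarrow> u (fst z) = v (fst z)"] by simp
  then show ?thesis
  proof eventually_elim
    case (elim x)
    show ?case
    proof (cases "x \<in> \<Omega>")
      case True
      show ?thesis
      proof (rule ccontr)
        assume "u x \<noteq> v x"
        with elim True have "AE y in lborel. y \<in> \<Omega> \<longleftrightarrow> y \<in> (UNIV :: 'a set)" by simp
        then have "emeasure lborel \<Omega> = emeasure lborel (UNIV :: 'a set)"
          by (rule emeasure_eq_AE) simp_all
        with emeasure_\<Omega> show False by simp
      qed
    next
      case False
      then show ?thesis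
        using competitors_outside[OF u(1) False] competitors_outside[OF v(1) False] by simp
    qed
  qed
qed

end

text \<open>A sequence whose increments are so small converges, by \<open>\<bar>t\<bar> \<le> 2\<^sup>-\<^sup>k + 2\<^sup>k t\<^sup>2\<close>.\<close>

lemma convergent_of_weighted_increments:
  fixes a :: "nat \<Rightarrow> real"
  assumes "(\<Sum>k. ennreal (2 ^ k * (a k - a (Suc k))\<^sup>2)) < \<infinity>"
  shows "convergent a"
proof -
  have S: "summable (\<lambda>k. 2 ^ k * (a k - a (Suc k))\<^sup>2)"
    using assms by (intro summable_suminf_not_top) simp_all
  have "summable (\<lambda>k. \<bar>a (Suc k) - a k\<bar>)"
  proof (rule summable_comparison_test')
    show "summable (\<lambda>k. (1/2) ^ k + 2 ^ k * (a k - a (Suc k))\<^sup>2)"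
      by (intro summable_add S summable_geometric) simp
    fix k :: nat
    define t where "t = \<bar>a k - a (Suc k)\<bar>"
    have "t \<le> (1/2) ^ k + 2 ^ k * t\<^sup>2"
    proof (cases "t \<le> (1/2) ^ k")
      case True
      then show ?thesis by (rule add_increasing2[rotated]) simp
    next
      case False
      then have "1 \<le> 2 ^ k * t" by (simp add: power_divide field_simps)
      then have "1 * t \<le> (2 ^ k * t) * t" by (rule mult_right_mono) (simp add: t_def)
      then have "t \<le> 2 ^ k * t\<^sup>2" by (simp add: power2_eq_square mult.assoc)
      then show ?thesis by (rule add_increasing[rotated]) simp
    qed
    then show "norm \<bar>a (Suc k) - a k\<bar> \<le> (1/2) ^ k + 2 ^ k * (a k - a (Suc k))\<^sup>2"
      by (simp add: t_def abs_minus_commute)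
  qed
  then have "summable (\<lambda>k. a (Suc k) - a k)"
    by (rule summable_rabs_cancel)
  then have "(\<lambda>n. \<Sum>k<n. a (Suc k) - a k) \<longlonglongrightarrow> (\<Sum>k. a (Suc k) - a k)"
    by (rule summable_LIMSEQ)
  then have "(\<lambda>n. (a n - a 0) + a 0) \<longlonglongrightarrow> (\<Sum>k. a (Suc k) - a k) + a 0"
    unfolding sum_lessThan_telescope by (intro tendsto_add tendsto_const)
  then show ?thesis by (auto intro: convergentI)
qed

context bounded_obstacle_setting
begin

text \<open>
  Uniform convexity of the energy among bounded competitors. Against exterior points in the
  annulus all slopes are bounded, by \<open>R\<close> say, so the midpoint excess there is at least
  \<open>g R / 4\<close> times the square of the difference of slopes.
\<close>

lemma uniform_convexity:
  assumes N: "0 \<le> N"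
  obtains c where "0 < c"
    and "\<And>u v. u \<in> competitors \<Longrightarrow> v \<in> competitors \<Longrightarrow> (\<And>x. x \<in> \<Omega> \<Longrightarrow> \<bar>u x\<bar> \<le> N) \<Longrightarrow> (\<And>x. x \<in> \<Omega> \<Longrightarrow> \<bar>v x\<bar> \<le> N) \<Longrightarrow>
      ennreal c * (\<integral>\<^sup>+x. ennreal ((u x - v x)\<^sup>2) * indicator \<Omega> x \<partial>lborel)
        \<le> ennreal (energy_gap u (midpoint u v) + energy_gap v (midpoint u v))"
proof -
  define R where "R = (N + B) / d"
  define \<kappa> where "\<kappa> = g R / 4 / ((2 * d)\<^sup>2 * (2 * d) powr (real DIM('a) - 1 + s))"
  define V where "V = unit_ball_vol DIM('a) * d ^ DIM('a)"
  have \<kappa>: "0 < \<kappa>" unfolding \<kappa>_def using g_pos[of R] diam by (intro divide_pos_pos mult_pos_pos) simp_all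
  have V: "0 < V" using diam by (simp add: V_def)
  show thesis
  proof (rule that[of "\<kappa> * V"])
    show "0 < \<kappa> * V" using \<kappa> V by simp
    fix u v assume u: "u \<in> competitors" and v: "v \<in> competitors"
      and uN: "\<And>x. x \<in> \<Omega> \<Longrightarrow> \<bar>u x\<bar> \<le> N" and vN: "\<And>x. x \<in> \<Omega> \<Longrightarrow> \<bar>v x\<bar> \<le> N"
    note [measurable] = competitors_borel[OF u] competitors_borel[OF v]
    let ?D = "midpoint_excess u v"
    define ring where "ring z = (if d < norm (fst z - snd z) \<and> norm (fst z - snd z) < 2 * d then 1 else 0 :: real)"
      for z :: "'a \<times> 'a"
    have [measurable]: "ring \<in> borel_measurable borel" unfolding ring_def[abs_def] by measurable
    define F where "F z = \<kappa> * (u (fst z) - v (fst z))\<^sup>2 * indicator \<Omega> (fst z) * ring z" for z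
    have [measurable]: "F \<in> borel_measurable borel" unfolding F_def[abs_def] by measurable
    have "AE z in lborel. F z \<le> ?D z"
      using AE_lborel_snd[where 'a='a, OF \<phi>_bound]
    proof eventually_elim
      case (elim z)
      define r where "r = norm (fst z - snd z)"
      show ?case
      proof (cases "fst z \<in> \<Omega> \<and> d < r \<and> r < 2 * d")
        case True
        then have out: "snd z \<notin> \<Omega>" using outside_of_far[of "fst z" "snd z"] by (simp add: r_def)
        have r: "0 < r" using True diam by linarith
        have "2 * d \<le> \<Theta> * d" using \<Theta>2 diam by (intro mult_right_mono) simp_all
        moreover have "infdist (snd z) \<Omega> \<le> r"
          unfolding r_def by (rule infdist_le_norm) (use True in simp)
        ultimately have "infdist (snd z) \<Omega> < \<Theta> * d" using True by linarith
        then have \<phi>B: "\<bar>\<phi> (snd z)\<bar> \<le> B" using elim out by simp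
        have bound: "\<bar>slope f z\<bar> \<le> R" if f: "f \<in> competitors" and fN: "\<bar>f (fst z)\<bar> \<le> N" for f
        proof -
          have "\<bar>f (fst z) - f (snd z)\<bar> \<le> N + B"
            using fN \<phi>B competitors_outside[OF f out] by linarith
          then have "\<bar>f (fst z) - f (snd z)\<bar> / r \<le> (N + B) / d"
            using True diam N B by (intro frac_le) simp_all
          then show ?thesis by (simp add: slope_def R_def r_def abs_divide)
        qed
        have "g R / 4 * (slope u z - slope v z)\<^sup>2 \<le> calG (slope u z) + calG (slope v z) - 2 * calG ((slope u z + slope v z) / 2)"
          by (intro calG_midpoint_gap bound u v uN vN) (use True in simp_all)
        then have 1: "g R / 4 * (slope u z - slope v z)\<^sup>2 / weight z \<le> ?D z"
          unfolding midpoint_excess_slope by (rule divide_right_mono) (rule weight_nonneg)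
        have "slope u z - slope v z = (u (fst z) - v (fst z)) / r"
          using competitors_outside[OF u out] competitors_outside[OF v out]
          by (simp add: slope_def r_def diff_divide_distrib)
        then have 2: "g R / 4 * (slope u z - slope v z)\<^sup>2 / weight z = g R / 4 * (u (fst z) - v (fst z))\<^sup>2 / (r\<^sup>2 * weight z)"
          by (simp add: power_divide)
        have "r\<^sup>2 * weight z \<le> (2 * d)\<^sup>2 * (2 * d) powr (real DIM('a) - 1 + s)"
          unfolding weight_def r_def[symmetric]
          by (intro mult_mono power_mono powr_mono2) (use True r s DIM_positive[where 'a='a] in simp_all)
        moreover have "0 < (2 * d)\<^sup>2 * (2 * d) powr (real DIM('a) - 1 + s) * (r\<^sup>2 * weight z)"
          using r diam unfolding weight_def r_def[symmetric] by simp
        ultimately have "g R / 4 * (u (fst z) - v (fst z))\<^sup>2 / ((2 * d)\<^sup>2 * (2 * d) powr (real DIM('a) - 1 + s))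
            \<le> g R / 4 * (u (fst z) - v (fst z))\<^sup>2 / (r\<^sup>2 * weight z)"
          by (intro divide_left_mono) (use g_pos[of R] in simp_all)
        then have "\<kappa> * (u (fst z) - v (fst z))\<^sup>2 \<le> ?D z" using 1 2 by (simp add: \<kappa>_def)
        then show ?thesis using True by (simp add: F_def ring_def r_def)
      next
        case False
        then have "F z = 0" by (auto simp: F_def ring_def r_def)
        then show ?thesis using midpoint_excess_nonneg by simp
      qed
    qed
    then have "(\<integral>\<^sup>+z. ennreal (F z) \<partial>lborel) \<le> (\<integral>\<^sup>+z. ennreal (?D z) \<partial>lborel)"
      by (intro nn_integral_mono_AE) (auto elim!: eventually_mono intro: ennreal_leI)
    also have "\<dots> = ennreal (energy_gap u (midpoint u v) + energy_gap v (midpoint u v))"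
      using nn_integral_eq_integral[OF midpoint_excess_integral(1)[OF u v]] midpoint_excess_integral(2)[OF u v]
      by (simp add: midpoint_excess_nonneg)
    finally have upper: "(\<integral>\<^sup>+z. ennreal (F z) \<partial>lborel) \<le> ennreal (energy_gap u (midpoint u v) + energy_gap v (midpoint u v))" .
    have "ennreal (\<kappa> * V) * (\<integral>\<^sup>+x. ennreal ((u x - v x)\<^sup>2) * indicator \<Omega> x \<partial>lborel)
      = (\<integral>\<^sup>+x. ennreal (\<kappa> * V) * (ennreal ((u x - v x)\<^sup>2) * indicator \<Omega> x) \<partial>lborel)"
      by (rule nn_integral_cmult[symmetric]) measurable
    also have "\<dots> \<le> (\<integral>\<^sup>+x. \<integral>\<^sup>+y. ennreal (F (x, y)) \<partial>lborel \<partial>lborel)"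
    proof (rule nn_integral_mono)
      fix x :: 'a
      let ?a = "\<kappa> * (u x - v x)\<^sup>2 * indicator \<Omega> x"
      have a: "0 \<le> ?a" using \<kappa> by simp
      have "ennreal (\<kappa> * V) * (ennreal ((u x - v x)\<^sup>2) * indicator \<Omega> x) = ennreal (?a * V)"
        using \<kappa> V by (cases "x \<in> \<Omega>") (simp_all add: ennreal_mult[symmetric] mult_ac)
      also have "\<dots> \<le> ennreal (?a * measure lborel (annulus x))"
        using a annulus_volume[of x] unfolding V_def by (intro ennreal_leI mult_left_mono)
      also have "\<dots> = ennreal ?a * emeasure lborel (annulus x)"
        using a annulus_finite[of x] by (simp add: ennreal_mult emeasure_eq_ennreal_measure less_top)
      also have "\<dots> = (\<integral>\<^sup>+y. ennreal ?a * indicator (annulus x) y \<partial>lborel)"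
        by (simp add: nn_integral_cmult_indicator)
      also have "\<dots> = (\<integral>\<^sup>+y. ennreal (F (x, y)) \<partial>lborel)"
        by (intro nn_integral_cong) (simp add: F_def ring_def indicator_def annulus_iff)
      finally show "ennreal (\<kappa> * V) * (ennreal ((u x - v x)\<^sup>2) * indicator \<Omega> x) \<le> (\<integral>\<^sup>+y. ennreal (F (x, y)) \<partial>lborel)" .
    qed
    also have "\<dots> = (\<integral>\<^sup>+z. ennreal (F z) \<partial>lborel)"
      by (rule nn_integral_lborel_pair(1)[symmetric]) measurable
    also note upper
    finally show "ennreal (\<kappa> * V) * (\<integral>\<^sup>+x. ennreal ((u x - v x)\<^sup>2) * indicator \<Omega> x \<partial>lborel)
        \<le> ennreal (energy_gap u (midpoint u v) + energy_gap v (midpoint u v))" .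
  qed
qed

definition admissible :: "real \<Rightarrow> 'a set \<Rightarrow> ('a \<Rightarrow> real) \<Rightarrow> ('a \<Rightarrow> real) set" where
  "admissible N A \<psi> = {u \<in> competitors. (\<forall>x\<in>\<Omega>. \<bar>u x\<bar> \<le> N) \<and> above_obstacle A \<psi> u}"

lemma midpoint_admissible: "u \<in> admissible N A \<psi> \<Longrightarrow> v \<in> admissible N A \<psi> \<Longrightarrow> midpoint u v \<in> admissible N A \<psi>"
proof -
  assume a: "u \<in> admissible N A \<psi>" "v \<in> admissible N A \<psi>"
  have "\<bar>midpoint u v x\<bar> \<le> N" if "x \<in> \<Omega>" for x
  proof -
    have "\<bar>u x\<bar> \<le> N" "\<bar>v x\<bar> \<le> N" using a that by (simp_all add: admissible_def)
    then have "- N \<le> u x" "u x \<le> N" "- N \<le> v x" "v x \<le> N" by linarith+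
    then show ?thesis unfolding midpoint_def abs_le_iff by (simp add: field_simps)
  qed
  with a show ?thesis
    using midpoint_competitor above_obstacle_midpoint by (simp add: admissible_def)
qed

text \<open>
  Existence by the direct method, where uniform convexity plays the role of compactness: a minimising
  sequence is Cauchy in \<open>L\<^sup>2(\<Omega>)\<close>, a fast one converges almost everywhere, and Fatou's lemma
  applies since the energy relative to a constant is bounded below by an integrable function.
\<close>

lemma minimiser_among_bounded:
  assumes N: "0 \<le> N" and A: "A \<subseteq> \<Omega>" and \<psi>: "AE x in lborel. x \<in> A \<longrightarrow> \<psi> x \<le> N"
  obtains u where "u \<in> admissible N A \<psi>" "\<And>v. v \<in> admissible N A \<psi> \<Longrightarrow> energy_gap u v \<le> 0"
proof -
  let ?K = "admissible N A \<psi>"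
  define w where "w = plateau N"
  have wc: "w \<in> competitors" unfolding w_def by (rule plateau_competitor)
  have wK: "w \<in> ?K"
  proof -
    have "above_obstacle A \<psi> w" unfolding above_obstacle_def
      using \<psi> by eventually_elim (use A in \<open>auto simp: w_def plateau_def\<close>)
    then show ?thesis using wc N by (simp add: admissible_def w_def plateau_def)
  qed
  have Kc: "u \<in> competitors" and KN: "x \<in> \<Omega> \<Longrightarrow> \<bar>u x\<bar> \<le> N" and KA: "above_obstacle A \<psi> u" if "u \<in> ?K" for u x
    using that by (simp_all add: admissible_def)
  define h where "h z = 4 * N * gradient_kernel (indicator \<Omega>) z" for z
  have h_int: "integrable lborel h"
    unfolding h_def[abs_def]
    by (intro integrable_mult_right integrable_gradient_kernel gagliardo_indicator) measurable
  have [measurable]: "h \<in> borel_measurable borel" using h_int by (simp add: borel_measurable_integrable)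
  have h0: "0 \<le> h z" for z using N by (simp add: h_def gradient_kernel_nonneg)
  define H where "H = (\<integral>z. h z \<partial>lborel)"
  have lower: "0 \<le> energy_diff s u w z + h z"
    if out: "\<And>x. x \<notin> \<Omega> \<Longrightarrow> u x = \<phi> x" and bd: "\<And>x. x \<in> \<Omega> \<Longrightarrow> \<bar>u x\<bar> \<le> N" for u z
  proof (cases "fst z \<in> \<Omega> \<and> snd z \<in> \<Omega>")
    case True
    then have "slope w z = 0" by (simp add: slope_def w_def plateau_def)
    then have "0 \<le> energy_diff s u w z"
      by (simp add: energy_diff_slope calG_nonneg weight_nonneg)
    then show ?thesis using h0[of z] by simp
  next
    case False
    have diff: "\<bar>u x - w x\<bar> \<le> 2 * N * indicator \<Omega> x" for x
      using bd[of x] out[of x] by (cases "x \<in> \<Omega>") (simp_all add: w_def plateau_def)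
    have "\<bar>(u (fst z) - w (fst z)) - (u (snd z) - w (snd z))\<bar> \<le> 2 * N * \<bar>indicator \<Omega> (fst z) - indicator \<Omega> (snd z)\<bar>"
      using False diff[of "fst z"] diff[of "snd z"] by (auto simp: indicator_def split: if_splits)
    then have "gradient_kernel (\<lambda>x. u x - w x) z \<le> 2 * N * gradient_kernel (indicator \<Omega>) z"
      unfolding gradient_kernel_def times_divide_eq_right by (rule divide_right_mono) simp
    then show ?thesis using abs_energy_diff_le[of u w z] by (simp add: h_def)
  qed
  have nn: "(\<integral>\<^sup>+z. ennreal (energy_diff s u w z + h z) \<partial>lborel) = ennreal (energy_gap u w + H)" if "u \<in> ?K" for u
  proof -
    have "(\<integral>\<^sup>+z. ennreal (energy_diff s u w z + h z) \<partial>lborel) = ennreal (\<integral>z. energy_diff s u w z + h z \<partial>lborel)"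
      by (intro nn_integral_eq_integral Bochner_Integration.integrable_add integrable_energy_diff Kc that wc h_int)
        (use lower[of u] competitors_outside[OF Kc[OF that]] KN[OF that] in simp)
    then show ?thesis
      using integrable_energy_diff[OF Kc[OF that] wc] h_int by (simp add: energy_gap_def H_def)
  qed
  have bdd: "- H \<le> energy_gap u w" if "u \<in> ?K" for u
  proof -
    have "0 \<le> (\<integral>z. energy_diff s u w z + h z \<partial>lborel)"
      by (intro integral_nonneg_AE AE_I2) (use lower[of u] competitors_outside[OF Kc[OF that]] KN[OF that] in simp)
    then show ?thesis
      using integrable_energy_diff[OF Kc[OF that] wc] h_int by (simp add: energy_gap_def H_def)
  qed
  define m where "m = (INF u\<in>?K. energy_gap u w)"
  have m_le: "m \<le> energy_gap u w" if "u \<in> ?K" for u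
    unfolding m_def by (rule cINF_lower[OF bdd_belowI2[where m = "- H"] that]) (rule bdd)
  obtain c where c: "0 < c" and uc: "\<And>u v. u \<in> competitors \<Longrightarrow> v \<in> competitors \<Longrightarrow>
      (\<And>x. x \<in> \<Omega> \<Longrightarrow> \<bar>u x\<bar> \<le> N) \<Longrightarrow> (\<And>x. x \<in> \<Omega> \<Longrightarrow> \<bar>v x\<bar> \<le> N) \<Longrightarrow>
      ennreal c * (\<integral>\<^sup>+x. ennreal ((u x - v x)\<^sup>2) * indicator \<Omega> x \<partial>lborel)
        \<le> ennreal (energy_gap u (midpoint u v) + energy_gap v (midpoint u v))"
    using uniform_convexity[OF N] by blast
  (* With this rate the squared increments of the sequence stay summable after multiplication
     by 2 ^ k. *)
  define \<epsilon> where "\<epsilon> k = c / 2 * (1/8) ^ k" for k :: nat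
  have \<epsilon>: "0 < \<epsilon> k" for k using c by (simp add: \<epsilon>_def)
  have "\<exists>u. u \<in> ?K \<and> energy_gap u w < m + \<epsilon> k" for k
  proof -
    have "(INF u\<in>?K. energy_gap u w) < m + \<epsilon> k" using \<epsilon>[of k] by (simp add: m_def)
    then show ?thesis
      using wK by (subst (asm) cINF_less_iff) (auto intro: bdd_belowI2[where m = "- H"] bdd)
  qed
  then obtain U where U: "\<And>k. U k \<in> ?K" "\<And>k. energy_gap (U k) w < m + \<epsilon> k" by metis
  have U_borel [measurable]: "U k \<in> borel_measurable borel" for k
    by (rule competitors_borel[OF Kc[OF U(1)]])
  have L2: "(\<integral>\<^sup>+x. ennreal ((U k x - U (Suc k) x)\<^sup>2) * indicator \<Omega> x \<partial>lborel) \<le> ennreal ((1/8) ^ k)" for k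
  proof -
    let ?m = "midpoint (U k) (U (Suc k))"
    let ?I = "\<integral>\<^sup>+x. ennreal ((U k x - U (Suc k) x)\<^sup>2) * indicator \<Omega> x \<partial>lborel"
    have mK: "?m \<in> ?K" by (rule midpoint_admissible[OF U(1) U(1)])
    have "energy_gap (U j) ?m \<le> \<epsilon> j" for j
      using energy_gap_trans[OF Kc[OF U(1)] Kc[OF mK] wc, of j] U(2)[of j] m_le[OF mK] by simp
    then have "energy_gap (U k) ?m + energy_gap (U (Suc k)) ?m \<le> \<epsilon> k + \<epsilon> (Suc k)" by (intro add_mono)
    also have "\<dots> \<le> c * (1/8) ^ k" using c by (simp add: \<epsilon>_def)
    finally have "ennreal c * ?I \<le> ennreal (c * (1/8) ^ k)"
      using uc[OF Kc[OF U(1)] Kc[OF U(1)] KN[OF U(1)] KN[OF U(1)], of k "Suc k"] by (meson ennreal_leI order_trans)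
    then have "ennreal (1 / c) * (ennreal c * ?I) \<le> ennreal (1 / c) * ennreal (c * (1/8) ^ k)"
      by (rule mult_left_mono) simp
    moreover have "ennreal (1 / c) * (ennreal c * ?I) = ?I"
      using c by (simp add: mult.assoc[symmetric] ennreal_mult[symmetric])
    moreover have "ennreal (1 / c) * ennreal (c * (1/8) ^ k) = ennreal ((1/8) ^ k)"
      using c by (simp add: ennreal_mult[symmetric])
    ultimately show ?thesis by simp
  qed
  have conv: "AE x in lborel. x \<in> \<Omega> \<longrightarrow> convergent (\<lambda>k. U k x)"
  proof -
    let ?f = "\<lambda>k x. ennreal (2 ^ k) * (ennreal ((U k x - U (Suc k) x)\<^sup>2) * indicator \<Omega> x)"
    have "(\<integral>\<^sup>+x. (\<Sum>k. ?f k x) \<partial>lborel) = (\<Sum>k. \<integral>\<^sup>+x. ?f k x \<partial>lborel)"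
      by (rule nn_integral_suminf) measurable
    also have "\<dots> \<le> (\<Sum>k. ennreal (1 * (1/4) ^ k))"
    proof (rule suminf_le)
      fix k
      have "(\<integral>\<^sup>+x. ?f k x \<partial>lborel) = ennreal (2 ^ k) * (\<integral>\<^sup>+x. ennreal ((U k x - U (Suc k) x)\<^sup>2) * indicator \<Omega> x \<partial>lborel)"
        by (rule nn_integral_cmult) measurable
      also have "\<dots> \<le> ennreal (2 ^ k) * ennreal ((1/8) ^ k)" by (intro mult_left_mono L2) simp
      also have "\<dots> = ennreal (1 * (1/4) ^ k)"
        by (simp add: ennreal_mult[symmetric] power_mult_distrib[symmetric])
      finally show "(\<integral>\<^sup>+x. ?f k x \<partial>lborel) \<le> ennreal (1 * (1/4) ^ k)" .
    qed simp_all
    also have "\<dots> = ennreal (1 / (1 - 1/4))" by (rule suminf_geometric_ennreal) simp_all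
    also have "\<dots> < \<infinity>" by simp
    finally have "AE x in lborel. (\<Sum>k. ?f k x) \<noteq> \<infinity>"
      by (intro nn_integral_noteq_infinite) (simp_all add: less_top)
    then show ?thesis
    proof eventually_elim
      case (elim x)
      show ?case
      proof
        assume "x \<in> \<Omega>"
        with elim have "(\<Sum>k. ennreal (2 ^ k * (U k x - U (Suc k) x)\<^sup>2)) < \<infinity>"
          by (simp add: ennreal_mult less_top)
        then show "convergent (\<lambda>k. U k x)" by (rule convergent_of_weighted_increments)
      qed
    qed
  qed
  (* The truncation only matters where the sequence diverges: it makes the bound hold everywhere. *)
  define u where "u x = (if x \<in> \<Omega> then max (- N) (min N (lim (\<lambda>k. U k x))) else \<phi> x)" for x
  have u_borel [measurable]: "u \<in> borel_measurable borel" unfolding u_def[abs_def] by measurable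
  have u_out: "x \<notin> \<Omega> \<Longrightarrow> u x = \<phi> x" for x by (simp add: u_def)
  have u_bd: "x \<in> \<Omega> \<Longrightarrow> \<bar>u x\<bar> \<le> N" for x using N by (simp add: u_def abs_le_iff)
  have lim: "AE x in lborel. (\<lambda>k. U k x) \<longlonglongrightarrow> u x"
    using conv
  proof eventually_elim
    case (elim x)
    show ?case
    proof (cases "x \<in> \<Omega>")
      case True
      then have L: "(\<lambda>k. U k x) \<longlonglongrightarrow> lim (\<lambda>k. U k x)"
        using elim by (simp add: convergent_LIMSEQ_iff)
      have "- N \<le> U k x" "U k x \<le> N" for k using KN[OF U(1) True, of k] by linarith+
      then have "- N \<le> lim (\<lambda>k. U k x)" "lim (\<lambda>k. U k x) \<le> N"
        using LIMSEQ_le_const[OF L] LIMSEQ_le_const2[OF L] by blast+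
      then have "u x = lim (\<lambda>k. U k x)" using True by (simp add: u_def)
      with L show ?thesis by simp
    next
      case False
      then have "U k x = u x" for k using competitors_outside[OF Kc[OF U(1)] False] by (simp add: u_def)
      then show ?thesis by simp
    qed
  qed
  have lim_e: "AE z in lborel. (\<lambda>k. energy_diff s (U k) w z + h z) \<longlonglongrightarrow> energy_diff s u w z + h z"
    using AE_lborel_fst[OF lim, where 'b='a] AE_lborel_snd[where 'a='a, OF lim]
  proof eventually_elim
    case (elim z)
    have "(\<lambda>k. slope (U k) z) \<longlonglongrightarrow> slope u z"
      unfolding slope_def divide_inverse by (intro tendsto_mult tendsto_diff elim tendsto_const)
    then have "(\<lambda>k. calG (slope (U k) z)) \<longlonglongrightarrow> calG (slope u z)"
      by (rule isCont_tendsto_compose[OF isCont_calG])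
    then show ?case
      unfolding energy_diff_slope divide_inverse
      by (intro tendsto_add tendsto_mult tendsto_diff tendsto_const)
  qed
  have wb [measurable]: "w \<in> borel_measurable borel" by (rule competitors_borel[OF wc])
  have "\<epsilon> \<longlonglongrightarrow> c / 2 * 0"
    unfolding \<epsilon>_def by (intro tendsto_mult tendsto_const LIMSEQ_power_zero) simp
  then have "(\<lambda>k. m + \<epsilon> k) \<longlonglongrightarrow> m" using tendsto_add[OF tendsto_const[of m], of \<epsilon> 0] by simp
  then have "(\<lambda>k. energy_gap (U k) w) \<longlonglongrightarrow> m"
  proof (rule tendsto_sandwich[rotated 3])
    show "\<forall>\<^sub>F k in sequentially. m \<le> energy_gap (U k) w"
      by (rule always_eventually) (use m_le[OF U(1)] in blast)
    show "\<forall>\<^sub>F k in sequentially. energy_gap (U k) w \<le> m + \<epsilon> k"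
      by (rule always_eventually) (use U(2) less_imp_le in blast)
  qed (rule tendsto_const)
  then have gap_lim: "(\<lambda>k. ennreal (energy_gap (U k) w + H)) \<longlonglongrightarrow> ennreal (m + H)"
    by (intro tendsto_ennrealI tendsto_add tendsto_const)
  have "(\<integral>\<^sup>+z. ennreal (energy_diff s u w z + h z) \<partial>lborel)
     = (\<integral>\<^sup>+z. liminf (\<lambda>k. ennreal (energy_diff s (U k) w z + h z)) \<partial>lborel)"
  proof (rule nn_integral_cong_AE)
    show "AE z in lborel. ennreal (energy_diff s u w z + h z) = liminf (\<lambda>k. ennreal (energy_diff s (U k) w z + h z))"
      using lim_e
    proof eventually_elim
      case (elim z)
      then have "(\<lambda>k. ennreal (energy_diff s (U k) w z + h z)) \<longlonglongrightarrow> ennreal (energy_diff s u w z + h z)"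
        by (rule tendsto_ennrealI)
      then show ?case by (intro lim_imp_Liminf[symmetric]) simp_all
    qed
  qed
  also have "\<dots> \<le> liminf (\<lambda>k. \<integral>\<^sup>+z. ennreal (energy_diff s (U k) w z + h z) \<partial>lborel)"
    by (rule nn_integral_liminf) measurable
  also have "\<dots> = ennreal (m + H)"
    unfolding nn[OF U(1)] by (rule lim_imp_Liminf) (use gap_lim in simp_all)
  finally have fatou: "(\<integral>\<^sup>+z. ennreal (energy_diff s u w z + h z) \<partial>lborel) \<le> ennreal (m + H)" .
  have uc': "u \<in> competitors"
  proof (rule competitor_of_finite_energy[OF u_borel u_out u_bd])
    have "(\<integral>\<^sup>+z. ennreal (calG (slope u z) / weight z) * indicator (\<Omega> \<times> \<Omega>) z \<partial>lborel)
       \<le> (\<integral>\<^sup>+z. ennreal (energy_diff s u w z + h z) \<partial>lborel)"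
    proof (rule nn_integral_mono)
      fix z
      show "ennreal (calG (slope u z) / weight z) * indicator (\<Omega> \<times> \<Omega>) z \<le> ennreal (energy_diff s u w z + h z)"
      proof (cases "z \<in> \<Omega> \<times> \<Omega>")
        case True
        then have "slope w z = 0" by (auto simp: slope_def w_def plateau_def)
        then have "energy_diff s u w z = calG (slope u z) / weight z" by (simp add: energy_diff_slope)
        then show ?thesis using True h0[of z] by (simp add: ennreal_leI)
      qed simp
    qed
    also note fatou
    finally show "(\<integral>\<^sup>+z. ennreal (calG (slope u z) / weight z) * indicator (\<Omega> \<times> \<Omega>) z \<partial>lborel) < \<infinity>"
      by (rule le_less_trans) simp
  qed
  have "above_obstacle A \<psi> u"
  proof -
    have "AE x in lborel. \<forall>k. x \<in> A \<longrightarrow> \<psi> x \<le> U k x"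
      using KA[OF U(1)] unfolding AE_all_countable above_obstacle_def by blast
    with lim show ?thesis unfolding above_obstacle_def
      by eventually_elim (auto intro: LIMSEQ_le_const)
  qed
  with uc' u_bd have uK: "u \<in> ?K" by (simp add: admissible_def)
  have "ennreal (energy_gap u w + H) \<le> ennreal (m + H)" using fatou nn[OF uK] by simp
  then have "energy_gap u w \<le> m"
  proof -
    have "- H \<le> m" unfolding m_def by (rule cINF_greatest) (use wK bdd in auto)
    then show ?thesis
      using \<open>ennreal (energy_gap u w + H) \<le> ennreal (m + H)\<close> by (subst (asm) ennreal_le_iff) simp_all
  qed
  then have "energy_gap u v \<le> 0" if "v \<in> ?K" for v
    using energy_gap_trans[OF uc' Kc[OF that] wc] m_le[OF that] by simp
  with uK show thesis by (rule that)
qed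

text \<open>The bound is no restriction, because truncation does not increase the energy.\<close>

lemma minimiser_exists:
  assumes N: "B + d \<le> N" and A: "A \<subseteq> \<Omega>" and \<psi>: "AE x in lborel. x \<in> A \<longrightarrow> \<bar>\<psi> x\<bar> \<le> N"
  obtains u where "u \<in> competitors" "above_obstacle A \<psi> u" "\<And>x. x \<in> \<Omega> \<Longrightarrow> \<bar>u x\<bar> \<le> N"
    "\<And>v. v \<in> competitors \<Longrightarrow> above_obstacle A \<psi> v \<Longrightarrow> energy_gap u v \<le> 0"
proof -
  have N0: "0 \<le> N" using N B diam by linarith
  have \<psi>': "AE x in lborel. x \<in> A \<longrightarrow> \<psi> x \<le> N" using \<psi> by eventually_elim auto
  obtain u where u: "u \<in> admissible N A \<psi>" and min: "\<And>v. v \<in> admissible N A \<psi> \<Longrightarrow> energy_gap u v \<le> 0"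
    using minimiser_among_bounded[OF N0 A \<psi>'] by blast
  have uc: "u \<in> competitors" using u by (simp add: admissible_def)
  show thesis
  proof (rule that[of u])
    fix v assume v: "v \<in> competitors" "above_obstacle A \<psi> v"
    define v' where "v' = clamp_inside N v"
    have v': "v' \<in> competitors" unfolding v'_def by (rule clamp_competitor[OF v(1) N0])
    have "above_obstacle A \<psi> v'"
      unfolding above_obstacle_def using v(2)[unfolded above_obstacle_def] \<psi>
      by eventually_elim (use A in \<open>auto simp: v'_def clamp_inside_def\<close>)
    moreover have "\<forall>x\<in>\<Omega>. \<bar>v' x\<bar> \<le> N" using N0 by (auto simp: v'_def clamp_inside_def max_def min_def abs_le_iff)
    ultimately have "energy_gap u v' \<le> 0" using v' by (intro min) (simp add: admissible_def)
    moreover have "energy_gap v' v \<le> 0" unfolding v'_def by (rule truncation_decreases_energy[OF v(1) N])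
    ultimately show "energy_gap u v \<le> 0" using energy_gap_trans[OF uc v' v(1)] by simp
  qed (use u in \<open>simp_all add: admissible_def\<close>)
qed

end

section \<open>Interaction of two columns\<close>

context profile
begin

definition column_kernel :: "real \<Rightarrow> real \<Rightarrow> real" where
  "column_kernel r z = r powr - (real n + 1 + s) * g (z / r)"

lemma column_kernel_nonneg: "0 \<le> column_kernel r z"
  by (simp add: column_kernel_def less_imp_le g_pos)

lemma column_kernel_minus [simp]: "column_kernel r (- z) = column_kernel r z"
  by (simp add: column_kernel_def)

lemma column_kernel_borel [measurable]: "column_kernel r \<in> borel_measurable borel"
  unfolding column_kernel_def[abs_def] by measurable

lemma column_kernel_distance:
  assumes "0 < r"
  shows "column_kernel r z = 1 / sqrt (r\<^sup>2 + z\<^sup>2) powr (real n + 1 + s)"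
proof -
  let ?e = "real n + 1 + s"
  have pos: "0 < 1 + (z / r)\<^sup>2" by (rule one_plus_sq_pos)
  have "r\<^sup>2 + z\<^sup>2 = r\<^sup>2 * (1 + (z / r)\<^sup>2)" using assms by (simp add: power_divide field_simps)
  then have "sqrt (r\<^sup>2 + z\<^sup>2) = r * sqrt (1 + (z / r)\<^sup>2)" using assms by (simp add: real_sqrt_mult)
  then have "sqrt (r\<^sup>2 + z\<^sup>2) powr ?e = r powr ?e * (sqrt (1 + (z / r)\<^sup>2)) powr ?e"
    using assms pos by (simp add: powr_mult)
  also have "(sqrt (1 + (z / r)\<^sup>2)) powr ?e = (1 + (z / r)\<^sup>2) powr (?e / 2)"
    using pos by (simp add: powr_half_sqrt[symmetric] powr_powr)
  finally have eq: "sqrt (r\<^sup>2 + z\<^sup>2) powr ?e = r powr ?e * (1 + (z / r)\<^sup>2) powr (?e / 2)" .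
  have "g (z / r) = 1 / (1 + (z / r)\<^sup>2) powr (?e / 2)"
    unfolding g_fun_def minus_divide_left[symmetric] powr_minus_divide ..
  then show ?thesis
    unfolding column_kernel_def eq powr_minus_divide by simp
qed

definition g_mass :: real where "g_mass = (\<integral>w. g w \<partial>lborel)"
definition g_moment :: real where "g_moment = (\<integral>w. \<bar>w\<bar> * g w \<partial>lborel)"

lemma g_mass_nonneg: "0 \<le> g_mass"
  unfolding g_mass_def by (intro integral_nonneg_AE AE_I2 less_imp_le g_pos)

lemma g_moment_nonneg: "0 \<le> g_moment"
  unfolding g_moment_def by (intro integral_nonneg_AE AE_I2 mult_nonneg_nonneg less_imp_le[OF g_pos]) simp

lemma column_kernel_integral:
  assumes r: "0 < r"
  shows "integrable lborel (column_kernel r)"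
    and "(\<integral>z. column_kernel r z \<partial>lborel) = r powr - (real n + s) * g_mass"
proof -
  have "integrable lborel (\<lambda>z. g (0 + (1 / r) * z))"
    using r by (intro lborel_integrable_real_affine integrable_g) simp
  then show "integrable lborel (column_kernel r)"
    unfolding column_kernel_def[abs_def] by (intro integrable_mult_right) simp
  have "(\<integral>z. column_kernel r z \<partial>lborel) = \<bar>r\<bar> *\<^sub>R (\<integral>w. column_kernel r (0 + r * w) \<partial>lborel)"
    by (rule lborel_integral_real_affine) (use r in simp)
  also have "\<dots> = r * (r powr - (real n + 1 + s) * g_mass)"
    using r by (simp add: column_kernel_def g_mass_def)
  also have "\<dots> = r powr - (real n + s) * g_mass"
  proof -
    have "r * r powr - (real n + 1 + s) = r powr - (real n + s)"
      using r by (subst powr_mult_base) simp_all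
    then show ?thesis by (simp only: mult.assoc[symmetric])
  qed
  finally show "(\<integral>z. column_kernel r z \<partial>lborel) = r powr - (real n + s) * g_mass" .
qed

text \<open>
  The interaction of two half-lines at horizontal distance \<open>r\<close> and height difference \<open>c\<close>; up to
  the first summand this is twice the energy density of a function with increment \<open>c\<close>.
\<close>

definition half_line_energy :: "real \<Rightarrow> real \<Rightarrow> real" where
  "half_line_energy r c = r powr (1 - real n - s) * (g_moment + 2 * calG (c / r))"

lemma column_kernel_moment:
  assumes r: "0 < r"
  shows "integrable lborel (\<lambda>z. \<bar>z + c\<bar> * column_kernel r z)"
    and "(\<integral>z. \<bar>z + c\<bar> * column_kernel r z \<partial>lborel) = half_line_energy r c"
proof -
  have scale: "\<bar>(0 + r * w) + c\<bar> * column_kernel r (0 + r * w) = r * r powr - (real n + 1 + s) * (\<bar>w + c / r\<bar> * g w)" for w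
  proof -
    have "\<bar>r * w + c\<bar> = r * \<bar>w + c / r\<bar>"
    proof -
      have "r * w + c = r * (w + c / r)" using r by (simp add: distrib_left)
      then show ?thesis using r by (simp add: abs_mult)
    qed
    then show ?thesis using r by (simp add: column_kernel_def)
  qed
  have "integrable lborel (\<lambda>w. \<bar>(0 + r * w) + c\<bar> * column_kernel r (0 + r * w))"
    unfolding scale by (intro integrable_mult_right half_line_interaction)
  then show "integrable lborel (\<lambda>z. \<bar>z + c\<bar> * column_kernel r z)"
    using r by (subst (asm) lborel_integrable_real_affine_iff[where f = "\<lambda>z. \<bar>z + c\<bar> * column_kernel r z"]) simp_all
  have "(\<integral>z. \<bar>z + c\<bar> * column_kernel r z \<partial>lborel) = \<bar>r\<bar> *\<^sub>R (\<integral>w. \<bar>(0 + r * w) + c\<bar> * column_kernel r (0 + r * w) \<partial>lborel)"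
    by (rule lborel_integral_real_affine) (use r in simp)
  also have "\<dots> = r * (r * r powr - (real n + 1 + s)) * (g_moment + 2 * calG (c / r))"
    unfolding scale using r by (simp add: half_line_interaction(2) g_moment_def)
  also have "r * (r * r powr - (real n + 1 + s)) = r powr (1 - real n - s)"
  proof -
    have "1 + (1 + - (real n + 1 + s)) = 1 - real n - s" by simp
    then show ?thesis using powr_mult_base[of r] r by (metis less_imp_le)
  qed
  finally show "(\<integral>z. \<bar>z + c\<bar> * column_kernel r z \<partial>lborel) = half_line_energy r c"
    by (simp add: half_line_energy_def)
qed

definition column_energy :: "real \<Rightarrow> real set \<Rightarrow> real set \<Rightarrow> (real \<times> real) set \<Rightarrow> ennreal" where
  "column_energy r A A' S = (\<integral>\<^sup>+z. ennreal (\<bar>indicator A (fst z) - indicator A' (snd z)\<bar> * column_kernel r (fst z - snd z))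
     * indicator S z \<partial>lborel)"

definition strip :: "real set \<Rightarrow> real set \<Rightarrow> (real \<times> real) set" where
  "strip I J = {z. fst z \<in> I \<or> snd z \<in> J}"

lemma strip_borel [measurable]: "I \<in> sets borel \<Longrightarrow> J \<in> sets borel \<Longrightarrow> strip I J \<in> sets borel"
proof -
  assume [measurable]: "I \<in> sets borel" "J \<in> sets borel"
  have "strip I J = I \<times> UNIV \<union> UNIV \<times> J" by (auto simp: strip_def)
  also have "\<dots> \<in> sets borel" by (intro sets.Un borel_Times) simp_all
  finally show ?thesis .
qed

lemma indicator_fst_borel [measurable (raw)]:
  "A \<in> sets borel \<Longrightarrow> (\<lambda>z::real \<times> real. indicator A (fst z) :: real) \<in> borel_measurable borel"
  by (rule measurable_compose[OF fst_borel borel_measurable_indicator])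

lemma indicator_snd_borel [measurable (raw)]:
  "A \<in> sets borel \<Longrightarrow> (\<lambda>z::real \<times> real. indicator A (snd z) :: real) \<in> borel_measurable borel"
  by (rule measurable_compose[OF snd_borel borel_measurable_indicator])

lemma column_kernel_diff_borel [measurable]: "(\<lambda>z::real \<times> real. column_kernel r (fst z - snd z)) \<in> borel_measurable borel"
  by (rule measurable_compose[OF _ column_kernel_borel]) measurable

text \<open>
  The pairs at vertical distance \<open>z\<close> that are separated by the half-lines form an interval of
  length \<open>\<bar>z + b - a\<bar>\<close>.
\<close>

lemma column_energy_half_lines:
  assumes r: "0 < r"
  shows "column_energy r {..<a} {..<b} UNIV = ennreal (half_line_energy r (a - b))"
proof -
  have overlap: "(\<integral>\<^sup>+t. ennreal \<bar>indicator {..<a} t - indicator {..<c} (t::real)\<bar> \<partial>lborel) = ennreal \<bar>c - a\<bar>" for c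
  proof -
    have "(\<integral>\<^sup>+t. ennreal \<bar>indicator {..<a} t - indicator {..<c} (t::real)\<bar> \<partial>lborel)
      = (\<integral>\<^sup>+t. indicator {min a c..<max a c} t \<partial>lborel)"
      by (intro nn_integral_cong) (auto simp: indicator_def min_def max_def)
    also have "\<dots> = ennreal \<bar>c - a\<bar>" by (simp add: min_def max_def)
    finally show ?thesis .
  qed
  let ?f = "\<lambda>t z. ennreal \<bar>indicator {..<a} t - indicator {..<b + z} (t::real)\<bar> * ennreal (column_kernel r z)"
  have shift_ind: "indicator {..<b} (t - z) = (indicator {..<b + z} t :: real)" for t z :: real
    by (simp add: indicator_def)
  have mf: "(\<lambda>(t, z). ?f t z) \<in> borel_measurable borel"
  proof -
    have [measurable]: "(\<lambda>p::real \<times> real. indicator {..<b} (fst p - snd p) :: real) \<in> borel_measurable borel"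
      by (rule measurable_compose[where N = borel, OF _ borel_measurable_indicator]) simp_all
    have "(\<lambda>p::real \<times> real. column_kernel r (snd p)) \<in> borel_measurable borel"
      by (rule measurable_compose[OF snd_borel column_kernel_borel])
    then show ?thesis unfolding case_prod_beta' shift_ind[symmetric] by measurable
  qed
  have "column_energy r {..<a} {..<b} UNIV
    = (\<integral>\<^sup>+t. \<integral>\<^sup>+\<tau>. ennreal (\<bar>indicator {..<a} t - indicator {..<b} \<tau>\<bar> * column_kernel r (t - \<tau>)) \<partial>lborel \<partial>lborel)"
    unfolding column_energy_def by (subst nn_integral_lborel_pair(1)) simp_all
  also have "\<dots> = (\<integral>\<^sup>+t. \<integral>\<^sup>+z. ?f t z \<partial>lborel \<partial>lborel)"
  proof (rule nn_integral_cong)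
    fix t :: real
    have "(\<integral>\<^sup>+\<tau>. ennreal (\<bar>indicator {..<a} t - indicator {..<b} \<tau>\<bar> * column_kernel r (t - \<tau>)) \<partial>lborel)
      = (\<integral>\<^sup>+z. ennreal (\<bar>indicator {..<a} t - indicator {..<b} (t - z)\<bar> * column_kernel r (t - (t - z))) \<partial>lborel)"
      by (rule nn_integral_lborel_reflect[symmetric]) measurable
    also have "\<dots> = (\<integral>\<^sup>+z. ?f t z \<partial>lborel)"
      by (intro nn_integral_cong) (simp add: shift_ind ennreal_mult column_kernel_nonneg)
    finally show "(\<integral>\<^sup>+\<tau>. ennreal (\<bar>indicator {..<a} t - indicator {..<b} \<tau>\<bar> * column_kernel r (t - \<tau>)) \<partial>lborel) = (\<integral>\<^sup>+z. ?f t z \<partial>lborel)" .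
  qed
  also have "\<dots> = (\<integral>\<^sup>+z. \<integral>\<^sup>+t. ?f t z \<partial>lborel \<partial>lborel)"
    by (rule nn_integral_lborel_swap[OF mf])
  also have "\<dots> = (\<integral>\<^sup>+z. ennreal (\<bar>z + (b - a)\<bar> * column_kernel r z) \<partial>lborel)"
  proof (rule nn_integral_cong)
    fix z :: real
    have "(\<integral>\<^sup>+t. ?f t z \<partial>lborel) = (\<integral>\<^sup>+t. ennreal \<bar>indicator {..<a} t - indicator {..<b + z} (t::real)\<bar> \<partial>lborel) * ennreal (column_kernel r z)"
      by (rule nn_integral_multc) measurable
    also have "\<dots> = ennreal (\<bar>z + (b - a)\<bar> * column_kernel r z)"
      unfolding overlap by (simp add: ennreal_mult column_kernel_nonneg algebra_simps)
    finally show "(\<integral>\<^sup>+t. ?f t z \<partial>lborel) = ennreal (\<bar>z + (b - a)\<bar> * column_kernel r z)" .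
  qed
  also have "\<dots> = ennreal (half_line_energy r (b - a))"
    using column_kernel_moment[OF r, of "b - a"]
    by (subst nn_integral_eq_integral) (simp_all add: column_kernel_nonneg)
  also have "half_line_energy r (b - a) = half_line_energy r (a - b)"
    using calG_minus[of "(a - b) / r"] by (simp add: half_line_energy_def minus_divide_left)
  finally show ?thesis .
qed

lemma column_energy_split:
  assumes [measurable]: "A \<in> sets borel" "A' \<in> sets borel" "S \<in> sets borel"
  shows "column_energy r A A' UNIV = column_energy r A A' S + column_energy r A A' (- S)"
proof -
  have "column_energy r A A' S + column_energy r A A' (- S) =
    (\<integral>\<^sup>+z. ennreal (\<bar>indicator A (fst z) - indicator A' (snd z)\<bar> * column_kernel r (fst z - snd z)) * indicator S z
      + ennreal (\<bar>indicator A (fst z) - indicator A' (snd z)\<bar> * column_kernel r (fst z - snd z)) * indicator (- S) z \<partial>lborel)"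
    unfolding column_energy_def by (rule nn_integral_add[symmetric]) measurable
  also have "\<dots> = column_energy r A A' UNIV"
    unfolding column_energy_def by (intro nn_integral_cong) (simp add: indicator_def)
  finally show ?thesis by simp
qed

text \<open>
  If two pairs of half-lines agree outside the windows \<open>I\<close> and \<open>J\<close>, their energies in the strip
  differ exactly as their full energies do, since the rest is the same finite number for both.
\<close>

lemma column_energy_strip_exchange:
  assumes r: "0 < r" and [measurable]: "I \<in> sets borel" "J \<in> sets borel"
    and a: "\<And>t. t \<notin> I \<Longrightarrow> t < a \<longleftrightarrow> t < a'" and b: "\<And>t. t \<notin> J \<Longrightarrow> t < b \<longleftrightarrow> t < b'"
  shows "column_energy r {..<a} {..<b} (strip I J) + ennreal (half_line_energy r (a' - b'))
    = column_energy r {..<a'} {..<b'} (strip I J) + ennreal (half_line_energy r (a - b))"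
proof -
  let ?S = "strip I J"
  let ?rest = "column_energy r {..<a} {..<b} (- ?S)"
  have eq: "column_energy r {..<a'} {..<b'} (- ?S) = ?rest"
    unfolding column_energy_def
  proof (intro nn_integral_cong)
    fix z :: "real \<times> real"
    show "ennreal (\<bar>indicator {..<a'} (fst z) - indicator {..<b'} (snd z)\<bar> * column_kernel r (fst z - snd z)) * indicator (- ?S) z
      = ennreal (\<bar>indicator {..<a} (fst z) - indicator {..<b} (snd z)\<bar> * column_kernel r (fst z - snd z)) * indicator (- ?S) z"
    proof (cases "z \<in> ?S")
      case False
      then have "indicator {..<a'} (fst z) = (indicator {..<a} (fst z) :: real)" "indicator {..<b'} (snd z) = (indicator {..<b} (snd z) :: real)"
        using a[of "fst z"] b[of "snd z"] by (simp_all add: strip_def indicator_def)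
      then show ?thesis by simp
    qed simp
  qed
  have "ennreal (half_line_energy r (a - b)) = column_energy r {..<a} {..<b} ?S + ?rest"
    unfolding column_energy_half_lines[OF r, symmetric] by (rule column_energy_split) simp_all
  moreover have "ennreal (half_line_energy r (a' - b')) = column_energy r {..<a'} {..<b'} ?S + ?rest"
    unfolding column_energy_half_lines[OF r, symmetric] eq[symmetric] by (rule column_energy_split) simp_all
  ultimately show ?thesis by (simp add: add_ac)
qed

text \<open>
  Half-lines minimise the interaction of two columns among sets that have the same measure in
  the windows and agree with the half-lines outside. The sign \<open>\<sigma>\<close> of \<open>(\<tau> - b) - (t - a)\<close> is a
  calibration: \<open>\<bar>1\<^sub>A - 1\<^sub>B\<bar> \<ge> \<sigma> (1\<^sub>A - 1\<^sub>B)\<close>, with equality for the half-lines. By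
  translation invariance the integral of \<open>\<sigma>\<close> times the kernel over one variable does not depend
  on the other one, so the right-hand sides integrate to the same value.
\<close>

lemma half_lines_minimise:
  assumes r: "0 < r" and [measurable]: "A \<in> sets borel" "A' \<in> sets borel" "I \<in> sets borel" "J \<in> sets borel"
    and fin: "emeasure lborel I < \<infinity>" "emeasure lborel J < \<infinity>"
    and A: "\<And>t. t \<notin> I \<Longrightarrow> t \<in> A \<longleftrightarrow> t < a" and A': "\<And>t. t \<notin> J \<Longrightarrow> t \<in> A' \<longleftrightarrow> t < b"
    and mA: "measure lborel (A \<inter> I) = measure lborel ({..<a} \<inter> I)"
    and mA': "measure lborel (A' \<inter> J) = measure lborel ({..<b} \<inter> J)"
  shows "column_energy r {..<a} {..<b} (strip I J) \<le> column_energy r A A' (strip I J)"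
proof -
  let ?S = "strip I J" and ?k = "\<lambda>z::real \<times> real. column_kernel r (fst z - snd z)"
  have Sb [measurable]: "?S \<in> sets borel" by simp
  define \<sigma> where "\<sigma> z = sgn ((snd z - b) - (fst z - a))" for z :: "real \<times> real"
  have [measurable]: "\<sigma> \<in> borel_measurable borel" unfolding \<sigma>_def[abs_def] by measurable
  have \<sigma>1: "\<bar>\<sigma> z\<bar> \<le> 1" for z by (simp add: \<sigma>_def abs_sgn_eq)
  define c where "c = (\<integral>z. sgn (z + (a - b)) * column_kernel r z \<partial>lborel)"
  have row_int: "integrable lborel (\<lambda>z::real \<times> real. indicator W (fst z) * ?k z)"
    if [measurable]: "W \<in> sets borel" and W: "emeasure lborel W < \<infinity>" for W
  proof (rule integrableI_nonneg)
    have "(\<integral>\<^sup>+z. ennreal (indicator W (fst z) * ?k z) \<partial>lborel)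
      = (\<integral>\<^sup>+t. \<integral>\<^sup>+\<tau>. indicator W t * ennreal (column_kernel r (t - \<tau>)) \<partial>lborel \<partial>lborel)"
      by (subst nn_integral_lborel_pair(1)) (auto simp: indicator_def intro!: nn_integral_cong)
    also have "\<dots> = (\<integral>\<^sup>+t. indicator W t * (\<integral>\<^sup>+\<tau>. ennreal (column_kernel r \<tau>) \<partial>lborel) \<partial>lborel)"
    proof (rule nn_integral_cong)
      fix t :: real
      have "(\<integral>\<^sup>+\<tau>. indicator W t * ennreal (column_kernel r (t - \<tau>)) \<partial>lborel) = indicator W t * (\<integral>\<^sup>+\<tau>. ennreal (column_kernel r (t - \<tau>)) \<partial>lborel)"
        by (rule nn_integral_cmult) measurable
      also have "(\<integral>\<^sup>+\<tau>. ennreal (column_kernel r (t - \<tau>)) \<partial>lborel) = (\<integral>\<^sup>+\<tau>. ennreal (column_kernel r \<tau>) \<partial>lborel)"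
        by (rule nn_integral_lborel_reflect) measurable
      finally show "(\<integral>\<^sup>+\<tau>. indicator W t * ennreal (column_kernel r (t - \<tau>)) \<partial>lborel) = indicator W t * (\<integral>\<^sup>+\<tau>. ennreal (column_kernel r \<tau>) \<partial>lborel)" .
    qed
    also have "\<dots> = emeasure lborel W * (\<integral>\<^sup>+\<tau>. ennreal (column_kernel r \<tau>) \<partial>lborel)"
      by (simp add: nn_integral_multc)
    also have "\<dots> < \<infinity>"
      using W column_kernel_integral(1)[OF r]
      by (simp add: ennreal_mult_less_top nn_integral_eq_integral column_kernel_nonneg)
    finally show "(\<integral>\<^sup>+z. ennreal (indicator W (fst z) * ?k z) \<partial>lborel) < \<infinity>" .
  qed (simp_all add: column_kernel_nonneg)
  have col_int: "integrable lborel (\<lambda>z::real \<times> real. indicator W (snd z) * ?k z)"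
    if W: "W \<in> sets borel" "emeasure lborel W < \<infinity>" for W
  proof -
    have "integrable (lborel \<Otimes>\<^sub>M lborel) (\<lambda>z::real \<times> real. indicator W (fst z) * ?k z)"
      using row_int[OF W] by (simp add: lborel_prod)
    from lborel_pair.integrable_product_swap[OF this] show ?thesis
      using column_kernel_minus[of r "snd z - fst z" for z] by (simp add: lborel_prod case_prod_beta')
  qed
  define f where "f t = indicator A t - indicator {..<a} t * (1::real)" for t
  define h where "h t = indicator A' t - indicator {..<b} t * (1::real)" for t
  have [measurable]: "f \<in> borel_measurable borel" "h \<in> borel_measurable borel"
    unfolding f_def[abs_def] h_def[abs_def] by measurable
  have f_bound: "\<bar>f t\<bar> \<le> indicator I t" and f_eq: "f t = indicator (A \<inter> I) t - indicator ({..<a} \<inter> I) t" for t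
    using A[of t] by (auto simp: f_def indicator_def split: if_splits)
  have h_bound: "\<bar>h t\<bar> \<le> indicator J t" and h_eq: "h t = indicator (A' \<inter> J) t - indicator ({..<b} \<inter> J) t" for t
    using A'[of t] by (auto simp: h_def indicator_def split: if_splits)
  have fin': "emeasure lborel (X \<inter> W) < \<infinity>" if "X \<in> sets borel" "W \<in> sets borel" "emeasure lborel W < \<infinity>" for X W :: "real set"
    using that emeasure_mono[of "X \<inter> W" W lborel] by (simp add: le_less_trans)
  have f0: "(\<integral>t. f t \<partial>lborel) = 0"
    unfolding f_eq using fin'[of A I] fin'[of "{..<a}" I] fin mA
    by (subst Bochner_Integration.integral_diff) simp_all
  have h0: "(\<integral>t. h t \<partial>lborel) = 0"
    unfolding h_eq using fin'[of A' J] fin'[of "{..<b}" J] fin mA'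
    by (subst Bochner_Integration.integral_diff) simp_all
  have int_f: "integrable lborel (\<lambda>z. \<sigma> z * f (fst z) * ?k z)"
  proof (rule Bochner_Integration.integrable_bound[OF row_int[OF _ fin(1)]])
    show "AE z in lborel. norm (\<sigma> z * f (fst z) * ?k z) \<le> norm (indicator I (fst z) * ?k z)"
    proof (rule AE_I2)
      fix z :: "real \<times> real"
      have "\<bar>\<sigma> z\<bar> * \<bar>f (fst z)\<bar> \<le> 1 * indicator I (fst z)" by (intro mult_mono \<sigma>1 f_bound) simp_all
      then show "norm (\<sigma> z * f (fst z) * ?k z) \<le> norm (indicator I (fst z) * ?k z)"
        by (simp add: abs_mult column_kernel_nonneg mult_right_mono)
    qed
  qed simp_all
  have int_h: "integrable lborel (\<lambda>z. \<sigma> z * h (snd z) * ?k z)"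
  proof (rule Bochner_Integration.integrable_bound[OF col_int[OF _ fin(2)]])
    show "AE z in lborel. norm (\<sigma> z * h (snd z) * ?k z) \<le> norm (indicator J (snd z) * ?k z)"
    proof (rule AE_I2)
      fix z :: "real \<times> real"
      have "\<bar>\<sigma> z\<bar> * \<bar>h (snd z)\<bar> \<le> 1 * indicator J (snd z)" by (intro mult_mono \<sigma>1 h_bound) simp_all
      then show "norm (\<sigma> z * h (snd z) * ?k z) \<le> norm (indicator J (snd z) * ?k z)"
        by (simp add: abs_mult column_kernel_nonneg mult_right_mono)
    qed
  qed simp_all
  have zero_f: "(\<integral>z. \<sigma> z * f (fst z) * ?k z \<partial>lborel) = 0"
  proof -
    have "(\<integral>z. \<sigma> z * f (fst z) * ?k z \<partial>lborel) = (\<integral>t. \<integral>\<tau>. \<sigma> (t, \<tau>) * f t * column_kernel r (t - \<tau>) \<partial>lborel \<partial>lborel)"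
      using lborel_pair.integral_fst'[of "\<lambda>z. \<sigma> z * f (fst z) * ?k z"] int_f by (simp add: lborel_prod)
    also have "\<dots> = (\<integral>t. c * f t \<partial>lborel)"
    proof (rule Bochner_Integration.integral_cong[OF refl])
      fix t :: real
      have "(\<integral>\<tau>. \<sigma> (t, \<tau>) * f t * column_kernel r (t - \<tau>) \<partial>lborel)
        = \<bar>1\<bar> *\<^sub>R (\<integral>z. \<sigma> (t, t + 1 * z) * f t * column_kernel r (t - (t + 1 * z)) \<partial>lborel)"
        by (rule lborel_integral_real_affine) simp
      also have "\<dots> = (\<integral>z. (sgn (z + (a - b)) * column_kernel r z) * f t \<partial>lborel)"
        by (simp add: \<sigma>_def algebra_simps)
      also have "\<dots> = c * f t" by (simp add: c_def)
      finally show "(\<integral>\<tau>. \<sigma> (t, \<tau>) * f t * column_kernel r (t - \<tau>) \<partial>lborel) = c * f t" .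
    qed
    also have "\<dots> = 0" using f0 by simp
    finally show ?thesis .
  qed
  have zero_h: "(\<integral>z. \<sigma> z * h (snd z) * ?k z \<partial>lborel) = 0"
  proof -
    have "(\<integral>z. \<sigma> z * h (snd z) * ?k z \<partial>lborel) = (\<integral>\<tau>. \<integral>t. \<sigma> (t, \<tau>) * h \<tau> * column_kernel r (t - \<tau>) \<partial>lborel \<partial>lborel)"
      using lborel_pair.integral_snd[of "\<lambda>t \<tau>. \<sigma> (t, \<tau>) * h \<tau> * column_kernel r (t - \<tau>)"] int_h
      by (simp add: lborel_prod case_prod_beta')
    also have "\<dots> = (\<integral>\<tau>. c * h \<tau> \<partial>lborel)"
    proof (rule Bochner_Integration.integral_cong[OF refl])
      fix \<tau> :: real
      have "(\<integral>t. \<sigma> (t, \<tau>) * h \<tau> * column_kernel r (t - \<tau>) \<partial>lborel)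
        = \<bar>-1\<bar> *\<^sub>R (\<integral>z. \<sigma> (\<tau> + (-1) * z, \<tau>) * h \<tau> * column_kernel r ((\<tau> + (-1) * z) - \<tau>) \<partial>lborel)"
        by (rule lborel_integral_real_affine) simp
      also have "\<dots> = (\<integral>z. (sgn (z + (a - b)) * column_kernel r z) * h \<tau> \<partial>lborel)"
        by (simp add: \<sigma>_def algebra_simps)
      also have "\<dots> = c * h \<tau>" by (simp add: c_def)
      finally show "(\<integral>t. \<sigma> (t, \<tau>) * h \<tau> * column_kernel r (t - \<tau>) \<partial>lborel) = c * h \<tau>" .
    qed
    also have "\<dots> = 0" using h0 by simp
    finally show ?thesis .
  qed
  define X where "X E E' z = \<bar>indicator E (fst z) - indicator E' (snd z)\<bar> * ?k z * indicator ?S z" for E E' z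
  have X_int: "integrable lborel (X E E')" if [measurable]: "E \<in> sets borel" "E' \<in> sets borel" for E E'
  proof (rule Bochner_Integration.integrable_bound)
    show "integrable lborel (\<lambda>z. indicator I (fst z) * ?k z + indicator J (snd z) * ?k z)"
      by (intro Bochner_Integration.integrable_add row_int col_int fin) simp_all
    show "X E E' \<in> borel_measurable lborel" unfolding X_def[abs_def] by measurable
    show "AE z in lborel. norm (X E E' z) \<le> norm (indicator I (fst z) * ?k z + indicator J (snd z) * ?k z)"
      by (rule AE_I2) (simp add: X_def strip_def indicator_def column_kernel_nonneg)
  qed
  have energy: "column_energy r E E' ?S = ennreal (\<integral>z. X E E' z \<partial>lborel)" if "E \<in> sets borel" "E' \<in> sets borel" for E E'
  proof -
    have "column_energy r E E' ?S = (\<integral>\<^sup>+z. ennreal (X E E' z) \<partial>lborel)"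
      unfolding column_energy_def X_def by (intro nn_integral_cong) (simp add: indicator_def)
    also have "\<dots> = ennreal (\<integral>z. X E E' z \<partial>lborel)"
      by (rule nn_integral_eq_integral[OF X_int[OF that]]) (simp add: X_def column_kernel_nonneg)
    finally show ?thesis .
  qed
  have "(\<integral>z. X {..<a} {..<b} z + (\<sigma> z * f (fst z) * ?k z - \<sigma> z * h (snd z) * ?k z) \<partial>lborel) \<le> (\<integral>z. X A A' z \<partial>lborel)"
  proof (rule integral_mono)
    show "integrable lborel (\<lambda>z. X {..<a} {..<b} z + (\<sigma> z * f (fst z) * ?k z - \<sigma> z * h (snd z) * ?k z))"
      by (intro Bochner_Integration.integrable_add Bochner_Integration.integrable_diff X_int int_f int_h) simp_all
    show "integrable lborel (X A A')" by (rule X_int) simp_all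
    fix z :: "real \<times> real"
    obtain t \<tau> where z: "z = (t, \<tau>)" by (cases z)
    show "X {..<a} {..<b} z + (\<sigma> z * f (fst z) * ?k z - \<sigma> z * h (snd z) * ?k z) \<le> X A A' z"
    proof (cases "z \<in> ?S")
      case True
      let ?x = "indicator {..<a} t - indicator {..<b} \<tau> :: real" and ?y = "indicator A t - indicator A' \<tau> :: real"
      have "\<bar>?x\<bar> = \<sigma> z * ?x"
        by (simp add: z \<sigma>_def indicator_def)
      moreover have "\<sigma> z * ?y \<le> \<bar>?y\<bar>"
      proof -
        have "\<sigma> z * ?y \<le> \<bar>\<sigma> z\<bar> * \<bar>?y\<bar>" by (metis abs_ge_self abs_mult)
        also have "\<dots> \<le> 1 * \<bar>?y\<bar>" by (intro mult_right_mono \<sigma>1) simp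
        finally show ?thesis by simp
      qed
      ultimately have "\<bar>?x\<bar> + \<sigma> z * (f t - h \<tau>) \<le> \<bar>?y\<bar>"
        by (simp add: f_def h_def algebra_simps)
      then have "(\<bar>?x\<bar> + \<sigma> z * (f t - h \<tau>)) * column_kernel r (t - \<tau>) \<le> \<bar>?y\<bar> * column_kernel r (t - \<tau>)"
        by (rule mult_right_mono) (rule column_kernel_nonneg)
      then show ?thesis using True by (simp add: X_def z algebra_simps)
    next
      case False
      then have "f t = 0" "h \<tau> = 0" using f_bound[of t] h_bound[of \<tau>] by (simp_all add: strip_def z)
      then show ?thesis using False by (simp add: X_def z)
    qed
  qed
  then have "(\<integral>z. X {..<a} {..<b} z \<partial>lborel) \<le> (\<integral>z. X A A' z \<partial>lborel)"
    using X_int[of "{..<a}" "{..<b}"] int_f int_h zero_f zero_h by simp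
  then show ?thesis using energy[of A A'] energy[of "{..<a}" "{..<b}"] by (simp add: ennreal_leI)
qed

end

section \<open>Perimeters by columns\<close>

definition fibre :: "('a \<times> real) set \<Rightarrow> 'a \<Rightarrow> real set" where
  "fibre E x = {t. (x, t) \<in> E}"

lemma fibre_borel [measurable]:
  fixes E :: "('a::euclidean_space \<times> real) set"
  assumes "E \<in> sets borel"
  shows "fibre E x \<in> sets borel"
proof -
  have "(\<lambda>t. (x, t)) -` E \<inter> space borel \<in> sets borel"
    by (rule measurable_sets[OF _ assms]) measurable
  then show ?thesis by (simp add: fibre_def vimage_def)
qed

lemma fibre_Sg: "fibre (Sg u UNIV) x = {..<u x}"
  by (auto simp: fibre_def Sg_def)

lemma Sg_borel:
  fixes u :: "'a::euclidean_space \<Rightarrow> real"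
  assumes [measurable]: "u \<in> borel_measurable borel"
  shows "Sg u UNIV \<in> sets borel"
proof -
  have "{z \<in> space borel. snd z < u (fst z)} \<in> sets borel" by measurable
  moreover have "{z \<in> space borel. snd z < u (fst z)} = Sg u UNIV" by (auto simp: Sg_def)
  ultimately show ?thesis by (simp only:)
qed

lemma Q_set_borel: "U \<in> sets borel \<Longrightarrow> Q_set (U :: 'b::second_countable_topology set) \<in> sets borel"
  unfolding Q_set_def by (intro sets.Diff borel_Times) simp_all

lemma cyl_borel: "S \<in> sets borel \<Longrightarrow> cyl (S :: 'a::second_countable_topology set) M \<in> sets borel"
  unfolding cyl_def by (intro borel_Times) simp_all

definition per_kernel :: "real \<Rightarrow> 'b::euclidean_space set \<Rightarrow> 'b \<times> 'b \<Rightarrow> ennreal" where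
  "per_kernel s E Z = ennreal (\<bar>indicator E (fst Z) - indicator E (snd Z)\<bar> / norm (fst Z - snd Z) powr (real DIM('b) + s))"

lemma per_kernel_borel [measurable]:
  assumes E: "E \<in> sets borel" shows "per_kernel s E \<in> borel_measurable borel"
proof -
  have [measurable]: "(\<lambda>Z::'a \<times> 'a. indicator E (fst Z) :: real) \<in> borel_measurable borel"
      "(\<lambda>Z::'a \<times> 'a. indicator E (snd Z) :: real) \<in> borel_measurable borel"
    using measurable_compose[OF fst_borel borel_measurable_indicator[OF E]]
      measurable_compose[OF snd_borel borel_measurable_indicator[OF E]] by simp_all
  show ?thesis unfolding per_kernel_def[abs_def] by measurable
qed

lemma Per_lborel: "Per s E U = (\<integral>\<^sup>+Z. per_kernel s E Z * indicator (Q_set U) Z \<partial>lborel)"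
  unfolding Per_def per_kernel_def nn_integral_completion
  by (intro nn_integral_cong) (simp add: case_prod_beta')

lemma Per_cong_AE:
  assumes "AE X in lborel. X \<in> E \<longleftrightarrow> X \<in> F"
  shows "Per s E U = Per s F U"
  unfolding Per_lborel
proof (rule nn_integral_cong_AE)
  show "AE Z in lborel. per_kernel s E Z * indicator (Q_set U) Z = per_kernel s F Z * indicator (Q_set U) Z"
    using AE_lborel_fst[where 'b='a, OF assms] AE_lborel_snd[where 'a='a, OF assms]
    by eventually_elim (simp add: per_kernel_def indicator_def)
qed

text \<open>
  For a smaller window the perimeter drops by a quantity that does not see the set inside this
  smaller window.
\<close>

lemma Per_enlarge_window:
  fixes E :: "'b::euclidean_space set"
  assumes [measurable]: "E \<in> sets borel" "U \<in> sets borel" "W \<in> sets borel" and sub: "U \<subseteq> W"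
  shows "Per s E W = Per s E U + (\<integral>\<^sup>+Z. per_kernel s (E - U) Z * indicator (Q_set W - Q_set U) Z \<partial>lborel)"
proof -
  have [measurable]: "Q_set U \<in> sets borel" "Q_set W \<in> sets borel" by (simp_all add: Q_set_borel)
  have sub': "Q_set U \<subseteq> Q_set W" using sub by (auto simp: Q_set_def)
  have "Per s E W = (\<integral>\<^sup>+Z. per_kernel s E Z * indicator (Q_set U) Z + per_kernel s (E - U) Z * indicator (Q_set W - Q_set U) Z \<partial>lborel)"
    unfolding Per_lborel
  proof (rule nn_integral_cong)
    fix Z :: "'b \<times> 'b"
    have "per_kernel s (E - U) Z = per_kernel s E Z" if "Z \<notin> Q_set U"
      using that by (cases Z) (auto simp: Q_set_def per_kernel_def indicator_def)
    then show "per_kernel s E Z * indicator (Q_set W) Z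
      = per_kernel s E Z * indicator (Q_set U) Z + per_kernel s (E - U) Z * indicator (Q_set W - Q_set U) Z"
      using sub' by (auto simp: indicator_def)
  qed
  also have "\<dots> = Per s E U + (\<integral>\<^sup>+Z. per_kernel s (E - U) Z * indicator (Q_set W - Q_set U) Z \<partial>lborel)"
    unfolding Per_lborel by (rule nn_integral_add) measurable
  finally show ?thesis .
qed

context obstacle_setting
begin

definition window :: "real \<Rightarrow> 'a \<Rightarrow> real set" where
  "window M x = (if x \<in> \<Omega> then {-M<..<M} else {})"

lemma window_borel [measurable]: "window M x \<in> sets borel"
  by (simp add: window_def)

definition columns :: "real \<Rightarrow> ('a \<times> real) set \<Rightarrow> 'a \<Rightarrow> 'a \<Rightarrow> ennreal" where
  "columns M E x y = column_energy (norm (x - y)) (fibre E x) (fibre E y) (strip (window M x) (window M y))"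

lemma Per_columns:
  assumes E [measurable]: "E \<in> sets borel"
  shows "Per s E (cyl \<Omega> M) = (\<integral>\<^sup>+x. \<integral>\<^sup>+y. columns M E x y \<partial>lborel \<partial>lborel)"
proof -
  define U where "U = cyl \<Omega> M"
  have [measurable]: "Q_set U \<in> sets borel" unfolding U_def by (intro Q_set_borel cyl_borel) simp
  define f where "f Z = per_kernel s E Z * indicator (Q_set U) Z" for Z
  have mf: "f \<in> borel_measurable borel" unfolding f_def[abs_def] by measurable
  have sec: "(\<lambda>Y. f (X, Y)) \<in> borel_measurable borel" for X
    by (rule measurable_compose[OF _ mf]) measurable
  have mG: "(\<lambda>X. \<integral>\<^sup>+Y. f (X, Y) \<partial>lborel) \<in> borel_measurable borel"
    by (rule borel_measurable_nn_integral_lborel) (use mf in simp)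
  have mt: "(\<lambda>(t, y). \<integral>\<^sup>+\<tau>. f ((x, t), (y, \<tau>)) \<partial>lborel) \<in> borel_measurable borel" for x
  proof -
    have "(\<lambda>z. f ((x, fst (fst z)), (snd (fst z), snd z))) \<in> borel_measurable borel"
      by (rule measurable_compose[OF _ mf]) measurable
    then have "(\<lambda>p. \<integral>\<^sup>+\<tau>. f ((x, fst p), (snd p, \<tau>)) \<partial>lborel) \<in> borel_measurable borel"
      by (rule borel_measurable_nn_integral_lborel)
    then show ?thesis by (simp add: case_prod_beta')
  qed
  have "Per s E U = (\<integral>\<^sup>+X. \<integral>\<^sup>+Y. f (X, Y) \<partial>lborel \<partial>lborel)"
    unfolding Per_lborel f_def[symmetric] by (rule nn_integral_lborel_pair(1)[OF mf])
  also have "\<dots> = (\<integral>\<^sup>+x. \<integral>\<^sup>+t. \<integral>\<^sup>+Y. f ((x, t), Y) \<partial>lborel \<partial>lborel \<partial>lborel)"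
    by (rule nn_integral_lborel_pair(1)[OF mG])
  also have "\<dots> = (\<integral>\<^sup>+x. \<integral>\<^sup>+t. \<integral>\<^sup>+y. \<integral>\<^sup>+\<tau>. f ((x, t), (y, \<tau>)) \<partial>lborel \<partial>lborel \<partial>lborel \<partial>lborel)"
    by (simp only: nn_integral_lborel_pair(1)[OF sec])
  also have "\<dots> = (\<integral>\<^sup>+x. \<integral>\<^sup>+y. \<integral>\<^sup>+t. \<integral>\<^sup>+\<tau>. f ((x, t), (y, \<tau>)) \<partial>lborel \<partial>lborel \<partial>lborel \<partial>lborel)"
    by (simp only: nn_integral_lborel_swap[OF mt])
  also have "\<dots> = (\<integral>\<^sup>+x. \<integral>\<^sup>+y. columns M E x y \<partial>lborel \<partial>lborel)"
  proof (rule nn_integral_cong)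
    fix x :: 'a
    show "(\<integral>\<^sup>+y. \<integral>\<^sup>+t. \<integral>\<^sup>+\<tau>. f ((x, t), (y, \<tau>)) \<partial>lborel \<partial>lborel \<partial>lborel) = (\<integral>\<^sup>+y. columns M E x y \<partial>lborel)"
    proof (rule nn_integral_cong_AE)
      have "AE y in lborel. y \<noteq> x" by (rule AE_lborel_singleton)
      then show "AE y in lborel. (\<integral>\<^sup>+t. \<integral>\<^sup>+\<tau>. f ((x, t), (y, \<tau>)) \<partial>lborel \<partial>lborel) = columns M E x y"
      proof eventually_elim
        case (elim y)
        then have r: "0 < norm (x - y)" by simp
        have m: "(\<lambda>z. f ((x, fst z), (y, snd z))) \<in> borel_measurable borel"
          by (rule measurable_compose[OF _ mf]) measurable
        have "(\<integral>\<^sup>+t. \<integral>\<^sup>+\<tau>. f ((x, t), (y, \<tau>)) \<partial>lborel \<partial>lborel) = (\<integral>\<^sup>+z. f ((x, fst z), (y, snd z)) \<partial>lborel)"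
          by (subst nn_integral_lborel_pair(1)[OF m]) simp
        also have "\<dots> = columns M E x y"
          unfolding columns_def column_energy_def
        proof (rule nn_integral_cong)
          fix z :: "real \<times> real"
          obtain t \<tau> where z: "z = (t, \<tau>)" by (cases z)
          have dim: "real DIM('a \<times> real) + s = real DIM('a) + 1 + s" by simp
          have "norm ((x, t) - (y, \<tau>)) = sqrt ((norm (x - y))\<^sup>2 + (t - \<tau>)\<^sup>2)"
            by (simp add: norm_Pair)
          then have "1 / norm ((x, t) - (y, \<tau>)) powr (real DIM('a \<times> real) + s) = column_kernel (norm (x - y)) (t - \<tau>)"
            unfolding dim column_kernel_distance[OF r] by simp
          then have "a / norm ((x, t) - (y, \<tau>)) powr (real DIM('a \<times> real) + s) = a * column_kernel (norm (x - y)) (t - \<tau>)" for a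
            by (metis mult.right_neutral times_divide_eq_right)
          moreover have "((x, t), (y, \<tau>)) \<in> Q_set U \<longleftrightarrow> (t, \<tau>) \<in> strip (window M x) (window M y)"
            by (auto simp: U_def Q_set_def cyl_def strip_def window_def)
          moreover have "indicator E (x, t) = (indicator (fibre E x) t :: real)"
            "indicator E (y, \<tau>) = (indicator (fibre E y) \<tau> :: real)"
            by (simp_all add: fibre_def indicator_def)
          ultimately show "f ((x, fst z), (y, snd z)) = ennreal (\<bar>indicator (fibre E x) (fst z) - indicator (fibre E y) (snd z)\<bar>
              * column_kernel (norm (x - y)) (fst z - snd z)) * indicator (strip (window M x) (window M y)) z"
            by (simp only: f_def per_kernel_def z fst_conv snd_conv indicator_def)
        qed
        finally show ?case .
      qed
    qed
  qed
  finally show ?thesis by (simp add: U_def)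
qed

lemma columns_borel:
  assumes E: "E \<in> sets borel"
  shows "(\<lambda>z. columns M E (fst z) (snd z)) \<in> borel_measurable borel"
  unfolding columns_def column_energy_def
proof (rule borel_measurable_nn_integral_lborel)
  let ?X = "\<lambda>p::('a \<times> 'a) \<times> real \<times> real. (fst (fst p), fst (snd p))"
  let ?Y = "\<lambda>p::('a \<times> 'a) \<times> real \<times> real. (snd (fst p), snd (snd p))"
  have XY: "?X \<in> borel_measurable borel" "?Y \<in> borel_measurable borel" "(\<lambda>p. (?X p, ?Y p)) \<in> borel_measurable borel"
    by measurable
  have Q: "Q_set (cyl \<Omega> M) \<in> sets borel" by (intro Q_set_borel cyl_borel) simp
  have [measurable]: "(\<lambda>p. indicator E (?X p) :: real) \<in> borel_measurable borel"
    "(\<lambda>p. indicator E (?Y p) :: real) \<in> borel_measurable borel"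
    "(\<lambda>p. indicator (Q_set (cyl \<Omega> M)) (?X p, ?Y p) :: ennreal) \<in> borel_measurable borel"
    using measurable_compose[OF XY(1) borel_measurable_indicator[OF E]]
      measurable_compose[OF XY(2) borel_measurable_indicator[OF E]]
      measurable_compose[OF XY(3) borel_measurable_indicator[OF Q]] by simp_all
  have [measurable]: "(\<lambda>p::('a \<times> 'a) \<times> real \<times> real. column_kernel (norm (fst (fst p) - snd (fst p))) (fst (snd p) - snd (snd p))) \<in> borel_measurable borel"
    unfolding column_kernel_def by measurable
  have "(\<lambda>p. ennreal (\<bar>indicator E (?X p) - indicator E (?Y p)\<bar> * column_kernel (norm (fst (fst p) - snd (fst p))) (fst (snd p) - snd (snd p)))
      * indicator (Q_set (cyl \<Omega> M)) (?X p, ?Y p)) \<in> borel_measurable borel"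
    by measurable
  also have "(\<lambda>p. ennreal (\<bar>indicator E (?X p) - indicator E (?Y p)\<bar> * column_kernel (norm (fst (fst p) - snd (fst p))) (fst (snd p) - snd (snd p)))
      * indicator (Q_set (cyl \<Omega> M)) (?X p, ?Y p))
    = (\<lambda>z. ennreal (\<bar>indicator (fibre E (fst (fst z))) (fst (snd z)) - indicator (fibre E (snd (fst z))) (snd (snd z))\<bar> *
              column_kernel (norm (fst (fst z) - snd (fst z))) (fst (snd z) - snd (snd z))) *
            indicator (strip (window M (fst (fst z))) (window M (snd (fst z)))) (snd z))"
    by (rule ext) (auto simp: indicator_def fibre_def Q_set_def cyl_def strip_def window_def)
  finally show "(\<lambda>z. ennreal (\<bar>indicator (fibre E (fst (fst z))) (fst (snd z)) - indicator (fibre E (snd (fst z))) (snd (snd z))\<bar> *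
              column_kernel (norm (fst (fst z) - snd (fst z))) (fst (snd z) - snd (snd z))) *
            indicator (strip (window M (fst (fst z))) (window M (snd (fst z)))) (snd z)) \<in> borel_measurable borel" .
qed

lemma half_line_energy_slope:
  "half_line_energy (norm (x - y)) (u x - u y) = (g_moment + 2 * calG (slope u (x, y))) / weight (x, y)"
proof -
  have "norm (x - y) powr (1 - real DIM('a) - s) = 1 / weight (x, y)"
    unfolding weight_def fst_conv snd_conv powr_minus_divide[symmetric] by simp
  then show ?thesis by (simp add: half_line_energy_def slope_def)
qed

lemma graph_columns_exchange:
  assumes out: "\<And>x. x \<notin> \<Omega> \<Longrightarrow> u x = v x"
    and u: "\<And>x. x \<in> \<Omega> \<Longrightarrow> \<bar>u x\<bar> < M" and v: "\<And>x. x \<in> \<Omega> \<Longrightarrow> \<bar>v x\<bar> < M" and xy: "x \<noteq> y"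
  shows "columns M (Sg u UNIV) x y + ennreal ((g_moment + 2 * calG (slope v (x, y))) / weight (x, y))
    = columns M (Sg v UNIV) x y + ennreal ((g_moment + 2 * calG (slope u (x, y))) / weight (x, y))"
proof -
  have agree: "t < u x \<longleftrightarrow> t < v x" if "t \<notin> window M x" for t x
  proof (cases "x \<in> \<Omega>")
    case True
    then have "t \<le> - M \<or> M \<le> t" using that by (auto simp: window_def)
    moreover have "- M < u x" "u x < M" "- M < v x" "v x < M" using u[OF True] v[OF True] by linarith+
    ultimately show ?thesis by linarith
  qed (simp add: out)
  show ?thesis
    unfolding columns_def fibre_Sg half_line_energy_slope[symmetric]
    by (rule column_energy_strip_exchange) (use xy agree in simp_all)
qed

text \<open>Comparison with the graph of the zero function inside \<open>\<Omega>\<close>.\<close>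

lemma graph_columns_lower:
  assumes u: "\<And>x. x \<in> \<Omega> \<Longrightarrow> \<bar>u x\<bar> < M" and M: "0 < M" and xy: "x \<noteq> y" "x \<in> \<Omega>" "y \<in> \<Omega>"
  shows "ennreal (calG (slope u (x, y)) / weight (x, y)) \<le> columns M (Sg u UNIV) x y"
proof -
  define v where "v x = (if x \<in> \<Omega> then 0 else u x)" for x
  have w: "0 < weight (x, y)" using xy by (simp add: weight_pos)
  have v0: "slope v (x, y) = 0" using xy by (simp add: slope_def v_def)
  have "columns M (Sg u UNIV) x y + ennreal ((g_moment + 2 * calG (slope v (x, y))) / weight (x, y))
    = columns M (Sg v UNIV) x y + ennreal ((g_moment + 2 * calG (slope u (x, y))) / weight (x, y))"
    by (rule graph_columns_exchange) (use u M xy in \<open>simp_all add: v_def\<close>)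
  then have "ennreal (g_moment / weight (x, y)) + columns M (Sg u UNIV) x y
    = columns M (Sg v UNIV) x y + ennreal ((g_moment + 2 * calG (slope u (x, y))) / weight (x, y))"
    by (simp add: v0 add.commute)
  moreover have "ennreal ((g_moment + 2 * calG (slope u (x, y))) / weight (x, y))
    = ennreal (g_moment / weight (x, y)) + ennreal (2 * calG (slope u (x, y)) / weight (x, y))"
    using w g_moment_nonneg calG_nonneg by (subst ennreal_plus[symmetric]) (simp_all add: add_divide_distrib)
  ultimately have "ennreal (g_moment / weight (x, y)) + ennreal (2 * calG (slope u (x, y)) / weight (x, y))
    \<le> ennreal (g_moment / weight (x, y)) + columns M (Sg u UNIV) x y"
    by (simp add: add_increasing)
  then have "ennreal (2 * calG (slope u (x, y)) / weight (x, y)) \<le> columns M (Sg u UNIV) x y"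
    by (simp add: ennreal_add_left_cancel_le)
  moreover have "ennreal (calG (slope u (x, y)) / weight (x, y)) \<le> ennreal (2 * calG (slope u (x, y)) / weight (x, y))"
    using w calG_nonneg[of "slope u (x, y)"] by (intro ennreal_leI divide_right_mono) simp_all
  ultimately show ?thesis by (rule order_trans[rotated])
qed

lemma column_energy_one_window:
  assumes r: "0 < r" and [measurable]: "A \<in> sets borel" "A' \<in> sets borel" "I \<in> sets borel"
  shows "column_energy r A A' (strip I {}) \<le> emeasure lborel I * ennreal (r powr - (real DIM('a) + s) * g_mass)"
    and "column_energy r A A' (strip {} I) \<le> emeasure lborel I * ennreal (r powr - (real DIM('a) + s) * g_mass)"
proof -
  let ?k = "column_kernel r"
  have k: "(\<integral>\<^sup>+z. ennreal (?k z) \<partial>lborel) = ennreal (r powr - (real DIM('a) + s) * g_mass)"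
    using column_kernel_integral[OF r] by (simp add: nn_integral_eq_integral column_kernel_nonneg)
  have le: "ennreal (\<bar>indicator A t - indicator A' \<tau>\<bar> * ?k z) \<le> ennreal (?k z)" for t \<tau> z
    by (intro ennreal_leI) (simp add: column_kernel_nonneg indicator_def)
  have m: "(\<lambda>z. ennreal (\<bar>indicator A (fst z) - indicator A' (snd z)\<bar> * ?k (fst z - snd z)) * indicator (strip X Y) z) \<in> borel_measurable borel"
    if [measurable]: "X \<in> sets borel" "Y \<in> sets borel" for X Y
  proof -
    have [measurable]: "strip X Y \<in> sets borel" by simp
    show ?thesis by measurable
  qed
  have "column_energy r A A' (strip I {}) \<le> (\<integral>\<^sup>+t. \<integral>\<^sup>+\<tau>. indicator I t * ennreal (?k (t - \<tau>)) \<partial>lborel \<partial>lborel)"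
    unfolding column_energy_def
    by (subst nn_integral_lborel_pair(1)[OF m]) (auto simp: strip_def indicator_def le[unfolded indicator_def] intro!: nn_integral_mono)
  also have "\<dots> = (\<integral>\<^sup>+t. indicator I t * (\<integral>\<^sup>+z. ennreal (?k z) \<partial>lborel) \<partial>lborel)"
  proof (rule nn_integral_cong)
    fix t :: real
    have "(\<integral>\<^sup>+\<tau>. indicator I t * ennreal (?k (t - \<tau>)) \<partial>lborel) = indicator I t * (\<integral>\<^sup>+\<tau>. ennreal (?k (t - \<tau>)) \<partial>lborel)"
      by (rule nn_integral_cmult) measurable
    also have "(\<integral>\<^sup>+\<tau>. ennreal (?k (t - \<tau>)) \<partial>lborel) = (\<integral>\<^sup>+z. ennreal (?k z) \<partial>lborel)"
      by (rule nn_integral_lborel_reflect) measurable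
    finally show "(\<integral>\<^sup>+\<tau>. indicator I t * ennreal (?k (t - \<tau>)) \<partial>lborel) = indicator I t * (\<integral>\<^sup>+z. ennreal (?k z) \<partial>lborel)" .
  qed
  also have "\<dots> = emeasure lborel I * ennreal (r powr - (real DIM('a) + s) * g_mass)"
    by (simp add: nn_integral_multc k)
  finally show "column_energy r A A' (strip I {}) \<le> emeasure lborel I * ennreal (r powr - (real DIM('a) + s) * g_mass)" .
  have "column_energy r A A' (strip {} I) \<le> (\<integral>\<^sup>+\<tau>. \<integral>\<^sup>+t. indicator I \<tau> * ennreal (?k (t - \<tau>)) \<partial>lborel \<partial>lborel)"
    unfolding column_energy_def
    by (subst nn_integral_lborel_pair(2)[OF m]) (auto simp: strip_def indicator_def le[unfolded indicator_def] intro!: nn_integral_mono)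
  also have "\<dots> = (\<integral>\<^sup>+\<tau>. indicator I \<tau> * (\<integral>\<^sup>+z. ennreal (?k z) \<partial>lborel) \<partial>lborel)"
  proof (rule nn_integral_cong)
    fix \<tau> :: real
    have "(\<integral>\<^sup>+t. indicator I \<tau> * ennreal (?k (t - \<tau>)) \<partial>lborel) = indicator I \<tau> * (\<integral>\<^sup>+t. ennreal (?k (- \<tau> + t)) \<partial>lborel)"
      by (subst nn_integral_cmult[symmetric]) (auto simp: algebra_simps)
    also have "(\<integral>\<^sup>+t. ennreal (?k (- \<tau> + t)) \<partial>lborel) = (\<integral>\<^sup>+z. ennreal (?k z) \<partial>lborel)"
      by (rule nn_integral_lborel_translate) measurable
    finally show "(\<integral>\<^sup>+t. indicator I \<tau> * ennreal (?k (t - \<tau>)) \<partial>lborel) = indicator I \<tau> * (\<integral>\<^sup>+z. ennreal (?k z) \<partial>lborel)" .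
  qed
  also have "\<dots> = emeasure lborel I * ennreal (r powr - (real DIM('a) + s) * g_mass)"
    by (simp add: nn_integral_multc k)
  finally show "column_energy r A A' (strip {} I) \<le> emeasure lborel I * ennreal (r powr - (real DIM('a) + s) * g_mass)" .
qed

text \<open>
  Two columns inside \<open>\<Omega>\<close> interact at most as full half-lines do, which is controlled by the energy
  and by the reciprocal weight, integrable on \<open>\<Omega> \<times> \<Omega>\<close>. If one column is outside, only the bounded window of the other one
  counts, and this costs the fractional perimeter of \<open>\<Omega>\<close>.
\<close>

lemma graph_perimeter_finite:
  assumes u: "u \<in> competitors" and M: "0 < M"
  shows "Per s (Sg u UNIV) (cyl \<Omega> M) < \<infinity>"
proof -
  note [measurable] = competitors_borel[OF u]
  define b where "b z = (ennreal g_moment * ennreal (1 / weight z) + 4 * ennreal (gradient_kernel u z)) * indicator (\<Omega> \<times> \<Omega>) z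
    + ennreal (2 * M * g_mass) * ennreal (gradient_kernel (indicator \<Omega>) z)" for z
  have mb: "b \<in> borel_measurable borel" unfolding b_def[abs_def] by measurable
  have pt: "columns M (Sg u UNIV) x y \<le> b (x, y)" if xy: "x \<noteq> y" for x y
  proof -
    have r: "0 < norm (x - y)" using xy by simp
    have I: "emeasure lborel {-M<..<M} = ennreal (2 * M)" using M by simp
    have one: "ennreal (2 * M) * ennreal (norm (x - y) powr - (real DIM('a) + s) * g_mass) \<le> b (x, y)"
      if "\<bar>indicator \<Omega> x - indicator \<Omega> y\<bar> = (1::real)"
    proof -
      have "gradient_kernel (indicator \<Omega>) (x, y) = norm (x - y) powr - (real DIM('a) + s)"
        unfolding gradient_kernel_def fst_conv snd_conv that powr_minus_divide ..
      then have "ennreal (2 * M * g_mass) * ennreal (gradient_kernel (indicator \<Omega>) (x, y))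
        = ennreal (2 * M) * ennreal (norm (x - y) powr - (real DIM('a) + s) * g_mass)"
        using M g_mass_nonneg by (simp add: ennreal_mult[symmetric] mult_ac)
      then show ?thesis by (simp add: b_def)
    qed
    consider "x \<in> \<Omega>" "y \<in> \<Omega>" | "x \<in> \<Omega>" "y \<notin> \<Omega>" | "x \<notin> \<Omega>" "y \<in> \<Omega>" | "x \<notin> \<Omega>" "y \<notin> \<Omega>" by blast
    then show ?thesis
    proof cases
      case 1
      have "columns M (Sg u UNIV) x y \<le> column_energy (norm (x - y)) {..<u x} {..<u y} UNIV"
        unfolding columns_def fibre_Sg by (subst column_energy_split[of _ _ "strip (window M x) (window M y)"]) simp_all
      also have "\<dots> = ennreal ((g_moment + 2 * calG (slope u (x, y))) / weight (x, y))"
        unfolding column_energy_half_lines[OF r] half_line_energy_slope ..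
      also have "\<dots> \<le> ennreal (g_moment * (1 / weight (x, y)) + 4 * gradient_kernel u (x, y))"
      proof (rule ennreal_leI)
        have "calG (slope u (x, y)) \<le> 2 * \<bar>slope u (x, y)\<bar>"
          using calG_diff_le[of "slope u (x, y)" 0] by simp
        then have "(g_moment + 2 * calG (slope u (x, y))) / weight (x, y) \<le> (g_moment + 4 * \<bar>slope u (x, y)\<bar>) / weight (x, y)"
          by (intro divide_right_mono weight_nonneg) simp
        then show "(g_moment + 2 * calG (slope u (x, y))) / weight (x, y) \<le> g_moment * (1 / weight (x, y)) + 4 * gradient_kernel u (x, y)"
          by (simp add: abs_slope_weight[symmetric] add_divide_distrib)
      qed
      also have "\<dots> = ennreal g_moment * ennreal (1 / weight (x, y)) + 4 * ennreal (gradient_kernel u (x, y))"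
        using g_moment_nonneg weight_nonneg gradient_kernel_nonneg
        by (subst ennreal_plus) (simp_all add: ennreal_mult[symmetric] ennreal_mult)
      also have "\<dots> \<le> b (x, y)" using 1 by (simp add: b_def)
      finally show ?thesis .
    next
      case 2
      then have "columns M (Sg u UNIV) x y \<le> emeasure lborel {-M<..<M} * ennreal (norm (x - y) powr - (real DIM('a) + s) * g_mass)"
        unfolding columns_def fibre_Sg by (simp only: window_def if_True if_False) (rule column_energy_one_window[OF r]; simp)
      also have "\<dots> \<le> b (x, y)" unfolding I by (rule one) (use 2 in simp)
      finally show ?thesis .
    next
      case 3
      then have "columns M (Sg u UNIV) x y \<le> emeasure lborel {-M<..<M} * ennreal (norm (x - y) powr - (real DIM('a) + s) * g_mass)"
        unfolding columns_def fibre_Sg by (simp only: window_def if_True if_False) (rule column_energy_one_window[OF r]; simp)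
      also have "\<dots> \<le> b (x, y)" unfolding I by (rule one) (use 3 in simp)
      finally show ?thesis .
    next
      case 4
      then have "columns M (Sg u UNIV) x y = 0" by (simp add: columns_def column_energy_def strip_def window_def)
      then show ?thesis by simp
    qed
  qed
  have "Per s (Sg u UNIV) (cyl \<Omega> M) = (\<integral>\<^sup>+x. \<integral>\<^sup>+y. columns M (Sg u UNIV) x y \<partial>lborel \<partial>lborel)"
    by (rule Per_columns[OF Sg_borel]) measurable
  also have "\<dots> \<le> (\<integral>\<^sup>+x. \<integral>\<^sup>+y. b (x, y) \<partial>lborel \<partial>lborel)"
  proof (rule nn_integral_mono)
    fix x :: 'a
    have "AE y in lborel. y \<noteq> x" by (rule AE_lborel_singleton)
    then show "(\<integral>\<^sup>+y. columns M (Sg u UNIV) x y \<partial>lborel) \<le> (\<integral>\<^sup>+y. b (x, y) \<partial>lborel)"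
      by (intro nn_integral_mono_AE) (auto elim!: eventually_mono intro: pt)
  qed
  also have "\<dots> = (\<integral>\<^sup>+z. b z \<partial>lborel)" by (rule nn_integral_lborel_pair(1)[OF mb, symmetric])
  also have "\<dots> = ennreal g_moment * (\<integral>\<^sup>+z. ennreal (1 / weight z) * indicator (\<Omega> \<times> \<Omega>) z \<partial>lborel)
     + 4 * inner_seminorm u + ennreal (2 * M * g_mass) * gagliardo s (indicator \<Omega> :: 'a \<Rightarrow> real)"
    unfolding b_def inner_seminorm_def gagliardo_def gradient_kernel_def[symmetric]
    by (simp add: distrib_right nn_integral_add nn_integral_cmult mult.assoc)
  also have "\<dots> < \<infinity>"
    using weight_integral_finite competitors_inner[OF u] gagliardo_indicator by (simp add: ennreal_mult_less_top)
  finally show ?thesis .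
qed

text \<open>
  A competing set is replaced by the subgraph whose columns have the same length in the window;
  this does not increase the perimeter, and for subgraphs the perimeter differs from twice the
  energy only by terms that are the same for all competitors.
\<close>

lemma subgraph_minimises_perimeter:
  assumes u: "u \<in> competitors" and N: "0 \<le> N" and uN: "\<And>x. x \<in> \<Omega> \<Longrightarrow> \<bar>u x\<bar> \<le> N"
    and min: "\<And>v. v \<in> competitors \<Longrightarrow> above_obstacle A \<psi> v \<Longrightarrow> energy_gap u v \<le> 0"
    and A: "A \<subseteq> \<Omega>" and \<psi>: "AE x in lborel. x \<in> A \<longrightarrow> \<bar>\<psi> x\<bar> \<le> N"
    and F [measurable]: "F \<in> sets borel" and FE: "F - cyl \<Omega> N = Sg u UNIV - cyl \<Omega> N"
    and obs: "AE X in lborel. X \<in> Sg \<psi> A \<longrightarrow> X \<in> F" and NM: "N < M"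
  shows "Per s (Sg u UNIV) (cyl \<Omega> M) \<le> Per s F (cyl \<Omega> M)"
proof (cases "Per s F (cyl \<Omega> M) = \<infinity>")
  case False
  note [measurable] = competitors_borel[OF u]
  have M: "0 < M" using N NM by simp
  define J where "J = {-M<..<M}"
  have [measurable]: "J \<in> sets borel" by (simp add: J_def)
  define len where "len x = measure lborel (fibre F x \<inter> J)" for x
  (* Each column of F over \<Omega> contains the part of the window below -N and, by N < M, this keeps
     v strictly inside the window. *)
  define v where "v x = (if x \<in> \<Omega> then len x - M else \<phi> x)" for x
  have fin: "emeasure lborel (X \<inter> J) < \<infinity>" if "X \<in> sets borel" for X
    by (rule emeasure_bounded_finite) (simp add: J_def bounded_Int)
  have FE': "(x, t) \<in> F \<longleftrightarrow> t < u x" if "x \<notin> \<Omega> \<or> t \<le> - N \<or> N \<le> t" for x t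
  proof -
    have "(x, t) \<notin> cyl \<Omega> N" using that by (auto simp: cyl_def)
    then have "(x, t) \<in> F \<longleftrightarrow> (x, t) \<in> Sg u UNIV" using FE by blast
    then show ?thesis by (simp add: Sg_def)
  qed
  have v_bd: "- N \<le> v x \<and> v x \<le> N" if x: "x \<in> \<Omega>" for x
  proof -
    have ux: "- N \<le> u x" "u x \<le> N" using uN[OF x] by linarith+
    have "{-M<..<-N} \<subseteq> fibre F x \<inter> J"
      using FE'[of x] ux NM N by (auto simp: fibre_def J_def)
    then have "measure lborel {-M<..<-N} \<le> len x"
      unfolding len_def using fin[OF fibre_borel[OF F], of x] by (intro measure_mono_fmeasurable) (simp_all add: fmeasurable_def)
    moreover have "fibre F x \<inter> J \<subseteq> {-M<..<N}"
    proof
      fix t assume t: "t \<in> fibre F x \<inter> J"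
      have "t < N"
      proof (rule ccontr)
        assume "\<not> t < N"
        then show False using FE'[of x t] ux t by (simp add: fibre_def)
      qed
      with t show "t \<in> {-M<..<N}" by (simp add: J_def)
    qed
    then have "len x \<le> measure lborel {-M<..<N}"
      unfolding len_def using NM N by (intro measure_mono_fmeasurable) (simp_all add: fmeasurable_def)
    ultimately show ?thesis using x NM N by (simp add: v_def)
  qed
  have v_borel [measurable]: "v \<in> borel_measurable borel"
  proof -
    have mI: "(\<lambda>z. indicator F (fst z, snd z) * indicator J (snd z) :: ennreal) \<in> borel_measurable borel"
    proof -
      have [measurable]: "(\<lambda>z::'a \<times> real. indicator J (snd z) :: ennreal) \<in> borel_measurable borel"
        by (rule measurable_compose[OF snd_borel borel_measurable_indicator]) simp
      have "(\<lambda>z::'a \<times> real. indicator F z * indicator J (snd z) :: ennreal) \<in> borel_measurable borel" by measurable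
      then show ?thesis by simp
    qed
    have "len x = enn2real (\<integral>\<^sup>+t. indicator F (x, t) * indicator J t \<partial>lborel)" for x
    proof -
      have "(\<integral>\<^sup>+t. indicator F (x, t) * indicator J t \<partial>lborel) = (\<integral>\<^sup>+t. indicator (fibre F x \<inter> J) t \<partial>lborel)"
        by (intro nn_integral_cong) (simp add: indicator_def fibre_def)
      then show ?thesis by (simp add: len_def measure_def)
    qed
    moreover have "(\<lambda>x. enn2real (\<integral>\<^sup>+t. indicator F (x, t) * indicator J t \<partial>lborel)) \<in> borel_measurable borel"
      using borel_measurable_nn_integral_lborel[OF mI] by measurable
    ultimately have [measurable]: "len \<in> borel_measurable borel" by (simp add: measurable_cong[of borel len])
    show ?thesis unfolding v_def[abs_def] by measurable
  qed
  have v_out: "x \<notin> \<Omega> \<Longrightarrow> v x = \<phi> x" for x by (simp add: v_def)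
  have uM: "\<bar>u x\<bar> < M" and vM: "\<bar>v x\<bar> < M" and vN: "\<bar>v x\<bar> \<le> N" if "x \<in> \<Omega>" for x
    using uN[OF that] v_bd[OF that] NM by (simp_all add: abs_le_iff abs_less_iff)
  have rearr: "columns M (Sg v UNIV) x y \<le> columns M F x y" if xy: "x \<noteq> y" for x y
  proof -
    have outside: "t \<in> fibre F x \<longleftrightarrow> t < v x" if t: "t \<notin> window M x" for t x
    proof (cases "x \<in> \<Omega>")
      case True
      then have "t \<le> - M \<or> M \<le> t" using t by (auto simp: window_def)
      moreover have "- M < u x" "u x < M" "- M < v x" "v x < M" using uM[OF True] vM[OF True] by linarith+
      ultimately show ?thesis using FE'[of x t] NM by (auto simp: fibre_def)
    next
      case False
      then show ?thesis using FE'[of x t] competitors_outside[OF u False] by (simp add: fibre_def v_def)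
    qed
    have same: "measure lborel (fibre F x \<inter> window M x) = measure lborel ({..<v x} \<inter> window M x)" for x
    proof (cases "x \<in> \<Omega>")
      case True
      have "- M < v x" "v x < M" using vM[OF True] by linarith+
      then have "{..<v x} \<inter> window M x = {-M<..<v x}" using True by (auto simp: window_def)
      then have "measure lborel ({..<v x} \<inter> window M x) = v x + M" using \<open>- M < v x\<close> by simp
      then show ?thesis using True by (simp add: v_def len_def J_def window_def)
    qed (simp add: window_def)
    have "emeasure lborel (window M x) < \<infinity>" for x
      using M by (simp add: window_def)
    then show ?thesis
      unfolding columns_def fibre_Sg using xy
      by (intro half_lines_minimise outside same) simp_all
  qed
  have Pv_le: "Per s (Sg v UNIV) (cyl \<Omega> M) \<le> Per s F (cyl \<Omega> M)"
    unfolding Per_columns[OF F] Per_columns[OF Sg_borel[OF v_borel]]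
  proof (rule nn_integral_mono)
    fix x :: 'a
    have "AE y in lborel. y \<noteq> x" by (rule AE_lborel_singleton)
    then show "(\<integral>\<^sup>+y. columns M (Sg v UNIV) x y \<partial>lborel) \<le> (\<integral>\<^sup>+y. columns M F x y \<partial>lborel)"
      by (intro nn_integral_mono_AE) (auto elim!: eventually_mono intro: rearr)
  qed
  then have Pv_fin: "Per s (Sg v UNIV) (cyl \<Omega> M) < \<infinity>" 
    by (rule le_less_trans) (use False in \<open>simp add: less_top[symmetric]\<close>)
  have vc: "v \<in> competitors"
  proof (rule competitor_of_finite_energy[OF v_borel v_out vN])
    let ?h = "\<lambda>z. ennreal (calG (slope v z) / weight z) * indicator (\<Omega> \<times> \<Omega>) z"
    have "(\<integral>\<^sup>+z. ?h z \<partial>lborel) = (\<integral>\<^sup>+x. \<integral>\<^sup>+y. ?h (x, y) \<partial>lborel \<partial>lborel)"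
      by (rule nn_integral_lborel_pair(1)) measurable
    also have "\<dots> \<le> Per s (Sg v UNIV) (cyl \<Omega> M)"
      unfolding Per_columns[OF Sg_borel[OF v_borel]]
    proof (rule nn_integral_mono)
      fix x :: 'a
      have "AE y in lborel. y \<noteq> x" by (rule AE_lborel_singleton)
      then show "(\<integral>\<^sup>+y. ?h (x, y) \<partial>lborel) \<le> (\<integral>\<^sup>+y. columns M (Sg v UNIV) x y \<partial>lborel)"
      proof (intro nn_integral_mono_AE, elim eventually_mono)
        fix y assume "y \<noteq> x"
        then show "?h (x, y) \<le> columns M (Sg v UNIV) x y"
          using graph_columns_lower[where u = v and x = x and y = y, OF vM M] by (cases "x \<in> \<Omega> \<and> y \<in> \<Omega>") auto
      qed
    qed
    finally show "(\<integral>\<^sup>+z. ?h z \<partial>lborel) < \<infinity>" using Pv_fin by (rule le_less_trans)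
  qed
  have va: "above_obstacle A \<psi> v"
    unfolding above_obstacle_def
    using AE_lborel_pairD[OF obs] \<psi>
  proof eventually_elim
    case (elim x)
    show ?case
    proof
      assume x: "x \<in> A"
      then have x\<Omega>: "x \<in> \<Omega>" using A by blast
      have \<psi>x: "- N \<le> \<psi> x" "\<psi> x \<le> N" using elim(2) x by (simp_all add: abs_le_iff)
      have "AE t in lborel. t \<in> {-M<..<\<psi> x} \<longrightarrow> t \<in> fibre F x \<inter> J"
        using elim(1) by eventually_elim (use x \<psi>x NM in \<open>auto simp: Sg_def fibre_def J_def\<close>)
      then have "emeasure lborel {-M<..<\<psi> x} \<le> emeasure lborel (fibre F x \<inter> J)"
        by (rule emeasure_mono_AE) simp
      then have "ennreal (\<psi> x + M) \<le> ennreal (len x)"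
        using \<psi>x NM fin[OF fibre_borel[OF F], of x] by (simp add: len_def emeasure_eq_ennreal_measure less_top)
      then have "\<psi> x + M \<le> len x" by (simp add: len_def ennreal_le_iff)
      then show "\<psi> x \<le> v x" using x\<Omega> by (simp add: v_def)
    qed
  qed
  let ?e = "energy_diff s v u"
  have e_int: "integrable lborel ?e" by (rule integrable_energy_diff[OF vc u])
  have [measurable]: "?e \<in> borel_measurable borel" using e_int by (simp add: borel_measurable_integrable)
  (* The positive and negative parts of the energy difference are finite and can be cancelled,
     so they are added on either side instead of subtracting perimeters. *)
  define \<alpha> where "\<alpha> = (\<integral>\<^sup>+z. ennreal (2 * ?e z) \<partial>lborel)"
  define \<beta> where "\<beta> = (\<integral>\<^sup>+z. ennreal (- (2 * ?e z)) \<partial>lborel)"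
  have e2: "integrable lborel (\<lambda>z. 2 * ?e z)" using e_int by simp
  then have ab_fin: "\<alpha> < \<infinity>" "\<beta> < \<infinity>"
    using real_integrable_def[of lborel "\<lambda>z. 2 * ?e z"] by (simp_all add: \<alpha>_def \<beta>_def less_top)
  have "0 \<le> 2 * energy_gap v u"
    using energy_gap_trans[OF u vc u] min[OF vc va] by (simp add: energy_gap_def energy_diff_slope)
  also have "\<dots> = enn2real \<alpha> - enn2real \<beta>"
    using real_lebesgue_integral_def[OF e2] by (simp add: energy_gap_def \<alpha>_def \<beta>_def)
  finally have "\<beta> \<le> \<alpha>"
    using ab_fin by (simp add: enn2real_le_iff less_top) (metis ab_fin enn2real_le_iff ennreal_enn2real ennreal_leI infinity_ennreal_def less_top)
  have eq: "columns M (Sg u UNIV) x y + ennreal (2 * ?e (x, y)) = columns M (Sg v UNIV) x y + ennreal (- (2 * ?e (x, y)))"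
    if xy: "x \<noteq> y" for x y
  proof -
    define a where "a = (g_moment + 2 * calG (slope u (x, y))) / weight (x, y)"
    define b where "b = (g_moment + 2 * calG (slope v (x, y))) / weight (x, y)"
    have a0: "0 \<le> a" and b0: "0 \<le> b"
      unfolding a_def b_def using g_moment_nonneg calG_nonneg weight_nonneg by simp_all
    have ex: "columns M (Sg u UNIV) x y + ennreal b = columns M (Sg v UNIV) x y + ennreal a"
      unfolding a_def b_def
      by (rule graph_columns_exchange) (use uM vM xy competitors_outside[OF u] v_out in simp_all)
    have e: "2 * ?e (x, y) = b - a"
      by (simp add: a_def b_def energy_diff_slope diff_divide_distrib[symmetric])
    show ?thesis
    proof (cases "a \<le> b")
      case True
      then have "ennreal b = ennreal (b - a) + ennreal a" using a0 by (simp add: ennreal_plus[symmetric] del: ennreal_plus)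
      with ex have "ennreal a + (columns M (Sg u UNIV) x y + ennreal (b - a)) = ennreal a + columns M (Sg v UNIV) x y"
        by (simp add: add_ac)
      then show ?thesis unfolding e using True by (simp add: ennreal_add_left_cancel ennreal_neg)
    next
      case False
      then have "ennreal a = ennreal (a - b) + ennreal b" using b0 by (simp add: ennreal_plus[symmetric] del: ennreal_plus)
      with ex have "ennreal b + columns M (Sg u UNIV) x y = ennreal b + (columns M (Sg v UNIV) x y + ennreal (a - b))"
        by (simp add: add_ac)
      then show ?thesis unfolding e using False by (simp add: ennreal_add_left_cancel ennreal_neg)
    qed
  qed
  have sum: "Per s (Sg w UNIV) (cyl \<Omega> M) + (\<integral>\<^sup>+z. h z \<partial>lborel)
     = (\<integral>\<^sup>+x. \<integral>\<^sup>+y. columns M (Sg w UNIV) x y + h (x, y) \<partial>lborel \<partial>lborel)"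
    if w: "w \<in> borel_measurable borel" and h: "h \<in> borel_measurable borel" for w h
  proof -
    have mw: "(\<lambda>z. columns M (Sg w UNIV) (fst z) (snd z)) \<in> borel_measurable borel"
      by (rule columns_borel[OF Sg_borel[OF w]])
    have "Per s (Sg w UNIV) (cyl \<Omega> M) = (\<integral>\<^sup>+z. columns M (Sg w UNIV) (fst z) (snd z) \<partial>lborel)"
      unfolding Per_columns[OF Sg_borel[OF w]] by (subst nn_integral_lborel_pair(1)[OF mw]) simp
    then have "Per s (Sg w UNIV) (cyl \<Omega> M) + (\<integral>\<^sup>+z. h z \<partial>lborel) = (\<integral>\<^sup>+z. columns M (Sg w UNIV) (fst z) (snd z) + h z \<partial>lborel)"
      using mw h by (simp add: nn_integral_add)
    also have "\<dots> = (\<integral>\<^sup>+x. \<integral>\<^sup>+y. columns M (Sg w UNIV) x y + h (x, y) \<partial>lborel \<partial>lborel)"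
      using mw h by (subst nn_integral_lborel_pair(1)) simp_all
    finally show ?thesis .
  qed
  have "Per s (Sg u UNIV) (cyl \<Omega> M) + \<alpha> = Per s (Sg v UNIV) (cyl \<Omega> M) + \<beta>"
    unfolding \<alpha>_def \<beta>_def
  proof (subst (1 2) sum)
    show "(\<integral>\<^sup>+x. \<integral>\<^sup>+y. columns M (Sg u UNIV) x y + ennreal (2 * ?e (x, y)) \<partial>lborel \<partial>lborel)
      = (\<integral>\<^sup>+x. \<integral>\<^sup>+y. columns M (Sg v UNIV) x y + ennreal (- (2 * ?e (x, y))) \<partial>lborel \<partial>lborel)"
    proof (rule nn_integral_cong)
      fix x :: 'a
      have "AE y in lborel. y \<noteq> x" by (rule AE_lborel_singleton)
      then show "(\<integral>\<^sup>+y. columns M (Sg u UNIV) x y + ennreal (2 * ?e (x, y)) \<partial>lborel)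
        = (\<integral>\<^sup>+y. columns M (Sg v UNIV) x y + ennreal (- (2 * ?e (x, y))) \<partial>lborel)"
        by (intro nn_integral_cong_AE) (auto elim!: eventually_mono intro: eq)
    qed
  qed simp_all
  also have "\<dots> \<le> Per s (Sg v UNIV) (cyl \<Omega> M) + \<alpha>" using \<open>\<beta> \<le> \<alpha>\<close> by (rule add_left_mono)
  finally have "Per s (Sg u UNIV) (cyl \<Omega> M) \<le> Per s (Sg v UNIV) (cyl \<Omega> M)"
    using ab_fin by (auto simp: add.commute[of _ \<alpha>] ennreal_add_left_cancel_le)
  with Pv_le show ?thesis by (rule order_trans[rotated])
qed simp

end

section \<open>The obstacle problem\<close>

lemma borel_measurable_lebesgue_AE:
  fixes f f' :: "'b::euclidean_space \<Rightarrow> real"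
  assumes ae: "AE x in lborel. f x = f' x" and f': "f' \<in> borel_measurable borel"
  shows "f \<in> borel_measurable lebesgue"
proof (rule measurableI)
  fix A :: "real set" assume A: "A \<in> sets borel"
  have "f' -` A \<inter> space borel \<in> sets borel" by (rule measurable_sets[OF f' A])
  then have S: "f' -` A \<in> sets lebesgue" by simp
  have "AE x in lebesgue. f x = f' x" using ae by (rule AE_completion)
  then have "AE x in lebesgue. x \<in> f' -` A \<longleftrightarrow> x \<in> f -` A" by eventually_elim simp
  then have "f -` A \<in> sets lebesgue" by (rule completion.in_sets_AE[OF _ S]) simp
  then show "f -` A \<inter> space lebesgue \<in> sets lebesgue" by simp
qed simp

lemma Linf_AE_bound:
  fixes f :: "'b::euclidean_space \<Rightarrow> real"
  assumes f: "f \<in> Linf S" and S: "S \<in> sets borel"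
  shows "AE x in lborel. x \<in> S \<longrightarrow> \<bar>f x\<bar> \<le> enn2real (Linf_norm S f)"
proof -
  have fin: "Linf_norm S f < \<infinity>" using f by (simp add: Linf_def)
  have "AE x in lebesgue_on S. ennreal \<bar>f x\<bar> \<le> Linf_norm S f"
    unfolding Linf_norm_def by (rule esssup_AE)
  then have "AE x in lebesgue. x \<in> S \<longrightarrow> ennreal \<bar>f x\<bar> \<le> Linf_norm S f"
    by (subst (asm) AE_restrict_space_iff) (use S in simp_all)
  then have "AE x in lborel. x \<in> S \<longrightarrow> ennreal \<bar>f x\<bar> \<le> Linf_norm S f"
    by (simp only: AE_completion_iff)
  then show ?thesis
  proof eventually_elim
    case (elim x)
    have "Linf_norm S f = ennreal (enn2real (Linf_norm S f))" using fin by (simp add: less_top)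
    then show ?case using elim by (metis ennreal_le_iff enn2real_nonneg)
  qed
qed

lemma lebesgue_set_borel_version:
  fixes F :: "'b::euclidean_space set"
  assumes "F \<in> sets lebesgue"
  obtains F' where "F' \<in> sets borel" "AE X in lborel. X \<in> F' \<longleftrightarrow> X \<in> F"
proof -
  from assms obtain S N N' where F: "F = S \<union> N" "N \<subseteq> N'" "N' \<in> null_sets lborel" "S \<in> sets lborel"
    by (rule sets_completionE)
  have "AE X in lborel. X \<notin> N'" by (rule AE_not_in[OF F(3)])
  then have "AE X in lborel. X \<in> S \<longleftrightarrow> X \<in> F" by eventually_elim (use F in auto)
  then show thesis by (rule that[rotated]) (use F in simp)
qed

context obstacle_setting
begin

lemma Ws1_norm_eq:
  assumes ae: "AE x in lborel. u x = u' x" and u' [measurable]: "u' \<in> borel_measurable borel"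
  shows "Ws1_norm s \<Omega> u = mass \<Omega> u' + inner_seminorm u'"
proof -
  let ?k = "\<lambda>u x y. ennreal (\<bar>u x - u y\<bar> / norm (x - y) powr (real DIM('a) + s))"
  have "(\<integral>\<^sup>+x. ennreal \<bar>u x\<bar> * indicator \<Omega> x \<partial>lborel) = mass \<Omega> u'"
    unfolding mass_def by (rule nn_integral_cong_AE) (use ae in \<open>auto elim!: eventually_mono\<close>)
  moreover have "(\<integral>\<^sup>+x. (\<integral>\<^sup>+y. ?k u x y * indicator \<Omega> y \<partial>lborel) * indicator \<Omega> x \<partial>lborel) = inner_seminorm u'"
  proof -
    have "(\<integral>\<^sup>+x. (\<integral>\<^sup>+y. ?k u x y * indicator \<Omega> y \<partial>lborel) * indicator \<Omega> x \<partial>lborel)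
      = (\<integral>\<^sup>+x. \<integral>\<^sup>+y. ?k u' x y * indicator (\<Omega> \<times> \<Omega>) (x, y) \<partial>lborel \<partial>lborel)"
    proof (rule nn_integral_cong_AE)
      show "AE x in lborel. (\<integral>\<^sup>+y. ?k u x y * indicator \<Omega> y \<partial>lborel) * indicator \<Omega> x
        = (\<integral>\<^sup>+y. ?k u' x y * indicator (\<Omega> \<times> \<Omega>) (x, y) \<partial>lborel)"
        using ae
      proof eventually_elim
        case (elim x)
        show ?case
        proof (cases "x \<in> \<Omega>")
          case True
          then have "(\<integral>\<^sup>+y. ?k u x y * indicator \<Omega> y \<partial>lborel) = (\<integral>\<^sup>+y. ?k u' x y * indicator (\<Omega> \<times> \<Omega>) (x, y) \<partial>lborel)"
            by (intro nn_integral_cong_AE) (use ae elim in \<open>auto elim!: eventually_mono simp: indicator_def\<close>)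
          with True show ?thesis by simp
        qed simp
      qed
    qed
    also have "\<dots> = inner_seminorm u'"
      unfolding inner_seminorm_def by (subst nn_integral_lborel_pair(1)) simp_all
    finally show ?thesis .
  qed
  ultimately show ?thesis
    unfolding Ws1_norm_def nn_integral_completion by simp
qed

lemma Ws_obs_competitor:
  assumes u: "u \<in> Ws_obs s \<Omega> A \<phi>0 \<psi>" and \<phi>0: "AE x in lborel. \<phi>0 x = \<phi> x"
  obtains u' where "u' \<in> competitors" "above_obstacle A \<psi> u'" "AE x in lborel. u x = u' x"
proof -
  have ub: "u \<in> borel_measurable lebesgue" and un: "Ws1_norm s \<Omega> u < \<infinity>"
    and out: "AE x in lborel. x \<notin> \<Omega> \<longrightarrow> u x = \<phi>0 x" and obs: "AE x in lborel. x \<in> A \<longrightarrow> \<psi> x \<le> u x"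
    using u by (simp_all add: Ws_obs_def Ws_def AE_completion_iff)
  obtain w where w: "w \<in> borel_measurable lborel" "AE x in lborel. u x = w x"
    using completion_ex_borel_measurable_real[OF ub] by blast
  have [measurable]: "w \<in> borel_measurable borel" using w(1) by simp
  define u' where "u' x = (if x \<in> \<Omega> then w x else \<phi> x)" for x
  have u'b: "u' \<in> borel_measurable borel" unfolding u'_def[abs_def] by measurable
  have ae: "AE x in lborel. u x = u' x"
    using out \<phi>0 w(2) by eventually_elim (simp add: u'_def)
  have "mass \<Omega> u' + inner_seminorm u' < \<infinity>" using un Ws1_norm_eq[OF ae u'b] by simp
  then have "u' \<in> competitors" using u'b by (simp add: competitors_def u'_def)
  moreover have "above_obstacle A \<psi> u'"
    unfolding above_obstacle_def using obs ae by eventually_elim simp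
  ultimately show thesis using ae by (rule that)
qed

lemma competitor_Ws_obs:
  assumes u: "u \<in> competitors" "above_obstacle A \<psi> u" and \<phi>0: "AE x in lborel. \<phi>0 x = \<phi> x"
  shows "u \<in> Ws_obs s \<Omega> A \<phi>0 \<psi>"
proof -
  have "Ws1_norm s \<Omega> u = mass \<Omega> u + inner_seminorm u"
    by (rule Ws1_norm_eq[OF _ competitors_borel[OF u(1)]]) simp
  also have "\<dots> < \<infinity>" using competitors_mass[OF u(1)] competitors_inner[OF u(1)] by simp
  finally have "Ws1_norm s \<Omega> u < \<infinity>" .
  moreover have "u \<in> borel_measurable lebesgue"
    by (rule borel_measurable_lebesgue_AE[OF _ competitors_borel[OF u(1)]]) simp
  moreover have "AE x in lborel. x \<notin> \<Omega> \<longrightarrow> u x = \<phi>0 x"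
    using \<phi>0 by eventually_elim (simp add: competitors_outside[OF u(1)])
  ultimately show ?thesis
    using u(2) by (simp add: Ws_obs_def Ws_def AE_completion_iff above_obstacle_def)
qed

lemma set_integral_energy_diff:
  assumes u: "u' \<in> competitors" "AE x in lborel. u x = u' x" and v: "v' \<in> competitors" "AE x in lborel. v x = v' x"
  shows "set_integrable lebesgue (Q_set \<Omega>) (energy_diff s u v)"
    and "set_lebesgue_integral lebesgue (Q_set \<Omega>) (energy_diff s u v) = energy_gap u' v'"
proof -
  let ?k = "\<lambda>z. indicator (Q_set \<Omega>) z *\<^sub>R energy_diff s u v z" and ?e = "energy_diff s u' v'"
  have ae: "AE z in lborel. ?k z = ?e z"
    using AE_lborel_fst[where 'b='a, OF u(2)] AE_lborel_snd[where 'a='a, OF u(2)]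
      AE_lborel_fst[where 'b='a, OF v(2)] AE_lborel_snd[where 'a='a, OF v(2)]
  proof eventually_elim
    case (elim z)
    then have "energy_diff s u v z = ?e z" by (simp add: energy_diff_slope slope_def)
    then show ?case
      using energy_diff_outside[OF u(1) v(1), of z] by (cases "z \<in> Q_set \<Omega>") simp_all
  qed
  have e_borel: "?e \<in> borel_measurable borel"
    by (rule energy_diff_borel[OF competitors_borel[OF u(1)] competitors_borel[OF v(1)]])
  have k_leb: "?k \<in> borel_measurable lebesgue" by (rule borel_measurable_lebesgue_AE[OF ae e_borel])
  have e_leb: "?e \<in> borel_measurable lebesgue"
    by (rule borel_measurable_lebesgue_AE[OF _ e_borel]) simp
  have ae': "AE z in lebesgue. ?k z = ?e z" using ae by (rule AE_completion)
  have e_int: "integrable lebesgue ?e"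
    using integrable_energy_diff[OF u(1) v(1)] e_borel by (simp add: integrable_completion)
  show "set_integrable lebesgue (Q_set \<Omega>) (energy_diff s u v)"
    unfolding set_integrable_def using integrable_cong_AE[OF k_leb e_leb ae'] e_int by simp
  show "set_lebesgue_integral lebesgue (Q_set \<Omega>) (energy_diff s u v) = energy_gap u' v'"
    unfolding set_lebesgue_integral_def energy_gap_def
    using integral_cong_AE[OF k_leb e_leb ae'] e_borel by (simp add: integral_completion)
qed

text \<open>
  The comparison takes place in a window taller than \<open>u\<close> and the obstacle; a lower window loses the
  same finite part of the perimeter for both sets.
\<close>

lemma minimiser_solves_geometric:
  assumes u: "u \<in> competitors" "above_obstacle A \<psi> u" and N: "0 \<le> N" and uN: "\<And>x. x \<in> \<Omega> \<Longrightarrow> \<bar>u x\<bar> \<le> N"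
    and min: "\<And>v. v \<in> competitors \<Longrightarrow> above_obstacle A \<psi> v \<Longrightarrow> energy_gap u v \<le> 0"
    and A: "A \<subseteq> \<Omega>" and \<psi>: "AE x in lborel. x \<in> A \<longrightarrow> \<bar>\<psi> x\<bar> \<le> N"
    and \<phi>0: "AE x in lborel. \<phi>0 x = \<phi> x"
  shows "solves_geometric_obstacle s \<Omega> A \<phi>0 \<psi> (Sg u UNIV)"
proof -
  let ?E = "Sg u UNIV"
  have E: "?E \<in> sets borel" by (rule Sg_borel[OF competitors_borel[OF u(1)]])
  have cyl: "cyl \<Omega> M \<in> sets borel" for M by (rule cyl_borel) simp
  have "AE X in lborel. X \<in> ?E - \<Omega> \<times> UNIV \<longleftrightarrow> X \<in> Sg \<phi>0 UNIV - \<Omega> \<times> UNIV"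
    using AE_lborel_fst[where 'b=real, OF \<phi>0]
  proof eventually_elim
    case (elim X)
    then show ?case
      by (cases "fst X \<in> \<Omega>"; cases X) (simp_all add: Sg_def competitors_outside[OF u(1)])
  qed
  then have out: "ae_eq (?E - \<Omega> \<times> UNIV) (Sg \<phi>0 UNIV - \<Omega> \<times> UNIV)"
    by (simp only: ae_eq_def AE_completion_iff)
  have "AE X in lborel. X \<in> Sg \<psi> A \<longrightarrow> X \<in> ?E"
    using AE_lborel_fst[where 'b=real, OF u(2)[unfolded above_obstacle_def]]
    by eventually_elim (auto simp: Sg_def)
  then have above: "ae_subset (Sg \<psi> A) ?E" by (simp only: ae_subset_def AE_completion_iff)
  have small_window: "Per s ?E (cyl \<Omega> M) < \<infinity> \<and> (\<forall>F\<in>sets lebesgue. ae_eq (F - cyl \<Omega> M) (?E - cyl \<Omega> M) \<and> ae_subset (Sg \<psi> A) F \<longrightarrow>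
      Per s ?E (cyl \<Omega> M) \<le> Per s F (cyl \<Omega> M))" if M: "0 \<le> M" for M
  proof (intro conjI ballI impI)
    define N' where "N' = max N M"
    define W where "W = cyl \<Omega> (N' + 1)"
    have sub: "cyl \<Omega> M \<subseteq> W" "cyl \<Omega> M \<subseteq> cyl \<Omega> N'" by (auto simp: W_def cyl_def N'_def)
    have W: "W \<in> sets borel" unfolding W_def by (rule cyl)
    have finW: "Per s ?E W < \<infinity>"
      unfolding W_def by (rule graph_perimeter_finite[OF u(1)]) (use N in \<open>simp add: N'_def\<close>)
    have splitE: "Per s ?E W = Per s ?E (cyl \<Omega> M) + (\<integral>\<^sup>+Z. per_kernel s (?E - cyl \<Omega> M) Z * indicator (Q_set W - Q_set (cyl \<Omega> M)) Z \<partial>lborel)"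
      by (rule Per_enlarge_window[OF E cyl W sub(1)])
    show "Per s ?E (cyl \<Omega> M) < \<infinity>" using finW splitE by simp
    fix F assume F: "F \<in> sets lebesgue" and cond: "ae_eq (F - cyl \<Omega> M) (?E - cyl \<Omega> M) \<and> ae_subset (Sg \<psi> A) F"
    obtain F1 where F1: "F1 \<in> sets borel" "AE X in lborel. X \<in> F1 \<longleftrightarrow> X \<in> F"
      by (rule lebesgue_set_borel_version[OF F])
    define F2 where "F2 = (F1 \<inter> cyl \<Omega> M) \<union> (?E - cyl \<Omega> M)"
    have F2: "F2 \<in> sets borel" unfolding F2_def using F1(1) E cyl by (intro sets.Un sets.Int sets.Diff)
    have eqM: "F2 - cyl \<Omega> M = ?E - cyl \<Omega> M" by (auto simp: F2_def)
    have "AE X in lborel. X \<in> F - cyl \<Omega> M \<longleftrightarrow> X \<in> ?E - cyl \<Omega> M"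
      using cond by (simp only: ae_eq_def AE_completion_iff)
    with F1(2) have F2F: "AE X in lborel. X \<in> F2 \<longleftrightarrow> X \<in> F"
      by eventually_elim (auto simp: F2_def)
    have "AE X in lborel. X \<in> Sg \<psi> A \<longrightarrow> X \<in> F"
      using cond by (simp only: ae_subset_def AE_completion_iff)
    with F2F have obs: "AE X in lborel. X \<in> Sg \<psi> A \<longrightarrow> X \<in> F2" by eventually_elim simp
    have eqN: "F2 - cyl \<Omega> N' = ?E - cyl \<Omega> N'" using eqM sub(2) by blast
    have \<psi>': "AE x in lborel. x \<in> A \<longrightarrow> \<bar>\<psi> x\<bar> \<le> N'" using \<psi> by eventually_elim (auto simp: N'_def)
    have uN': "\<bar>u x\<bar> \<le> N'" if "x \<in> \<Omega>" for x using uN[OF that] by (simp add: N'_def)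
    have "Per s ?E W \<le> Per s F2 W"
      unfolding W_def
      by (rule subgraph_minimises_perimeter[OF u(1) _ uN' min A \<psi>' F2 eqN obs]) (use N in \<open>simp_all add: N'_def\<close>)
    moreover have "Per s F2 W = Per s F2 (cyl \<Omega> M) + (\<integral>\<^sup>+Z. per_kernel s (?E - cyl \<Omega> M) Z * indicator (Q_set W - Q_set (cyl \<Omega> M)) Z \<partial>lborel)"
      using Per_enlarge_window[OF F2 cyl W sub(1)] by (simp only: eqM)
    ultimately have "Per s ?E (cyl \<Omega> M) \<le> Per s F2 (cyl \<Omega> M)"
      using splitE finW by (auto simp: add.commute[of "Per s _ (cyl \<Omega> M)"] ennreal_add_left_cancel_le)
    also have "\<dots> = Per s F (cyl \<Omega> M)" by (rule Per_cong_AE[OF F2F])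
    finally show "Per s ?E (cyl \<Omega> M) \<le> Per s F (cyl \<Omega> M)" .
  qed
  have "?E \<in> sets lebesgue" using E by simp
  with out above small_window show ?thesis
    unfolding solves_geometric_obstacle_def by blast
qed

lemma minimiser_solves:
  assumes u: "u \<in> competitors" "above_obstacle A \<psi> u" and N: "0 \<le> N" and uN: "\<And>x. x \<in> \<Omega> \<Longrightarrow> \<bar>u x\<bar> \<le> N"
    and min: "\<And>v. v \<in> competitors \<Longrightarrow> above_obstacle A \<psi> v \<Longrightarrow> energy_gap u v \<le> 0"
    and A: "A \<subseteq> \<Omega>" and \<psi>: "AE x in lborel. x \<in> A \<longrightarrow> \<bar>\<psi> x\<bar> \<le> N"
    and \<phi>0: "AE x in lborel. \<phi>0 x = \<phi> x"
  shows "\<exists>u. solves_obstacle s \<Omega> A \<phi>0 \<psi> u \<and>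
         (\<forall>v. solves_obstacle s \<Omega> A \<phi>0 \<psi> v \<longrightarrow> (AE x in lebesgue. v x = u x)) \<and>
         solves_geometric_obstacle s \<Omega> A \<phi>0 \<psi> (Sg u UNIV)"
proof (intro exI[of _ u] conjI allI impI)
  have refl: "AE x in lborel. w x = w x" for w :: "'a \<Rightarrow> real" by simp
  show "solves_obstacle s \<Omega> A \<phi>0 \<psi> u"
    unfolding solves_obstacle_def
  proof (intro conjI ballI)
    show "u \<in> Ws_obs s \<Omega> A \<phi>0 \<psi>" by (rule competitor_Ws_obs[OF u \<phi>0])
    fix v assume "v \<in> Ws_obs s \<Omega> A \<phi>0 \<psi>"
    then obtain v' where v': "v' \<in> competitors" "above_obstacle A \<psi> v'" "AE x in lborel. v x = v' x"
      by (rule Ws_obs_competitor[OF _ \<phi>0])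
    show "set_integrable lebesgue (Q_set \<Omega>) (energy_diff s u v)"
      by (rule set_integral_energy_diff(1)[OF u(1) refl v'(1,3)])
    show "set_lebesgue_integral lebesgue (Q_set \<Omega>) (energy_diff s u v) \<le> 0"
      using set_integral_energy_diff(2)[OF u(1) refl v'(1,3)] min[OF v'(1,2)] by simp
  qed
  show "solves_geometric_obstacle s \<Omega> A \<phi>0 \<psi> (Sg u UNIV)"
    by (rule minimiser_solves_geometric[OF u N uN min A \<psi> \<phi>0])
  fix v assume v: "solves_obstacle s \<Omega> A \<phi>0 \<psi> v"
  then have "v \<in> Ws_obs s \<Omega> A \<phi>0 \<psi>" by (simp add: solves_obstacle_def)
  then obtain v' where v': "v' \<in> competitors" "above_obstacle A \<psi> v'" "AE x in lborel. v x = v' x"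
    by (rule Ws_obs_competitor[OF _ \<phi>0])
  have min_v': "energy_gap v' w \<le> 0" if w: "w \<in> competitors" "above_obstacle A \<psi> w" for w
  proof -
    have "set_lebesgue_integral lebesgue (Q_set \<Omega>) (energy_diff s v w) \<le> 0"
      using v competitor_Ws_obs[OF w \<phi>0] unfolding solves_obstacle_def by blast
    then show ?thesis unfolding set_integral_energy_diff(2)[OF v'(1,3) w(1) refl] .
  qed
  have "AE x in lborel. u x = v' x"
    by (rule minimiser_unique[OF u v'(1,2) min min_v'])
  with v'(3) have "AE x in lborel. v x = u x" by eventually_elim simp
  then show "AE x in lebesgue. v x = u x" by (rule AE_completion)
qed

end

theorem proposition3p2:
  fixes s :: real
  assumes "0 < s" and "s < 1"
  shows "\<exists>\<Theta>>1. \<forall>(\<Omega> :: (real ^ 'n) set) A \<psi> \<phi>.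
    open \<Omega> \<and> bounded \<Omega> \<and> lipschitz_boundary \<Omega> \<and>
    open A \<and> A \<subseteq> \<Omega> \<and> \<psi> \<in> Linf A \<and>
    \<phi> \<in> borel_measurable lebesgue \<and> \<phi> \<in> Linf (enlarged \<Omega> (\<Theta> * diameter \<Omega>) - \<Omega>) \<longrightarrow>
    (\<exists>u. solves_obstacle s \<Omega> A \<phi> \<psi> u \<and>
         (\<forall>v. solves_obstacle s \<Omega> A \<phi> \<psi> v \<longrightarrow> (AE x in lebesgue. v x = u x)) \<and>
         solves_geometric_obstacle s \<Omega> A \<phi> \<psi> (Sg u UNIV))"
proof -
  let ?n = "DIM(real ^ 'n)"
  let ?C = "2 * kernel_tail_const TYPE(real ^ 'n) s"
  let ?D = "G_fun ?n s (1/2) * unit_ball_vol ?n * 2 powr - (real ?n + s)"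
  interpret profile ?n s by unfold_locales (use assms DIM_positive[where 'a="real ^ 'n"] in simp_all)
  have C: "0 < ?C" using kernel_tail_const_pos[OF assms(1), where 'a="real ^ 'n"] by simp
  have "G_fun ?n s 0 < G_fun ?n s (1/2)" by (rule G_strict_mono) simp
  then have "0 < G_fun ?n s (1/2)" unfolding G_zero .
  then have D: "0 < ?D" by (intro mult_pos_pos) simp_all
  define \<Theta> where "\<Theta> = max 2 ((?C / ?D) powr (1 / s))"
  have \<Theta>2: "2 \<le> \<Theta>" by (simp add: \<Theta>_def)
  have \<Theta>: "?C * \<Theta> powr - s \<le> ?D"
  proof -
    have "?C / ?D = ((?C / ?D) powr (1 / s)) powr s" using C D assms by (simp add: powr_powr)
    also have "\<dots> \<le> \<Theta> powr s" using assms by (intro powr_mono2) (simp_all add: \<Theta>_def)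
    finally have "?C \<le> ?D * \<Theta> powr s" using D by (simp only: pos_divide_le_eq mult.commute)
    then show ?thesis using \<Theta>2 by (simp add: powr_minus_divide pos_divide_le_eq)
  qed
  show ?thesis
  proof (rule exI[of _ \<Theta>], rule conjI)
    show "1 < \<Theta>" using \<Theta>2 by simp
    show "\<forall>(\<Omega> :: (real ^ 'n) set) A \<psi> \<phi>.
      open \<Omega> \<and> bounded \<Omega> \<and> lipschitz_boundary \<Omega> \<and>
      open A \<and> A \<subseteq> \<Omega> \<and> \<psi> \<in> Linf A \<and>
      \<phi> \<in> borel_measurable lebesgue \<and> \<phi> \<in> Linf (enlarged \<Omega> (\<Theta> * diameter \<Omega>) - \<Omega>) \<longrightarrow>
      (\<exists>u. solves_obstacle s \<Omega> A \<phi> \<psi> u \<and>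
         (\<forall>v. solves_obstacle s \<Omega> A \<phi> \<psi> v \<longrightarrow> (AE x in lebesgue. v x = u x)) \<and>
         solves_geometric_obstacle s \<Omega> A \<phi> \<psi> (Sg u UNIV))"
    proof (intro allI impI, elim conjE)
      fix \<Omega> A :: "(real ^ 'n) set" and \<psi> \<phi> :: "real ^ 'n \<Rightarrow> real"
      assume \<Omega>: "open \<Omega>" "bounded \<Omega>" "lipschitz_boundary \<Omega>" and A: "open A" "A \<subseteq> \<Omega>" and \<psi>: "\<psi> \<in> Linf A"
        and datum: "\<phi> \<in> borel_measurable lebesgue" "\<phi> \<in> Linf (enlarged \<Omega> (\<Theta> * diameter \<Omega>) - \<Omega>)"
      obtain \<phi>' where \<phi>': "\<phi>' \<in> borel_measurable lborel" "AE x in lborel. \<phi> x = \<phi>' x"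
        using completion_ex_borel_measurable_real[OF datum(1)] by blast
      interpret obstacle_setting s \<Omega> \<phi>'
        by unfold_locales (use assms \<Omega> \<phi>'(1) in simp_all)
      define P where "P = enn2real (Linf_norm A \<psi>)"
      have P: "0 \<le> P" by (simp add: P_def)
      have \<psi>P: "AE x in lborel. x \<in> A \<longrightarrow> \<bar>\<psi> x\<bar> \<le> P"
        unfolding P_def by (rule Linf_AE_bound[OF \<psi>]) (use A in simp)
      show "\<exists>u. solves_obstacle s \<Omega> A \<phi> \<psi> u \<and>
         (\<forall>v. solves_obstacle s \<Omega> A \<phi> \<psi> v \<longrightarrow> (AE x in lebesgue. v x = u x)) \<and>
         solves_geometric_obstacle s \<Omega> A \<phi> \<psi> (Sg u UNIV)"
      (* For empty \<Omega> the diameter vanishes and the datum is bounded nowhere, but then it is the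
         only competitor. *)
      proof (cases "\<Omega> = {}")
        case True
        have u: "plateau 0 \<in> competitors" by (rule plateau_competitor)
        have single: "w = plateau 0" if "w \<in> competitors" for w
        proof (rule ext)
          fix x
          have "x \<notin> \<Omega>" using True by simp
          then show "w x = plateau 0 x"
            using competitors_outside[OF that] unfolding plateau_def by (simp only: if_False)
        qed
        have "energy_gap (plateau 0) (plateau 0) = 0" by (simp add: energy_gap_def energy_diff_slope)
        then have min: "energy_gap (plateau 0) v \<le> 0" if "v \<in> competitors" for v
          using single[OF that] by simp
        have "above_obstacle A \<psi> (plateau 0)" using A(2) True by (simp add: above_obstacle_def)
        then show ?thesis
          by (rule minimiser_solves[OF u _ P _ min A(2) \<psi>P \<phi>'(2)]) (use True in simp_all)
      next
        case False
        define S where "S = enlarged \<Omega> (\<Theta> * diameter \<Omega>) - \<Omega>"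
        define B where "B = enn2real (Linf_norm S \<phi>)"
        have S: "S \<in> sets borel"
        proof -
          have "{x \<in> space borel. signed_dist \<Omega> x < \<Theta> * diameter \<Omega>} \<in> sets borel"
            unfolding signed_dist_def by measurable
          then show ?thesis using \<Omega>(1) by (simp add: S_def enlarged_def)
        qed
        have diam: "0 < diameter \<Omega>"
        proof -
          obtain x where x: "x \<in> \<Omega>" using False by blast
          then obtain e where e: "0 < e" "ball x e \<subseteq> \<Omega>" using \<Omega>(1) open_contains_ball by blast
          obtain b :: "real ^ 'n" where b: "b \<in> Basis" using nonempty_Basis by blast
          define y where "y = x + (e / 2) *\<^sub>R b"
          have d: "dist x y = e / 2" using b e(1) by (simp add: y_def dist_norm)
          then have "y \<in> \<Omega>" using e by (auto simp: subset_eq)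
          then have "dist x y \<le> diameter \<Omega>" using \<Omega>(2) x by (rule diameter_bounded_bound[rotated 2])
          then show ?thesis using d e(1) by linarith
        qed
        have bound: "AE y in lborel. y \<notin> \<Omega> \<and> infdist y \<Omega> < \<Theta> * diameter \<Omega> \<longrightarrow> \<bar>\<phi>' y\<bar> \<le> B"
          using Linf_AE_bound[OF datum(2)[folded S_def] S] \<phi>'(2)
          by eventually_elim (auto simp: B_def S_def enlarged_def signed_dist_def)
        interpret bounded_obstacle_setting s \<Omega> \<phi>' B \<Theta>
          by unfold_locales (use \<Theta>2 \<Theta> diam bound in \<open>simp_all add: B_def\<close>)
        define N where "N = max (B + diameter \<Omega>) P"
        have \<psi>N: "AE x in lborel. x \<in> A \<longrightarrow> \<bar>\<psi> x\<bar> \<le> N"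
          using \<psi>P by eventually_elim (auto simp: N_def)
        obtain u where u: "u \<in> competitors" "above_obstacle A \<psi> u" "\<And>x. x \<in> \<Omega> \<Longrightarrow> \<bar>u x\<bar> \<le> N"
          "\<And>v. v \<in> competitors \<Longrightarrow> above_obstacle A \<psi> v \<Longrightarrow> energy_gap u v \<le> 0"
          using minimiser_exists[of N A \<psi>, OF _ A(2) \<psi>N] by (auto simp: N_def)
        have "0 \<le> N" using P by (simp add: N_def)
        then show ?thesis
          by (rule minimiser_solves[OF u(1,2) _ u(3,4) A(2) \<psi>N \<phi>'(2)])
      qed
    qed
  qed
qed

end
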